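(* For $\lambda\geq 0$ let $g_\lambda$ be the unique maximal solution of the initial value problem $$g_\lambda''+2g_\lambda'=g_\lambda^2,\qquad g_\lambda(0)=0,\quad g_\lambda'(0)=-\lambda .$$ The function $g_\lambda$ is defined and non-positive on $[0,\infty)$ for every $\lambda\in[0,2)$. Moreover, for each $\lambda\in[0,1)$ and each $R=e^L>1$, the function $g_\lambda$ has the following probabilistic representation on $[0,L]$: setting $s=g_\lambda(L)$, $$g_\lambda(x)=(e^{-x}R)^2\Big(1-\mathbb{E}_{e^{-x}R,R}\big[(1-s)^{N_1}\big]\Big)\qquad\text{for every }x\in[0,L].$$
   Context: Dimension $d=4$. Critical binary branching Brownian motion: each particle performs a standard Brownian motion in $\mathbb{R}^4$ for an independent exponential lifetime of mean $1$, and is then replaced at its current location by $0$ or $2$ particles with probability $1/2$ each, the offspring evolving independently in the same way. $\mathbb{E}_{\rho,R}$ is the expectation for this process started from a single particle at a point of norm $\rho$, particles being killed upon reaching the sphere of radius $R$ centred at the origin. $N_1$ is the number of pioneers on the closed unit ball $B$ centred at the origin, i.e. the number of points $v$ of the genealogical real tree (particles at given times) whose position lies in $B$ while the positions of all strict ancestors lie outside $B$. (Thus $N_1=0$ when $\rho=R$ and $N_1=1$ when $\rho=1$.) *)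

theory Defs
  imports "HOL-Probability.Probability" "HOL-Library.Sublist"
begin

section \<open>The initial value problem\<close>

text \<open>
  A solution is a function on an open interval \<open>I\<close> containing \<open>0\<close>; requiring
  \<open>g \<in> extensional I\<close> makes the pair \<open>(I, g)\<close> represent the partial function
  with domain \<open>I\<close> uniquely.
\<close>

definition ivp_solution :: "real \<Rightarrow> real set \<Rightarrow> (real \<Rightarrow> real) \<Rightarrow> bool" where
  "ivp_solution lam I g \<longleftrightarrow>
     open I \<and> is_interval I \<and> 0 \<in> I \<and> g \<in> extensional I \<and>
     (\<exists>g' g''.
        (\<forall>x\<in>I. (g has_real_derivative g' x) (at x) \<and>
               (g' has_real_derivative g'' x) (at x) \<and>
               g'' x + 2 * g' x = (g x)\<^sup>2) \<and>
        g 0 = 0 \<and> g' 0 = - lam)"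

definition maximal_solution :: "real \<Rightarrow> real set \<Rightarrow> (real \<Rightarrow> real) \<Rightarrow> bool" where
  "maximal_solution lam I g \<longleftrightarrow>
     ivp_solution lam I g \<and>
     (\<forall>J h. ivp_solution lam J h \<and> I \<subseteq> J \<and> (\<forall>x\<in>I. h x = g x) \<longrightarrow> J = I)"


section \<open>Brownian motion\<close>

locale brownian_motion = prob_space M
  for M :: "'a measure" and X :: "real \<Rightarrow> 'a \<Rightarrow> 'v::euclidean_space" +
  assumes measurable_motion: "0 \<le> t \<Longrightarrow> X t \<in> borel_measurable M"
    and start_at_zero: "\<omega> \<in> space M \<Longrightarrow> X 0 \<omega> = 0"
    and continuous_paths: "\<omega> \<in> space M \<Longrightarrow> continuous_on {0..} (\<lambda>t. X t \<omega>)"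
    and gaussian_increments: "0 \<le> s \<Longrightarrow> s < t \<Longrightarrow>
      distributed M lborel (\<lambda>\<omega>. X t \<omega> - X s \<omega>)
        (\<lambda>x. ennreal (\<Prod>b\<in>Basis. normal_density 0 (sqrt (t - s)) (x \<bullet> b)))"
    and independent_increments: "0 \<le> r 0 \<Longrightarrow> (\<And>i. i < n \<Longrightarrow> r i < r (Suc i)) \<Longrightarrow>
      indep_vars (\<lambda>_. borel) (\<lambda>i \<omega>. X (r (Suc i)) \<omega> - X (r i) \<omega>) {..<n::nat}"


section \<open>Critical binary branching Brownian motion\<close>

text \<open>
  Particles carry Ulam--Harris labels, written with the youngest generation first:
  the children of \<open>u\<close> are \<open>i # u\<close>, so that the ancestors of \<open>u\<close> are its suffixes.
  Every label has a lifetime, a number of children and a motion relative to its place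
  of birth, all of them mutually independent; whether the particle is ever born is
  decided by \<open>born\<close> below.
\<close>

type_synonym label = "nat list"

datatype source = Lifetime label | Offspring label | Motion label

locale critical_binary_bbm = prob_space M
  for M :: "'a measure"
    and life :: "label \<Rightarrow> 'a \<Rightarrow> real"
    and offspring :: "label \<Rightarrow> 'a \<Rightarrow> nat"
    and motion :: "label \<Rightarrow> real \<Rightarrow> 'a \<Rightarrow> 'v::euclidean_space" +
  assumes life_pos: "\<omega> \<in> space M \<Longrightarrow> 0 < life u \<omega>"
    and life_exponential: "distributed M lborel (life u) (exponential_density 1)"
    and offspring_measurable: "offspring u \<in> measurable M (count_space UNIV)"
    and offspring_law:
      "distr M (count_space UNIV) (offspring u) = measure_pmf (pmf_of_set {0, 2})"
    and motion_brownian: "brownian_motion M (motion u)"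
    and independent_sources: "indep_sets
      (\<lambda>c. case c of
          Lifetime u \<Rightarrow> sets (vimage_algebra (space M) (life u) borel)
        | Offspring u \<Rightarrow> sets (vimage_algebra (space M) (offspring u) (count_space UNIV))
        | Motion u \<Rightarrow> sets (vimage_algebra (space M)
            (\<lambda>\<omega>. \<lambda>t\<in>{0..}. motion u t \<omega>) (Pi\<^sub>M {0..} (\<lambda>_. borel)))) UNIV"


section \<open>The genealogical tree and its pioneers\<close>

text \<open>
  From here on everything is a deterministic function of one realisation:
  lifetimes \<open>l\<close>, offspring numbers \<open>k\<close>, relative motions \<open>w\<close> and a starting
  point \<open>z\<close>.
\<close>

primrec birth :: "(label \<Rightarrow> real) \<Rightarrow> label \<Rightarrow> real" where
  "birth l [] = 0"
| "birth l (i # u) = birth l u + l u"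

primrec born :: "(label \<Rightarrow> nat) \<Rightarrow> label \<Rightarrow> bool" where
  "born k [] = True"
| "born k (i # u) = (born k u \<and> i < k u)"

text \<open>
  Position at time \<open>t\<close> of the particle \<open>u\<close> or, before the birth of \<open>u\<close>, of its
  ancestor living at that time.
\<close>

primrec position ::
  "'v::real_vector \<Rightarrow> (label \<Rightarrow> real) \<Rightarrow> (label \<Rightarrow> real \<Rightarrow> 'v) \<Rightarrow> label \<Rightarrow> real \<Rightarrow> 'v"
where
  "position z l w [] t = z + w [] t"
| "position z l w (i # u) t =
     (if t \<le> birth l (i # u) then position z l w u t
      else position z l w u (birth l (i # u)) + w (i # u) (t - birth l (i # u)))"

text \<open>
  A point of the real tree is a pair (particle, time). Life intervals are taken left-open
  and right-closed, so that a branch point is one single point, belonging to the parent;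
  only the root of the tree, at time \<open>0\<close>, has to be added.
\<close>

definition tree :: "(label \<Rightarrow> real) \<Rightarrow> (label \<Rightarrow> nat) \<Rightarrow> (label \<times> real) set" where
  "tree l k = {(u, t). born k u \<and> t \<le> birth l u + l u \<and>
                       (birth l u < t \<or> u = [] \<and> t = 0)}"

definition strict_ancestor :: "label \<times> real \<Rightarrow> label \<times> real \<Rightarrow> bool" where
  "strict_ancestor a v \<longleftrightarrow> suffix (fst a) (fst v) \<and> snd a < snd v"

text \<open>Particles are killed on reaching the sphere of radius \<open>R\<close> about the origin.\<close>

definition killed_tree ::
  "real \<Rightarrow> 'v::real_normed_vector \<Rightarrow> (label \<Rightarrow> real) \<Rightarrow> (label \<Rightarrow> nat) \<Rightarrow>
   (label \<Rightarrow> real \<Rightarrow> 'v) \<Rightarrow> (label \<times> real) set"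
where
  "killed_tree R z l k w =
     {v \<in> tree l k. \<forall>a\<in>tree l k. strict_ancestor a v \<longrightarrow>
        norm (position z l w (fst a) (snd a)) \<noteq> R}"

definition pioneers ::
  "real \<Rightarrow> 'v::real_normed_vector \<Rightarrow> (label \<Rightarrow> real) \<Rightarrow> (label \<Rightarrow> nat) \<Rightarrow>
   (label \<Rightarrow> real \<Rightarrow> 'v) \<Rightarrow> (label \<times> real) set"
where
  "pioneers R z l k w =
     {v \<in> killed_tree R z l k w.
        position z l w (fst v) (snd v) \<in> cball 0 1 \<and>
        (\<forall>a\<in>killed_tree R z l k w. strict_ancestor a v \<longrightarrow>
           position z l w (fst a) (snd a) \<notin> cball 0 1)}"

text \<open>
  The value \<open>card A = 0\<close> for infinite \<open>A\<close> only intervenes on a null event, since the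
  critical branching tree is almost surely finite and each particle contributes at most
  one pioneer.
\<close>

definition num_pioneers ::
  "real \<Rightarrow> 'v::real_normed_vector \<Rightarrow> (label \<Rightarrow> 'a \<Rightarrow> real) \<Rightarrow> (label \<Rightarrow> 'a \<Rightarrow> nat) \<Rightarrow>
   (label \<Rightarrow> real \<Rightarrow> 'a \<Rightarrow> 'v) \<Rightarrow> 'a \<Rightarrow> nat"
where
  "num_pioneers R z life offspring motion \<omega> =
     card (pioneers R z (\<lambda>u. life u \<omega>) (\<lambda>u. offspring u \<omega>) (\<lambda>u t. motion u t \<omega>))"

end

theory Submission
  imports Defs
begin

text \<open>
  Write \<open>f = - g\<close> for the solution. If \<open>lam < 2\<close> then \<open>k x = exp x * f x\<close> is convex as long as it is
  non-negative, so it stays above \<open>lam * x\<close>, while \<open>f' + 2 * f \<le> lam\<close> gives \<open>f \<le> lam / 2\<close>; these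
  bounds make the solution global. In terms of \<open>r = (norm y)\<^sup>2\<close> the function
  \<open>v = 1 + f (L - ln r / 2) / r\<close> satisfies \<open>\<Delta> v + (1 - v)\<^sup>2 = 0\<close> in the annulus, the equation of the
  generating function of the number of pioneers. Dynkin's formula, stopped at the first branching,
  turns this into the recursion satisfied by the generating functions \<open>w n\<close> of the pioneers in the
  first \<open>n\<close> generations, with an inequality for the initial datum; hence \<open>w n \<le> v\<close>. Since
  \<open>f \<le> lam / 2 < 1 / 2\<close>, the function \<open>1 / norm y\<close> is a strict supersolution of the linearised
  equation, and the same formula applied to it shows that \<open>v - w n\<close> is at most
  \<open>\<kappa> ^ n / norm y\<close> for some \<open>\<kappa> < 1\<close>. So \<open>w n\<close> increases to \<open>v\<close>.
\<close>

section \<open>The initial value problem\<close>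

text \<open>The function \<open>1 / norm y\<close> is the extremal power of Hardy's inequality in
  dimension 4: the Laplacian multiplies \<open>norm y\<close> to the power - a by - a * (2 - a) /
  (norm y)^2, and a * (2 - a) has its maximum 1 at a = 1. The linearised equation has potential 2 *
  (v - 1) \<le> lam / r, so the margin of this supersolution is exactly \<open>lam < 1\<close>. The
  comparison with v from below would not identify the limit by itself: u = v - 1 solves a
  superlinear equation, whose nonnegative solutions need not be determined by their boundary values.
  Hence the truncation error has to be controlled. Brownian motion enters through its increments:
  Dynkin's formula comes from a Taylor expansion on a time grid, with error d^(3/2) for a step of
  length d. For an exponential time T of mean 1 the expected integral of a function over [0, T] is
  its expected value at T; this removes the time integral and leaves an identity at the place where
  the first particle exits or dies. As 1 - s \<ge> 1, moments are computed in the extended half-line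
  before they are known to be finite.\<close>

lemma continuous_antiderivative:
  fixes f :: "real \<Rightarrow> 'a::banach"
  assumes "continuous_on UNIV f"
  obtains P where "P 0 = 0" "\<And>x. (P has_vector_derivative f x) (at x)"
proof -
  define P where "P x = integral {0..x} f - integral {x..0} f" for x
  have "P 0 = 0" by (simp add: P_def)
  moreover have "(P has_vector_derivative f x) (at x)" for x
  proof -
  \<comment> \<open>Starting the integral to the left of both \<open>0\<close> and \<open>x\<close>
    turns the two-case definition of \<open>P\<close> near \<open>x\<close> into one integral with
    variable upper limit, up to a constant.\<close>
  define a where "a = min x 0 - 1"
  define b where "b = x + 1"
  have int: "f integrable_on {u..v}" for u v
    by (rule integrable_continuous_real) (rule continuous_on_subset[OF assms], simp)
  have P: "P y = integral {a..y} f - integral {a..0} f" if "y \<ge> a" for y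
  proof (cases "y \<ge> 0")
    case True
    then show ?thesis
      using Henstock_Kurzweil_Integration.integral_combine[of a 0 y f] int
      by (cases "y = 0") (auto simp: P_def a_def algebra_simps)
  next
    case False
    then show ?thesis
      using Henstock_Kurzweil_Integration.integral_combine[of a y 0 f] int that
      by (auto simp: P_def algebra_simps)
  qed
  have "((\<lambda>y. integral {a..y} f - integral {a..0} f) has_vector_derivative f x - 0) (at x within {a..b})"
    by (intro derivative_intros integral_has_vector_derivative continuous_on_subset[OF assms])
      (auto simp: a_def b_def)
  then have "((\<lambda>y. integral {a..y} f - integral {a..0} f) has_vector_derivative f x) (at x within {a..b})"
    by simp
  then have "(P has_vector_derivative f x) (at x within {a..b})"
    by (rule has_vector_derivative_transform[rotated 2]) (auto simp: P a_def b_def)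
  then show "(P has_vector_derivative f x) (at x)"
    by (subst (asm) at_within_interior) (auto simp: a_def b_def)
  qed
  ultimately show ?thesis using that by blast
qed

text \<open>Integration against the weight \<open>exp (c * \<bar>x\<bar>)\<close> gains the factor
  \<open>1 / c\<close>. With \<open>c\<close> twice the Lipschitz constant this becomes the
  contraction factor one half of the Picard map.\<close>

lemma norm_le_exp_of_derivative:
  fixes P :: "real \<Rightarrow> 'a::real_normed_vector"
  assumes P0: "P 0 = 0" and P: "\<And>x. (P has_vector_derivative f x) (at x)"
    and f: "\<And>x. norm (f x) \<le> A * exp (c * \<bar>x\<bar>)" and c: "c > 0"
  shows "norm (P x) \<le> A / c * exp (c * \<bar>x\<bar>)"
proof -
  have A: "A \<ge> 0" using order_trans[OF norm_ge_zero f[of 0]] by simp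
  have *: "norm (Q x) \<le> A / c * exp (c * x)"
    if Q0: "Q 0 = 0" and Q: "\<And>x. (Q has_vector_derivative q x) (at x)"
      and q: "\<And>x. norm (q x) \<le> A * exp (c * \<bar>x\<bar>)" and x: "x \<ge> 0"
    for Q q :: "real \<Rightarrow> 'a" and x
  proof (cases "x = 0")
    case True
    then show ?thesis using A c Q0 by simp
  next
    case False
    then have x: "x > 0" using x by simp
    have "norm (Q x - Q 0) \<le> A / c * exp (c * x) - A / c * exp (c * 0)"
    proof (rule differentiable_bound_general[where f' = q and \<phi>' = "\<lambda>x. A * exp (c * x)"])
      show "0 < x" by fact
      show "continuous_on {0..x} Q"
        using Q by (intro continuous_at_imp_continuous_on) (auto intro: has_vector_derivative_continuous)
      show "continuous_on {0..x} (\<lambda>a. A / c * exp (c * a))" by (intro continuous_intros)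
      show "((\<lambda>a. A / c * exp (c * a)) has_vector_derivative A * exp (c * y)) (at y)" for y
        unfolding has_real_derivative_iff_has_vector_derivative[symmetric]
        using c by (auto intro!: derivative_eq_intros)
      show "norm (q y) \<le> A * exp (c * y)" if "0 < y" for y using q[of y] that by simp
    qed (rule Q)
    then have "norm (Q x) \<le> A / c * exp (c * x) - A / c" using Q0 by simp
    moreover have "A / c \<ge> 0" using A c by simp
    ultimately show ?thesis by linarith
  qed
  show ?thesis
  proof (cases "x \<ge> 0")
    case True
    then show ?thesis using *[OF P0 P f True] by simp
  next
    case False
    \<comment> \<open>The negative half-line reduces to the positive one by reflecting
      \<open>P\<close>.\<close>
    have "((\<lambda>x. P (- x)) has_vector_derivative - f (- y)) (at y)" for y
    proof -
      have "(uminus has_vector_derivative - 1) (at y)" by (auto intro!: derivative_eq_intros)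
      from vector_diff_chain_at[OF this P] show ?thesis by (simp add: o_def)
    qed
    from *[of "\<lambda>x. P (- x)", OF _ this, of "- x"] False f[of "- _"] P0
    show ?thesis by (metis abs_minus_cancel abs_of_neg neg_0_le_iff_le nle_le norm_minus_cancel not_less minus_minus minus_zero)
  qed
qed

text \<open>Picard iteration is a contraction for the norm weighted by \<open>exp (- 2 * K * \<bar>x\<bar>)\<close>,
  which makes the solution global at once.\<close>

lemma lipschitz_ode_global_solution:
  fixes F :: "'a::banach \<Rightarrow> 'a"
  assumes lip: "\<And>x y. norm (F x - F y) \<le> K * norm (x - y)"
  obtains Y where "Y 0 = y0" "\<And>x. (Y has_vector_derivative F (Y x)) (at (x::real))"
proof -
  \<comment> \<open>The maximum keeps the divisions by \<open>C\<close> legitimate when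
    \<open>K\<close> is not positive.\<close>
  define C where "C = max K 1"
  have C: "C > 0" and lipC: "norm (F x - F y) \<le> C * norm (x - y)" for x y
  proof -
    show "C > 0" by (simp add: C_def)
    have "K * norm (x - y) \<le> C * norm (x - y)" by (intro mult_right_mono) (auto simp: C_def)
    with lip[of x y] show "norm (F x - F y) \<le> C * norm (x - y)" by linarith
  qed
  define e where "e x = exp (2 * C * \<bar>x\<bar>)" for x :: real
  have e_pos: "e x > 0" for x by (simp add: e_def)
  have e_ge1: "e x \<ge> 1" for x using C by (simp add: e_def)
  have cont_e: "continuous_on S e" for S unfolding e_def by (intro continuous_intros)
  have contF: "continuous_on S F" for S
    by (rule lipschitz_on_continuous_on[where L = C])
      (auto simp: lipschitz_on_def dist_norm lipC C less_imp_le)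
  \<comment> \<open>\<open>Z\<close> stands for the solution divided by the weight \<open>e\<close>,
    which is bounded. Bounded continuous functions form a complete space, and undoing the weight
    inside \<open>F\<close> restores the true right-hand side.\<close>
  define G where "G Z = (\<lambda>x. F (e x *\<^sub>R apply_bcontfun Z x))" for Z :: "real \<Rightarrow>\<^sub>C 'a"
  have contG: "continuous_on UNIV (G Z)" for Z
    unfolding G_def
    by (rule continuous_on_compose2[OF contF[of UNIV]])
      (intro continuous_on_scaleR cont_e continuous_on_apply_bcontfun, simp)
  define P where "P Z = (SOME P. P 0 = 0 \<and> (\<forall>x. (P has_vector_derivative G Z x) (at x)))" for Z
  have "P Z 0 = 0 \<and> (\<forall>x. (P Z has_vector_derivative G Z x) (at x))" for Z
  proof -
    have "\<exists>P. P 0 = 0 \<and> (\<forall>x. (P has_vector_derivative G Z x) (at x))"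
      by (rule continuous_antiderivative[OF contG[of Z]]) blast
    from someI_ex[OF this] show ?thesis unfolding P_def .
  qed
  then have P0: "P Z 0 = 0" and P: "(P Z has_vector_derivative G Z x) (at x)" for Z x by auto
  have contP: "continuous_on S (P Z)" for S Z
    using P by (intro continuous_at_imp_continuous_on) (auto intro: has_vector_derivative_continuous)
  have bound: "norm (P Z x) \<le> (norm (F 0) + C * norm Z) / (2 * C) * e x" for Z x
    unfolding e_def
  proof (rule norm_le_exp_of_derivative[OF P0 P])
    fix x
    have "norm (G Z x) \<le> norm (F 0) + norm (F (e x *\<^sub>R apply_bcontfun Z x) - F 0)"
      unfolding G_def by norm
    also have "\<dots> \<le> norm (F 0) + C * norm (e x *\<^sub>R apply_bcontfun Z x - 0)"
      by (intro add_left_mono lipC)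
    also have "\<dots> \<le> norm (F 0) * e x + C * (e x * norm Z)"
      using e_ge1[of x] e_pos[of x] C norm_bounded[of Z x]
      by (intro add_mono mult_left_mono) (simp_all add: mult_le_cancel_left1)
    finally show "norm (G Z x) \<le> (norm (F 0) + C * norm Z) * exp (2 * C * \<bar>x\<bar>)"
      by (simp add: e_def algebra_simps)
  qed (use C in simp)
  define T where "T Z = Bcontfun (\<lambda>x. inverse (e x) *\<^sub>R (y0 + P Z x))" for Z
  have T: "apply_bcontfun (T Z) = (\<lambda>x. inverse (e x) *\<^sub>R (y0 + P Z x))" for Z
    unfolding T_def
  proof (rule Bcontfun_inverse, rule bcontfun_normI)
    have "e x \<noteq> 0" for x using e_pos[of x] by simp
    then show "continuous_on UNIV (\<lambda>x. inverse (e x) *\<^sub>R (y0 + P Z x))"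
      by (intro continuous_intros cont_e contP) auto
    fix x
    have "norm (y0 + P Z x) \<le> norm y0 * e x + (norm (F 0) + C * norm Z) / (2 * C) * e x"
      using bound[of Z x] e_ge1[of x]
      by (intro order_trans[OF norm_triangle_ineq] add_mono) (auto simp: mult_le_cancel_left1)
    then have "norm (y0 + P Z x) \<le> (norm y0 + (norm (F 0) + C * norm Z) / (2 * C)) * e x"
      by (simp add: algebra_simps)
    then have "norm (y0 + P Z x) / e x \<le> norm y0 + (norm (F 0) + C * norm Z) / (2 * C)"
      using e_pos[of x] by (simp only: pos_divide_le_eq)
    moreover have "norm (inverse (e x) *\<^sub>R v) = norm v / e x" for v :: 'a
      using e_pos[of x] by (simp add: divide_inverse)
    ultimately show "norm (inverse (e x) *\<^sub>R (y0 + P Z x)) \<le> norm y0 + (norm (F 0) + C * norm Z) / (2 * C)"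
      by metis
  qed
  have "\<exists>!Z. T Z = Z"
  proof (rule banach_fix_type[where c = "1/2"])
    show "\<forall>Z W. dist (T Z) (T W) \<le> 1/2 * dist Z W"
    proof (intro allI)
      fix Z W
      have "norm (P Z x - P W x) \<le> C * dist Z W / (2 * C) * e x" for x
        unfolding e_def
      proof (rule norm_le_exp_of_derivative[where f = "\<lambda>x. G Z x - G W x"])
        show "((\<lambda>x. P Z x - P W x) has_vector_derivative G Z x - G W x) (at x)" for x
          by (intro derivative_intros P)
        fix x
        have "norm (G Z x - G W x) \<le> C * norm (e x *\<^sub>R apply_bcontfun Z x - e x *\<^sub>R apply_bcontfun W x)"
          unfolding G_def by (rule lipC)
        also have "\<dots> = C * (e x * dist (apply_bcontfun Z x) (apply_bcontfun W x))"
          using e_pos[of x] by (simp add: scaleR_diff_right[symmetric] dist_norm)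
        also have "\<dots> \<le> C * (e x * dist Z W)"
          using C e_pos[of x] by (intro mult_left_mono dist_bounded) auto
        finally show "norm (G Z x - G W x) \<le> C * dist Z W * exp (2 * C * \<bar>x\<bar>)"
          by (simp add: e_def algebra_simps)
      qed (use C P0 in auto)
      note PZW = this
      have "dist (apply_bcontfun (T Z) x) (apply_bcontfun (T W) x) \<le> 1/2 * dist Z W" for x
      proof -
        have "dist (apply_bcontfun (T Z) x) (apply_bcontfun (T W) x) = inverse (e x) * norm (P Z x - P W x)"
          using e_pos[of x] unfolding T dist_norm scaleR_diff_right[symmetric] by simp
        also have "\<dots> \<le> inverse (e x) * (C * dist Z W / (2 * C) * e x)"
          using e_pos[of x] PZW[of x] by (intro mult_left_mono) auto
        also have "\<dots> = 1/2 * dist Z W" using C e_pos[of x] by simp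
        finally show ?thesis .
      qed
      then show "dist (T Z) (T W) \<le> 1/2 * dist Z W" by (rule dist_bound)
    qed
  qed auto
  then obtain Z where Z: "T Z = Z" by auto
  define Y where "Y x = y0 + P Z x" for x
  have "apply_bcontfun Z x = inverse (e x) *\<^sub>R Y x" for x
    using T[of Z] Z by (simp add: Y_def)
  then have "G Z x = F (Y x)" for x
    using e_pos[of x] by (simp add: G_def)
  then have "(Y has_vector_derivative F (Y x)) (at x)" for x
    using P[of Z x] unfolding Y_def by (auto intro!: derivative_eq_intros)
  moreover have "Y 0 = y0" using P0 by (simp add: Y_def)
  ultimately show ?thesis using that by blast
qed

lemma gronwall_zero:
  fixes E :: "real \<Rightarrow> real"
  assumes x: "x \<ge> 0" and E0: "E 0 = 0" and E_nonneg: "E x \<ge> 0"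
    and E: "\<And>t. t \<in> {0..x} \<Longrightarrow> (E has_real_derivative E' t) (at t)"
    and le: "\<And>t. t \<in> {0..x} \<Longrightarrow> E' t \<le> C * E t"
  shows "E x = 0"
proof -
  have "exp (- C * x) * E x \<le> exp (- C * 0) * E 0"
  proof (rule DERIV_nonpos_imp_nonincreasing[OF x])
    fix t assume t: "0 \<le> t" "t \<le> x"
    have "((\<lambda>t. exp (- C * t) * E t) has_real_derivative exp (- C * t) * (E' t - C * E t)) (at t)"
      using E[of t] t by (auto intro!: derivative_eq_intros simp: algebra_simps)
    moreover have "exp (- C * t) * (E' t - C * E t) \<le> 0"
      using le[of t] t by (simp add: mult_le_0_iff)
    ultimately show "\<exists>y. ((\<lambda>t. exp (- C * t) * E t) has_real_derivative y) (at t) \<and> y \<le> 0" by blast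
  qed
  then show ?thesis using E0 E_nonneg by (simp add: mult_le_0_iff)
qed

text \<open>Gronwall's inequality for the squared distance between the pairs (value, derivative) of
  the two solutions. The segment from \<open>0\<close> to \<open>x\<close> lies in both domains
  because these are intervals, so all estimates are on a compact set.\<close>

lemma ivp_solution_unique:
  assumes g: "ivp_solution lam I g" and h: "ivp_solution lam J h" and x: "x \<in> I" "x \<in> J"
  shows "g x = h x"
proof -
  from g obtain g1 g2 where g': "\<And>x. x \<in> I \<Longrightarrow> (g has_real_derivative g1 x) (at x)"
      "\<And>x. x \<in> I \<Longrightarrow> (g1 has_real_derivative g2 x) (at x)"
      "\<And>x. x \<in> I \<Longrightarrow> g2 x + 2 * g1 x = (g x)\<^sup>2" "g 0 = 0" "g1 0 = - lam"
    and I: "is_interval I" "0 \<in> I"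
    unfolding ivp_solution_def by blast
  from h obtain h1 h2 where h': "\<And>x. x \<in> J \<Longrightarrow> (h has_real_derivative h1 x) (at x)"
      "\<And>x. x \<in> J \<Longrightarrow> (h1 has_real_derivative h2 x) (at x)"
      "\<And>x. x \<in> J \<Longrightarrow> h2 x + 2 * h1 x = (h x)\<^sup>2" "h 0 = 0" "h1 0 = - lam"
    and J: "is_interval J" "0 \<in> J"
    unfolding ivp_solution_def by blast
  let ?S = "{min 0 x..max 0 x}"
  have S: "t \<in> I" "t \<in> J" if "t \<in> ?S" for t
    using I J x that unfolding is_interval_1
    by (metis atLeastAtMost_iff max_def min_def)+
  define E where "E t = (g t - h t)\<^sup>2 + (g1 t - h1 t)\<^sup>2" for t
  define E' where "E' t = 2 * (g t - h t) * (g1 t - h1 t) + 2 * (g1 t - h1 t) * (g2 t - h2 t)" for t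
  have E: "(E has_real_derivative E' t) (at t)" if "t \<in> ?S" for t
    unfolding E_def E'_def
    by (rule derivative_eq_intros g' h' S that refl)+ (simp add: algebra_simps)
  \<comment> \<open>The difference of the squares is \<open>(g + h) * (g - h)\<close>, so a bound on
    \<open>g + h\<close> over the segment serves as a local Lipschitz constant.\<close>
  have "continuous_on ?S (\<lambda>t. g t + h t)"
    by (intro continuous_at_imp_continuous_on ballI continuous_intros DERIV_isCont[OF g'(1)]
        DERIV_isCont[OF h'(1)] S)
  then have "bounded ((\<lambda>t. g t + h t) ` ?S)"
    by (intro compact_imp_bounded compact_continuous_image) auto
  then obtain B where B: "\<And>t. t \<in> ?S \<Longrightarrow> \<bar>g t + h t\<bar> \<le> B"
    unfolding bounded_iff real_norm_def by blast
  \<comment> \<open>The absolute value is bounded because Gronwall is applied forwards for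
    \<open>x \<ge> 0\<close> and to the reflected function for \<open>x < 0\<close>.\<close>
  have bound: "\<bar>E' t\<bar> \<le> (5 + B) * E t" if t: "t \<in> ?S" for t
  proof -
    define d p where "d = g t - h t" and "p = g1 t - h1 t"
    have "g2 t - h2 t = (g t + h t) * d - 2 * p"
      using g'(3)[of t] h'(3)[of t] S[OF t] by (simp add: d_def p_def power2_eq_square algebra_simps)
    then have eq: "E' t = 2 * d * p + 2 * p * ((g t + h t) * d - 2 * p)"
      unfolding E'_def by (simp only: d_def[symmetric] p_def[symmetric])
    have "E' t = 2 * d * p + (g t + h t) * (2 * d * p) - 4 * p\<^sup>2"
      unfolding eq by (simp add: power2_eq_square algebra_simps)
    then have 1: "\<bar>E' t\<bar> \<le> \<bar>2 * d * p\<bar> + \<bar>g t + h t\<bar> * \<bar>2 * d * p\<bar> + 4 * p\<^sup>2"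
      using abs_triangle_ineq4[of "2 * d * p + (g t + h t) * (2 * d * p)" "4 * p\<^sup>2"]
        abs_triangle_ineq[of "2 * d * p" "(g t + h t) * (2 * d * p)"]
      by (simp add: abs_mult)
    have 2: "\<bar>2 * d * p\<bar> \<le> d\<^sup>2 + p\<^sup>2"
      using sum_squares_bound[of d p] sum_squares_bound[of "-d" p] by (simp add: abs_if)
    have 3: "\<bar>g t + h t\<bar> * \<bar>2 * d * p\<bar> \<le> B * (d\<^sup>2 + p\<^sup>2)"
      using 2 B[OF t] by (intro mult_mono) auto
    have "(5 + B) * E t = 5 * d\<^sup>2 + 5 * p\<^sup>2 + B * (d\<^sup>2 + p\<^sup>2)"
      unfolding E_def d_def[symmetric] p_def[symmetric] by (simp only: algebra_simps)
    with 1 2 3 show ?thesis using zero_le_power2[of d] zero_le_power2[of p] by linarith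
  qed
  have "E x = 0"
  proof (cases "x \<ge> 0")
    case True
    show ?thesis
    proof (rule gronwall_zero[OF True])
      show "E 0 = 0" using g' h' by (simp add: E_def)
      show "E x \<ge> 0" by (simp add: E_def)
      show "(E has_real_derivative E' t) (at t)" if "t \<in> {0..x}" for t using that by (intro E) auto
      show "E' t \<le> (5 + B) * E t" if "t \<in> {0..x}" for t
      proof -
        have "\<bar>E' t\<bar> \<le> (5 + B) * E t" using that by (intro bound) auto
        then show ?thesis by linarith
      qed
    qed
  next
    case False
    have "E (- (- x)) = 0"
    proof (rule gronwall_zero[where x = "- x" and E = "\<lambda>t. E (- t)"])
      show "- x \<ge> 0" using False by simp
      show "E (- 0) = 0" using g' h' by (simp add: E_def)
      show "E (- (- x)) \<ge> 0" by (simp add: E_def)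
      show "((\<lambda>t. E (- t)) has_real_derivative - E' (- t)) (at t)" if "t \<in> {0..- x}" for t
      proof -
        have "(uminus has_real_derivative - 1) (at t)" by (auto intro!: derivative_eq_intros)
        moreover have "(E has_real_derivative E' (- t)) (at (- t))" using that by (intro E) auto
        ultimately show ?thesis by (auto dest: DERIV_chain2)
      qed
      show "- E' (- t) \<le> (5 + B) * E (- t)" if "t \<in> {0..- x}" for t
      proof -
        have "\<bar>E' (- t)\<bar> \<le> (5 + B) * E (- t)" using that by (intro bound) auto
        then show ?thesis by linarith
      qed
    qed
    then show ?thesis by simp
  qed
  then have "(g x - h x)\<^sup>2 \<le> 0" unfolding E_def using zero_le_power2[of "g1 x - h1 x"] by linarith
  then show ?thesis by simp
qed

section \<open>Local solutions through a truncated nonlinearity\<close>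

text \<open>Truncation at 1 makes the nonlinearity globally Lipschitz. It is inactive near 0 for
  every \<open>lam\<close>, as \<open>y 0 = 0\<close>, and on all of \<open>[0, \<infinity>)\<close>
  for \<open>0 \<le> lam < 2\<close>, where the solution stays in
  \<open>[- lam / 2, 0]\<close>.\<close>

definition clamp_square :: "real \<Rightarrow> real" where
  "clamp_square y = (max (-1) (min 1 y))\<^sup>2"

lemma clamp_square_eq: "\<bar>y\<bar> \<le> 1 \<Longrightarrow> clamp_square y = y\<^sup>2"
  by (simp add: clamp_square_def)

lemma clamp_square_nonneg: "clamp_square y \<ge> 0"
  by (simp add: clamp_square_def)

text \<open>For \<open>y \<le> 0\<close> this yields \<open>- y - clamp_square y \<ge> 0\<close>,
  the sign behind the convexity of \<open>- exp x * y x\<close>.\<close>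

lemma clamp_square_le: "clamp_square y \<le> \<bar>y\<bar>"
proof -
  define c where "c = \<bar>max (-1) (min 1 y)\<bar>"
  have "c * c \<le> 1 * c" unfolding c_def by (intro mult_right_mono) auto
  moreover have "c \<le> \<bar>y\<bar>" unfolding c_def by auto
  ultimately show ?thesis unfolding clamp_square_def c_def by (simp add: power2_eq_square flip: abs_mult)
qed

lemma clamp_square_lipschitz: "\<bar>clamp_square x - clamp_square y\<bar> \<le> 2 * \<bar>x - y\<bar>"
proof -
  define c where "c y = max (-1) (min 1 y)" for y :: real
  have "\<bar>clamp_square x - clamp_square y\<bar> = \<bar>c x + c y\<bar> * \<bar>c x - c y\<bar>"
    by (simp add: clamp_square_def c_def[symmetric] power2_eq_square algebra_simps flip: abs_mult)
  also have "\<dots> \<le> 2 * \<bar>x - y\<bar>"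
    unfolding c_def by (intro mult_mono) auto
  finally show ?thesis .
qed

lemma clamped_ivp_global_solution:
  obtains y p :: "real \<Rightarrow> real" where "y 0 = 0" "p 0 = - lam"
    "\<And>x. (y has_real_derivative p x) (at x)"
    "\<And>x. (p has_real_derivative clamp_square (y x) - 2 * p x) (at x)"
proof -
  define F where "F = (\<lambda>(y, p). (p, clamp_square y - 2 * p))"
  have "norm (F a - F b) \<le> 5 * norm (a - b)" for a b
  proof -
    obtain y p z q where ab: "a = (y, p)" "b = (z, q)" by fastforce
    have "norm (F a - F b) \<le> \<bar>p - q\<bar> + \<bar>(clamp_square y - clamp_square z) - 2 * (p - q)\<bar>"
      unfolding F_def ab by (auto simp: algebra_simps intro!: order_trans[OF norm_Pair_le])
    also have "\<dots> \<le> 3 * \<bar>p - q\<bar> + 2 * \<bar>y - z\<bar>"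
      using clamp_square_lipschitz[of y z] by (simp add: abs_if split: if_splits)
    also have "\<dots> \<le> 5 * norm (a - b)"
      using norm_fst_le[of "y - z" "p - q"] norm_snd_le[of "p - q" "y - z"] by (simp add: ab)
    finally show ?thesis .
  qed
  then obtain Y where Y: "Y 0 = (0, - lam)" "\<And>x. (Y has_vector_derivative F (Y x)) (at (x::real))"
    using lipschitz_ode_global_solution[of F 5 "(0, - lam)"] by blast
  show ?thesis
  proof (rule that[of "\<lambda>x. fst (Y x)" "\<lambda>x. snd (Y x)"])
    fix x
    have D: "(Y has_derivative (\<lambda>t. t *\<^sub>R F (Y x))) (at x)"
      using Y(2)[of x] by (simp add: has_vector_derivative_def)
    show "((\<lambda>x. fst (Y x)) has_real_derivative snd (Y x)) (at x)"
      using has_derivative_fst[OF D]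
      by (simp add: has_field_derivative_def F_def case_prod_beta mult_commute_abs)
    show "((\<lambda>x. snd (Y x)) has_real_derivative clamp_square (fst (Y x)) - 2 * snd (Y x)) (at x)"
      using has_derivative_snd[OF D]
      by (simp add: has_field_derivative_def F_def case_prod_beta mult_commute_abs)
  qed (simp_all add: Y)
qed

lemma ivp_solution_of_clamped:
  assumes "y 0 = 0" "p 0 = - lam" and y: "\<And>x. (y has_real_derivative p x) (at x)"
    and p: "\<And>x. (p has_real_derivative clamp_square (y x) - 2 * p x) (at x)"
    and I: "open I" "is_interval I" "0 \<in> I" and small: "\<And>x. x \<in> I \<Longrightarrow> \<bar>y x\<bar> \<le> 1"
  shows "ivp_solution lam I (restrict y I)"
proof -
  have
    "(\<forall>x\<in>I. (restrict y I has_real_derivative p x) (at x) \<and>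
       (p has_real_derivative clamp_square (y x) - 2 * p x) (at x) \<and>
       clamp_square (y x) - 2 * p x + 2 * p x = (restrict y I x)\<^sup>2) \<and> restrict y I 0 = 0 \<and> p 0 = - lam"
  proof (intro conjI ballI)
    fix x assume x: "x \<in> I"
    show "(restrict y I has_real_derivative p x) (at x)"
      by (rule has_field_derivative_transform_within_open[OF y I(1) x]) simp
    show "(p has_real_derivative clamp_square (y x) - 2 * p x) (at x)" by (rule p)
    show "clamp_square (y x) - 2 * p x + 2 * p x = (restrict y I x)\<^sup>2"
      using clamp_square_eq[OF small[OF x]] x by simp
  qed (use assms in auto)
  then have "\<exists>g' g''. (\<forall>x\<in>I. (restrict y I has_real_derivative g' x) (at x) \<and>
       (g' has_real_derivative g'' x) (at x) \<and>
       g'' x + 2 * g' x = (restrict y I x)\<^sup>2) \<and> restrict y I 0 = 0 \<and> g' 0 = - lam"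
    by (intro exI[where x = p] exI[where x = "\<lambda>x. clamp_square (y x) - 2 * p x"])
  then show ?thesis
    unfolding ivp_solution_def using I by auto
qed

text \<open>The domain of a solution is open around 0, so a small interval to the left of 0 has to
  be covered even when the estimates concern \<open>x \<ge> 0\<close>.\<close>

lemma ex_ball_small:
  fixes y :: "real \<Rightarrow> real"
  assumes "isCont y 0" "y 0 = 0"
  obtains e where "e > 0" "\<And>x. \<bar>x\<bar> < e \<Longrightarrow> \<bar>y x\<bar> \<le> 1"
proof -
  have "(y \<longlongrightarrow> 0) (at 0)" using assms by (simp add: isCont_def)
  from tendstoD[OF this, of 1] obtain e where "e > 0" "\<And>x. x \<noteq> 0 \<Longrightarrow> \<bar>x\<bar> < e \<Longrightarrow> \<bar>y x\<bar> < 1"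
    by (auto simp: eventually_at dist_real_def)
  then show ?thesis using assms(2) by (intro that[of e]) (metis abs_zero less_eq_real_def zero_le_one)+
qed

lemma ex_ivp_solution: "\<exists>I g. ivp_solution lam I g"
proof -
  obtain y p where yp: "y 0 = 0" "p 0 = - lam" "\<And>x. (y has_real_derivative p x) (at x)"
    "\<And>x. (p has_real_derivative clamp_square (y x) - 2 * p x) (at x)"
    by (rule clamped_ivp_global_solution[of lam]) (rule that)
  obtain e where e: "e > 0" "\<And>x. \<bar>x\<bar> < e \<Longrightarrow> \<bar>y x\<bar> \<le> 1"
    using ex_ball_small[of y] yp(1,3) DERIV_isCont by blast
  have "ivp_solution lam {-e<..<e} (restrict y {-e<..<e})"
    by (rule ivp_solution_of_clamped[where p = p]) (use yp e in \<open>auto simp: is_interval_oo\<close>)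
  then show ?thesis by blast
qed

section \<open>The maximal solution\<close>

definition ivp_domain :: "real \<Rightarrow> real set" where
  "ivp_domain lam = \<Union>{I. \<exists>g. ivp_solution lam I g}"

text \<open>Two solutions agree wherever both are defined, so the description picks their common
  value and patches all solutions together.\<close>

definition ivp_max :: "real \<Rightarrow> real \<Rightarrow> real" where
  "ivp_max lam = (\<lambda>x\<in>ivp_domain lam. THE y. \<exists>I g. ivp_solution lam I g \<and> x \<in> I \<and> y = g x)"

lemma ivp_max_eq:
  assumes "ivp_solution lam I g" "x \<in> I"
  shows "ivp_max lam x = g x"
proof -
  have "(THE y. \<exists>I g. ivp_solution lam I g \<and> x \<in> I \<and> y = g x) = g x"
  proof (rule the_equality)
    show "\<exists>I h. ivp_solution lam I h \<and> x \<in> I \<and> g x = h x" using assms by blast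
    show "y = g x" if "\<exists>I h. ivp_solution lam I h \<and> x \<in> I \<and> y = h x" for y
      using that ivp_solution_unique[OF assms(1) _ assms(2)] by metis
  qed
  then show ?thesis using assms by (auto simp: ivp_max_def ivp_domain_def)
qed

lemma ivp_solution_ivp_max: "ivp_solution lam (ivp_domain lam) (ivp_max lam)"
proof -
  let ?S = "{I. \<exists>g. ivp_solution lam I g}"
  have ne: "\<exists>I\<in>?S. 0 \<in> I" using ex_ivp_solution[of lam] by (auto simp: ivp_solution_def)
  have op: "open (ivp_domain lam)"
    by (auto simp: ivp_domain_def ivp_solution_def intro!: open_Union)
  have "connected (ivp_domain lam)" unfolding ivp_domain_def
  proof (rule connected_Union)
    show "connected s" if "s \<in> ?S" for s
      using that by (auto simp: ivp_solution_def is_interval_connected_1)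
    have "0 \<in> \<Inter> ?S" by (auto simp: ivp_solution_def)
    then show "\<Inter> ?S \<noteq> {}" by blast
  qed
  then have intv: "is_interval (ivp_domain lam)" by (simp add: is_interval_connected_1)
  have zero: "0 \<in> ivp_domain lam" using ne by (auto simp: ivp_domain_def)
  define d where "d = deriv (ivp_max lam)"
  have D: "(ivp_max lam has_real_derivative d x) (at x)"
      "(d has_real_derivative (deriv d) x) (at x)"
      "deriv d x + 2 * d x = (ivp_max lam x)\<^sup>2" "x = 0 \<Longrightarrow> ivp_max lam x = 0 \<and> d x = - lam"
    if "x \<in> ivp_domain lam" for x
  proof -
    from that obtain I g where Ig: "ivp_solution lam I g" "x \<in> I" by (auto simp: ivp_domain_def)
    from Ig obtain g1 g2 where g: "\<And>x. x \<in> I \<Longrightarrow> (g has_real_derivative g1 x) (at x)"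
      "\<And>x. x \<in> I \<Longrightarrow> (g1 has_real_derivative g2 x) (at x)"
      "\<And>x. x \<in> I \<Longrightarrow> g2 x + 2 * g1 x = (g x)\<^sup>2" "g 0 = 0" "g1 0 = - lam" and I: "open I"
      unfolding ivp_solution_def by blast
    have 1: "(ivp_max lam has_real_derivative g1 t) (at t)" if "t \<in> I" for t
      by (rule has_field_derivative_transform_within_open[OF g(1) I])
        (use that Ig in \<open>auto simp: ivp_max_eq\<close>)
    then have d: "d t = g1 t" if "t \<in> I" for t
      unfolding d_def by (simp add: DERIV_imp_deriv that)
    have 2: "(d has_real_derivative g2 t) (at t)" if "t \<in> I" for t
      by (rule has_field_derivative_transform_within_open[OF g(2) I])
        (use that d in auto)
    have dd: "deriv d x = g2 x" using 2[OF Ig(2)] by (rule DERIV_imp_deriv)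
    show "(ivp_max lam has_real_derivative d x) (at x)" using 1[OF Ig(2)] d[OF Ig(2)] by simp
    show "(d has_real_derivative (deriv d) x) (at x)" using 2[OF Ig(2)] dd by simp
    show "deriv d x + 2 * d x = (ivp_max lam x)\<^sup>2"
      using g(3)[OF Ig(2)] by (simp add: dd d Ig ivp_max_eq[OF Ig])
    show "x = 0 \<Longrightarrow> ivp_max lam x = 0 \<and> d x = - lam"
      using g(4,5) d[OF Ig(2)] ivp_max_eq[OF Ig] by simp
  qed
  show ?thesis
    unfolding ivp_solution_def
  proof (intro conjI)
    show "\<exists>g' g''. (\<forall>x\<in>ivp_domain lam. (ivp_max lam has_real_derivative g' x) (at x) \<and>
        (g' has_real_derivative g'' x) (at x) \<and> g'' x + 2 * g' x = (ivp_max lam x)\<^sup>2) \<and>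
        ivp_max lam 0 = 0 \<and> g' 0 = - lam"
      using D(1-3) D(4)[OF zero refl] by blast
    show "ivp_max lam \<in> extensional (ivp_domain lam)" by (simp add: ivp_max_def)
  qed (use op intv zero in auto)
qed

text \<open>Every solution lives on a part of \<open>ivp_domain lam\<close> and is extended by
  \<open>ivp_max lam\<close>, so maximality forces equality. Existence and uniqueness are both read
  off from this characterisation.\<close>

lemma maximal_solution_iff:
  "maximal_solution lam I g \<longleftrightarrow> I = ivp_domain lam \<and> g = ivp_max lam"
proof
  assume max: "maximal_solution lam I g"
  then have sol: "ivp_solution lam I g" by (simp add: maximal_solution_def)
  then have "I \<subseteq> ivp_domain lam" by (auto simp: ivp_domain_def)
  then have I: "ivp_domain lam = I"
    using max ivp_solution_ivp_max ivp_max_eq[OF sol] unfolding maximal_solution_def by blast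
  moreover have "g = ivp_max lam"
    by (rule extensionalityI[of _ I])
      (use sol ivp_solution_ivp_max[of lam] I ivp_max_eq[OF sol] in \<open>auto simp: ivp_solution_def\<close>)
  ultimately show "I = ivp_domain lam \<and> g = ivp_max lam" by simp
next
  assume "I = ivp_domain lam \<and> g = ivp_max lam"
  then show "maximal_solution lam I g"
    using ivp_solution_ivp_max[of lam] by (auto simp: maximal_solution_def ivp_domain_def)
qed

section \<open>Sign and size of the solution for lam < 2\<close>

text \<open>As long as \<open>y \<le> 0\<close>, convexity gives
  \<open>- exp x * y x \<ge> lam * x\<close>, so \<open>y\<close> is strictly negative after 0 and
  the inequality can be continued. With the lower bound the truncation is never active, so the
  global solution of the truncated equation solves the original one.\<close>

lemma ivp_global_bounds:
  assumes lam: "0 \<le> lam" "lam < 2"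
  shows "\<exists>J g. ivp_solution lam J g \<and> {0..} \<subseteq> J \<and> (\<forall>x\<ge>0. - lam / 2 \<le> g x \<and> g x \<le> 0)"
\<comment> \<open>The continuation argument needs a strictly negative initial slope; for
  \<open>lam = 0\<close> the solution is zero.\<close>
proof (cases "lam = 0")
  case True
  have "ivp_solution 0 UNIV (\<lambda>_. 0)"
    by (auto simp: ivp_solution_def intro!: exI[of _ "\<lambda>_. 0"])
  with True show ?thesis by (intro exI[of _ UNIV] exI[of _ "\<lambda>_. 0"]) auto
next
  case False
  with lam have lam: "0 < lam" "lam < 2" by auto
  obtain y p where yp: "y 0 = 0" "p 0 = - lam" and y: "\<And>x. (y has_real_derivative p x) (at x)"
    and p: "\<And>x. (p has_real_derivative clamp_square (y x) - 2 * p x) (at x)"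
    by (rule clamped_ivp_global_solution[of lam]) (rule that)
  have cy: "continuous_on S y" for S
    by (intro continuous_at_imp_continuous_on ballI DERIV_isCont[OF y])
  define k where "k x = - exp x * y x" for x
  define k1 where "k1 x = - exp x * (y x + p x)" for x
  have k: "(k has_real_derivative k1 x) (at x)" for x
    unfolding k_def k1_def by (auto intro!: derivative_eq_intros y simp: algebra_simps)
  \<comment> \<open>The second derivative of \<open>k\<close> is
    \<open>exp x * (f'' + 2 * f' + f)\<close> with \<open>f = - y\<close>, and the equation turns
    the first two terms into \<open>- clamp_square y\<close>.\<close>
  have k1: "(k1 has_real_derivative exp x * (- y x - clamp_square (y x))) (at x)" for x
    unfolding k1_def by (auto intro!: derivative_eq_intros y p simp: algebra_simps)
  have k1_ge: "k1 x \<ge> lam" if x: "x \<ge> 0" and neg: "\<And>t. 0 \<le> t \<Longrightarrow> t \<le> x \<Longrightarrow> y t \<le> 0" for x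
  proof -
    have "k1 0 \<le> k1 x"
    proof (rule DERIV_nonneg_imp_nondecreasing[OF x])
      fix t assume t: "0 \<le> t" "t \<le> x"
      have "exp t * (- y t - clamp_square (y t)) \<ge> 0"
        using neg[OF t] clamp_square_le[of "y t"] by simp
      then show "\<exists>z. (k1 has_real_derivative z) (at t) \<and> 0 \<le> z" using k1 by blast
    qed
    then show ?thesis using yp by (simp add: k1_def)
  qed
  have le0: "y x \<le> 0" if "x \<ge> 0" for x
  proof (rule ccontr)
    assume neg: "\<not> y x \<le> 0"
    \<comment> \<open>The supremum \<open>m\<close> of \<open>B\<close> is the last time up to which
      \<open>y\<close> is nonpositive; a positive value at \<open>x\<close> would leave room to move
      beyond \<open>m\<close>.\<close>
    define B where "B = {t\<in>{0..x}. \<forall>s\<in>{0..t}. y s \<le> 0}"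
    have B0: "0 \<in> B" using that yp by (auto simp: B_def)
    have bdd: "bdd_above B" by (auto simp: B_def intro!: bdd_aboveI[of _ x])
    define m where "m = Sup B"
    have m: "0 \<le> m" "m \<le> x"
    proof -
      show "0 \<le> m" unfolding m_def by (rule cSup_upper[OF B0 bdd])
      show "m \<le> x" unfolding m_def by (rule cSup_least) (use B0 in \<open>auto simp: B_def\<close>)
    qed
    have below: "y s \<le> 0" if s: "0 \<le> s" "s < m" for s
    proof -
      obtain t where "t \<in> B" "s < t" using less_cSupD[of B s] B0 s by (auto simp: m_def)
      then show ?thesis using s by (auto simp: B_def)
    qed
    have ym: "y m \<le> 0"
    proof (cases "m = 0")
      case False
      have "((\<lambda>s. y s) \<longlongrightarrow> y m) (at_left m)"
        using DERIV_isCont[OF y[of m]] by (simp add: isCont_def filterlim_at_split)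
      moreover have "eventually (\<lambda>s. y s \<le> 0) (at_left m)"
        using eventually_at_left_real[of 0 m] m False by (auto elim!: eventually_mono intro: below)
      ultimately show ?thesis by (rule tendsto_upperbound) simp
    qed (simp add: yp)
    have le_m: "y s \<le> 0" if "0 \<le> s" "s \<le> m" for s
      using below[of s] ym that by (cases "s = m") auto
    have pos: "y m < 0 \<or> (m = 0)"
    proof (cases "m = 0")
      case False
      have "k 0 + lam * m \<le> k m"
      proof -
        have "k 0 - lam * 0 \<le> k m - lam * m"
        proof (rule DERIV_nonneg_imp_nondecreasing[OF m(1)])
          fix t assume t: "0 \<le> t" "t \<le> m"
          have "((\<lambda>t. k t - lam * t) has_real_derivative k1 t - lam) (at t)"
            by (auto intro!: derivative_eq_intros k)
          moreover have "k1 t - lam \<ge> 0" using k1_ge[of t] le_m t by simp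
          ultimately show "\<exists>z. ((\<lambda>t. k t - lam * t) has_real_derivative z) (at t) \<and> 0 \<le> z" by blast
        qed
        then show ?thesis by simp
      qed
      moreover have "lam * m > 0" using lam m False by simp
      ultimately have "k m > 0" using yp by (simp add: k_def)
      then show ?thesis by (simp add: k_def zero_less_mult_iff mult_less_0_iff)
    qed simp
    have "m < x" using m le_m neg that by (metis antisym_conv1 order_refl)
    \<comment> \<open>At \<open>m = 0\<close> the slope \<open>- lam\<close> pushes \<open>y\<close>
      below 0; for \<open>m > 0\<close> already \<open>y m < 0\<close>, and continuity
      suffices.\<close>
    have "\<exists>d>0. \<forall>h>0. h < d \<longrightarrow> y (m + h) \<le> 0"
    proof (cases "m = 0")
      case True
      have "p 0 < 0" using yp lam by simp
      from DERIV_neg_dec_right[OF y this] obtain d where "d > 0" "\<And>h. 0 < h \<Longrightarrow> h < d \<Longrightarrow> y (0 + h) < y 0"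
        by auto
      then show ?thesis using yp True by (intro exI[of _ d]) (auto intro: less_imp_le)
    next
      case False
      with pos have "y m < 0" by simp
      have "(y \<longlongrightarrow> y m) (at m)" using DERIV_isCont[OF y[of m]] by (simp add: isCont_def)
      from order_tendstoD(2)[OF this \<open>y m < 0\<close>] obtain d where "d > 0" "\<And>s. s \<noteq> m \<Longrightarrow> dist s m < d \<Longrightarrow> y s < 0"
        by (auto simp: eventually_at)
      then show ?thesis by (intro exI[of _ d]) (auto simp: dist_real_def intro!: less_imp_le)
    qed
    then obtain d where d: "d > 0" "\<And>h. 0 < h \<Longrightarrow> h < d \<Longrightarrow> y (m + h) \<le> 0" by blast
    define h where "h = min (d / 2) (x - m)"
    have h: "0 < h" "h < d" "m + h \<le> x" using d(1) \<open>m < x\<close> by (auto simp: h_def)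
    have "m + h \<in> B" unfolding B_def
    proof (intro CollectI conjI ballI)
      show "m + h \<in> {0..x}" using h m by auto
      fix s assume s: "s \<in> {0..m + h}"
      show "y s \<le> 0"
      proof (cases "s \<le> m")
        case True then show ?thesis using le_m s by auto
      next
        case False then show ?thesis using d(2)[of "s - m"] s h by auto
      qed
    qed
    then have "m + h \<le> m" unfolding m_def by (rule cSup_upper[OF _ bdd])
    then show False using h by simp
  qed
  have ge: "- lam / 2 \<le> y x" if x: "x \<ge> 0" for x
  proof -
    have 1: "p t + 2 * y t \<ge> - lam" if "t \<ge> 0" for t
    proof -
      have "p 0 + 2 * y 0 \<le> p t + 2 * y t"
      proof (rule DERIV_nonneg_imp_nondecreasing[OF that])
        fix s
        have "((\<lambda>s. p s + 2 * y s) has_real_derivative clamp_square (y s)) (at s)"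
          by (auto intro!: derivative_eq_intros y p)
        then show "\<exists>z. ((\<lambda>s. p s + 2 * y s) has_real_derivative z) (at s) \<and> 0 \<le> z"
          using clamp_square_nonneg by blast
      qed
      then show ?thesis using yp by simp
    qed
    \<comment> \<open>By the bound \<open>p + 2 * y \<ge> - lam\<close> this product is
      nondecreasing; it starts at \<open>lam / 2 > 0\<close>.\<close>
    have "exp (2 * 0) * (y 0 + lam / 2) \<le> exp (2 * x) * (y x + lam / 2)"
    proof (rule DERIV_nonneg_imp_nondecreasing[OF x])
      fix t :: real assume t: "0 \<le> t"
      have "((\<lambda>t. exp (2 * t) * (y t + lam / 2)) has_real_derivative exp (2 * t) * (p t + 2 * y t + lam)) (at t)"
        by (auto intro!: derivative_eq_intros y simp: algebra_simps)
      moreover have "exp (2 * t) * (p t + 2 * y t + lam) \<ge> 0" using 1[OF t] by simp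
      ultimately show "\<exists>z. ((\<lambda>t. exp (2 * t) * (y t + lam / 2)) has_real_derivative z) (at t) \<and> 0 \<le> z"
        by blast
    qed
    then have "0 < exp (2 * x) * (y x + lam / 2)" using yp lam by simp
    then have "0 < y x + lam / 2" by (simp add: zero_less_mult_iff)
    then show ?thesis by simp
  qed
  obtain e where e: "e > 0" "\<And>x. \<bar>x\<bar> < e \<Longrightarrow> \<bar>y x\<bar> \<le> 1"
    using ex_ball_small[of y] yp(1) DERIV_isCont[OF y] by blast
  have small: "\<bar>y x\<bar> \<le> 1" if "x \<in> {-e<..}" for x
    using le0[of x] ge[of x] e(2)[of x] that lam by (cases "x \<ge> 0") auto
  have "ivp_solution lam {-e<..} (restrict y {-e<..})"
    using yp y p e(1) small by (intro ivp_solution_of_clamped[where p = p]) (simp_all add: is_interval_oi)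
  moreover have "{0..} \<subseteq> {-e<..}" using e(1) by auto
  moreover have "- lam / 2 \<le> restrict y {-e<..} x \<and> restrict y {-e<..} x \<le> 0" if "x \<ge> 0" for x
    using le0[OF that] ge[OF that] e(1) that by simp
  ultimately show ?thesis by blast
qed

lemma ivp_max_bounds:
  assumes "0 \<le> lam" "lam < 2"
  shows "{0..} \<subseteq> ivp_domain lam" and "x \<ge> 0 \<Longrightarrow> - lam / 2 \<le> ivp_max lam x \<and> ivp_max lam x \<le> 0"
proof -
  obtain J g where J: "ivp_solution lam J g" "{0..} \<subseteq> J" "\<forall>x\<ge>0. - lam / 2 \<le> g x \<and> g x \<le> 0"
    using ivp_global_bounds[OF assms] by blast
  then show "{0..} \<subseteq> ivp_domain lam" by (auto simp: ivp_domain_def)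
  show "- lam / 2 \<le> ivp_max lam x \<and> ivp_max lam x \<le> 0" if "x \<ge> 0"
    using J ivp_max_eq[OF J(1), of x] that by auto
qed

section \<open>Exit times and pioneers of the truncated tree\<close>

text \<open>The first exit from \<open>U\<close>, capped at \<open>K\<close>. The inserted
  \<open>0\<close> gives the value 0 to a path that starts outside \<open>U\<close>. With
  \<open>K\<close> a lifetime, this is the moment when a particle leaves \<open>U\<close> or dies
  inside it.\<close>

definition exit_time :: "'v::topological_space set \<Rightarrow> real \<Rightarrow> (real \<Rightarrow> 'v) \<Rightarrow> real" where
  "exit_time U K x = Sup (insert 0 {t\<in>{0..K}. \<forall>s\<in>{0..t}. x s \<in> U})"

lemma
  assumes "0 \<le> K"
  shows exit_time_nonneg: "0 \<le> exit_time U K x" and exit_time_le: "exit_time U K x \<le> K"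
    and exit_time_ge: "0 \<le> t \<Longrightarrow> t \<le> K \<Longrightarrow> \<forall>s\<in>{0..t}. x s \<in> U \<Longrightarrow> t \<le> exit_time U K x"
proof -
  let ?A = "insert 0 {t\<in>{0..K}. \<forall>s\<in>{0..t}. x s \<in> U}"
  have bdd: "bdd_above ?A" using assms by (auto intro!: bdd_aboveI[of _ K])
  show "0 \<le> exit_time U K x" unfolding exit_time_def by (rule cSup_upper[OF _ bdd]) simp
  show "exit_time U K x \<le> K" unfolding exit_time_def by (rule cSup_least) (use assms in auto)
  show "t \<le> exit_time U K x" if "0 \<le> t" "t \<le> K" "\<forall>s\<in>{0..t}. x s \<in> U"
    unfolding exit_time_def by (rule cSup_upper[OF _ bdd]) (use that in auto)
qed

lemma before_exit_time:
  assumes "0 \<le> s" "s < exit_time U K x"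
  shows "x s \<in> U"
proof -
  let ?A = "insert 0 {t\<in>{0..K}. \<forall>s\<in>{0..t}. x s \<in> U}"
  have "\<exists>t\<in>?A. s < t"
    by (rule less_cSupD) (use assms in \<open>auto simp: exit_time_def\<close>)
  with assms show ?thesis by auto
qed

lemma exit_time_alive:
  assumes "0 \<le> K" "\<forall>s\<in>{0..K}. x s \<in> U"
  shows "exit_time U K x = K"
  using exit_time_le[OF assms(1), of U x] exit_time_ge[OF assms(1) assms(1) order_refl assms(2)] by simp

text \<open>At an exit before \<open>K\<close> the path cannot still be in the open set
  \<open>U\<close>, for continuity would let it stay longer. So the position at the capped exit time
  alone tells whether the particle remained in \<open>U\<close> up to \<open>K\<close>.\<close>

lemma exit_time_in_iff:
  assumes K: "0 \<le> K" and U: "open U" and x: "continuous_on {0..} x"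
  shows "x (exit_time U K x) \<in> U \<longleftrightarrow> (\<forall>s\<in>{0..K}. x s \<in> U)"
proof
  assume "\<forall>s\<in>{0..K}. x s \<in> U"
  then show "x (exit_time U K x) \<in> U" using exit_time_alive[OF K, of x U] K by simp
next
  define S where "S = exit_time U K x"
  assume S_in: "x (exit_time U K x) \<in> U"
  have S: "0 \<le> S" "S \<le> K" using exit_time_nonneg[OF K] exit_time_le[OF K] by (auto simp: S_def)
  have in_S: "x s \<in> U" if "0 \<le> s" "s \<le> S" for s
    using before_exit_time[of s U K x] that S_in by (cases "s = S") (auto simp: S_def)
  show "\<forall>s\<in>{0..K}. x s \<in> U"
  proof (cases "S = K")
    case True
    then show ?thesis using in_S by auto
  next
    case False
    have "(x \<longlongrightarrow> x S) (at S within {0..})" using x S by (auto simp: continuous_on_def)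
    then have "eventually (\<lambda>s. x s \<in> U) (at S within {0..})"
      by (rule topological_tendstoD[OF _ U]) (use S_in in \<open>simp add: S_def\<close>)
    then obtain d where d: "d > 0" "\<And>s. s \<ge> 0 \<Longrightarrow> s \<noteq> S \<Longrightarrow> dist s S < d \<Longrightarrow> x s \<in> U"
      by (auto simp: eventually_at)
    define t where "t = min (S + d / 2) K"
    have t: "S < t" "t \<le> K" using d False S by (auto simp: t_def)
    have "t \<le> S" unfolding S_def
    proof (rule exit_time_ge[OF K])
      show "\<forall>s\<in>{0..t}. x s \<in> U"
      proof
        fix s assume s: "s \<in> {0..t}"
        show "x s \<in> U"
          using in_S[of s] d(2)[of s] s d(1) by (cases "s \<le> S") (auto simp: dist_real_def t_def)
      qed
    qed (use t S in auto)
    with t show ?thesis by simp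
  qed
qed

lemma exit_time_closure:
  assumes K: "0 \<le> K" and x: "continuous_on {0..} x" and x0: "x 0 \<in> closure U"
  shows "x (exit_time U K x) \<in> closure U"
proof (cases "exit_time U K x = 0")
  case False
  define S where "S = exit_time U K x"
  have S: "S > 0" using False exit_time_nonneg[OF K, of U x] by (simp add: S_def)
  have "(x \<longlongrightarrow> x S) (at S within {0..})" using x S by (auto simp: continuous_on_def)
  moreover have "at S within {0..} = at S" by (rule at_within_interior) (use S in simp)
  ultimately have "(x \<longlongrightarrow> x S) (at S)" by simp
  then have "(x \<longlongrightarrow> x S) (at_left S)" by (simp only: filterlim_at_split)
  moreover have "eventually (\<lambda>s. x s \<in> closure U) (at_left S)"
    using eventually_at_left_real[OF S]
  proof eventually_elim
    case (elim s)
    then show ?case using before_exit_time[of s U K x] closure_subset by (auto simp: S_def)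
  qed
  ultimately have "x S \<in> closure U"
    by (intro Lim_in_closed_set[OF closed_closure]) auto
  then show ?thesis by (simp add: S_def)
qed (use x0 in simp)

definition annulus :: "real \<Rightarrow> 'v::real_normed_vector set" where
  "annulus R = {y. 1 < norm y \<and> norm y < R}"

lemma open_annulus: "open (annulus R)"
  unfolding annulus_def
  by (intro open_Collect_conj open_Collect_less continuous_intros)

lemma exit_time_annulus:
  assumes K: "0 \<le> K" and x: "continuous_on {0..} x" and x0: "1 \<le> norm (x 0)" "norm (x 0) \<le> R"
    and R: "1 < R"
  shows "norm (x (exit_time (annulus R) K x)) \<in> {1..R}"
proof (cases "x 0 \<in> annulus R")
  case True
  have "x (exit_time (annulus R) K x) \<in> closure (annulus R)"
    using closure_subset True by (intro exit_time_closure[OF K x]) auto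
  moreover have "closure (annulus R) \<subseteq> {y. 1 \<le> norm y} \<inter> {y. norm y \<le> R}"
    by (intro closure_minimal closed_Int closed_Collect_le continuous_intros) (auto simp: annulus_def)
  ultimately show ?thesis by auto
next
  case False
  have "\<not> 0 < exit_time (annulus R) K x" using before_exit_time[of 0 "annulus R" K x] False by auto
  then have "exit_time (annulus R) K x = 0" using exit_time_nonneg[OF K, of "annulus R" x] by simp
  then show ?thesis using x0 by simp
qed

section \<open>Splitting the tree at the first branching\<close>

text \<open>Labels carry the youngest generation first, so \<open>u @ [i]\<close> is the label
  \<open>u\<close> inside the subtree of the root's child \<open>i\<close>. Shifting all families by
  \<open>@ [i]\<close> expresses the branching property for a single realisation.\<close>

lemma birth_snoc: "birth l (u @ [i]) = l [] + birth (\<lambda>u. l (u @ [i])) u"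
  by (induction u) auto

lemma born_snoc: "born k (u @ [i]) \<longleftrightarrow> i < k [] \<and> born (\<lambda>u. k (u @ [i])) u"
  by (induction u) auto

lemma birth_nonneg: "(\<And>u. 0 < l u) \<Longrightarrow> 0 \<le> birth l u"
  by (induction u) (auto intro: add_nonneg_nonneg less_imp_le)

text \<open>The two descriptions match at \<open>t = l []\<close>, the branch point, because the
  relative motion of the child starts at 0; induction on \<open>u\<close> carries this to later
  generations.\<close>

lemma position_snoc:
  assumes l: "\<And>u. 0 < l u" and w: "\<And>u. w u 0 = 0" and t: "l [] \<le> t"
  shows "position z l w (u @ [i]) t =
    position (z + w [] (l [])) (\<lambda>u. l (u @ [i])) (\<lambda>u. w (u @ [i])) u (t - l [])"
  using t
proof (induction u arbitrary: t)
  case Nil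
  then show ?case using w by (auto simp: not_le)
next
  case (Cons j u)
  have eq: "birth l ((j # u) @ [i]) = l [] + birth (\<lambda>u. l (u @ [i])) (j # u)"
    by (rule birth_snoc)
  have nn: "0 \<le> birth (\<lambda>u. l (u @ [i])) (j # u)" by (rule birth_nonneg) (rule l)
  have "position z l w ((j # u) @ [i]) t =
     (if t \<le> birth l ((j # u) @ [i]) then position z l w (u @ [i]) t
      else position z l w (u @ [i]) (birth l ((j # u) @ [i])) +
        w ((j # u) @ [i]) (t - birth l ((j # u) @ [i])))"
    by simp
  also have "\<dots> = position (z + w [] (l [])) (\<lambda>u. l (u @ [i])) (\<lambda>u. w (u @ [i])) (j # u) (t - l [])"
    unfolding eq using Cons.IH[of t] Cons.IH[of "l [] + birth (\<lambda>u. l (u @ [i])) (j # u)"] Cons.prems nn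
    by (simp add: algebra_simps del: birth.simps)
  finally show ?case .
qed

lemma strict_ancestor_trans: "strict_ancestor a b \<Longrightarrow> strict_ancestor b c \<Longrightarrow> strict_ancestor a c"
  by (auto simp: strict_ancestor_def)

text \<open>By transitivity, a strict ancestor of a point that has not been killed has not been
  killed either. The ancestors may therefore be taken in the whole tree, and killing and hitting the
  ball become conditions of the same shape.\<close>

lemma pioneers_alt:
  "pioneers R z l k w = {v \<in> tree l k. norm (position z l w (fst v) (snd v)) \<le> 1 \<and>
     (\<forall>a\<in>tree l k. strict_ancestor a v \<longrightarrow>
        norm (position z l w (fst a) (snd a)) \<noteq> R \<and> 1 < norm (position z l w (fst a) (snd a)))}"
proof -
  have "a \<in> killed_tree R z l k w"
    if "v \<in> killed_tree R z l k w" "a \<in> tree l k" "strict_ancestor a v" for a v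
    using that strict_ancestor_trans unfolding killed_tree_def by blast
  then show ?thesis
    unfolding pioneers_def by (auto simp: not_le killed_tree_def)
qed

text \<open>The condition \<open>0 < snd v\<close> drops the root point of each child's tree: in the
  whole tree it is the branch point, which belongs to the parent.\<close>

lemma tree_decomp:
  assumes l: "\<And>u. 0 < l u"
  shows "tree l k = {[]} \<times> {0..l []} \<union>
    (\<Union>i<k []. (\<lambda>(u, t). (u @ [i], t + l [])) `
       {v \<in> tree (\<lambda>u. l (u @ [i])) (\<lambda>u. k (u @ [i])). 0 < snd v})" (is "_ = ?A \<union> ?B")
proof (rule set_eqI)
  fix v :: "label \<times> real"
  obtain u t where v: "v = (u, t)" by fastforce
  show "v \<in> tree l k \<longleftrightarrow> v \<in> ?A \<union> ?B"
  proof (cases u rule: rev_cases)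
    case Nil
    then show ?thesis using l[of "[]"] v by (auto simp: tree_def)
  next
    case (snoc u' i)
    have "v \<in> tree l k \<longleftrightarrow> i < k [] \<and> (u', t - l []) \<in> tree (\<lambda>u. l (u @ [i])) (\<lambda>u. k (u @ [i])) \<and> 0 < t - l []"
      using birth_nonneg[of "\<lambda>u. l (u @ [i])" u'] l
      by (auto simp: tree_def v snoc birth_snoc born_snoc)
    also have "\<dots> \<longleftrightarrow> v \<in> ?B"
      by (force simp: v snoc image_iff)
    finally show ?thesis using snoc v by auto
  qed
qed

text \<open>Truncation by generation gives finite sets and a recursion in \<open>n\<close>, and the
  sets increase to all pioneers.\<close>

definition trunc_pioneers ::
  "nat \<Rightarrow> real \<Rightarrow> 'v::real_normed_vector \<Rightarrow> (label \<Rightarrow> real) \<Rightarrow> (label \<Rightarrow> nat) \<Rightarrow>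
   (label \<Rightarrow> real \<Rightarrow> 'v) \<Rightarrow> (label \<times> real) set"
where
  "trunc_pioneers n R z l k w = {v \<in> pioneers R z l k w. length (fst v) < n}"

context
  fixes l :: "label \<Rightarrow> real" and k :: "label \<Rightarrow> nat" and w :: "label \<Rightarrow> real \<Rightarrow> 'v::real_normed_vector"
    and R :: real and z y :: 'v
  assumes l: "\<And>u. 0 < l u" and w0: "\<And>u. w u 0 = 0" and w: "\<And>u. continuous_on {0..} (w u)"
    and R: "1 < R" and z: "1 \<le> norm z" "norm z \<le> R"
    and y: "y = z + w [] (exit_time (annulus R) (l []) (\<lambda>t. z + w [] t))"
begin

lemma cont_root: "continuous_on {0..} (\<lambda>t. z + w [] t)"
  by (intro continuous_intros w)

lemma norm_root_exit: "norm y \<in> {1..R}"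
  unfolding y by (rule exit_time_annulus) (use l[of "[]"] w0 z R cont_root in auto)

text \<open>The root reaches one of the two spheres at the exit time: on the inner one it is a
  pioneer, on the outer one it is killed. In both cases this point is a strict ancestor that
  excludes all later points, and before it nothing has touched the ball.\<close>

lemma pioneers_root_exits:
  assumes "y \<notin> annulus R"
  shows "pioneers R z l k w =
    (if norm y = 1 then {([], exit_time (annulus R) (l []) (\<lambda>t. z + w [] t))} else {})"
proof -
  define x where "x = (\<lambda>t. z + w [] t)"
  define S where "S = exit_time (annulus R) (l []) x"
  have l0: "0 \<le> l []" using l[of "[]"] by simp
  have yS: "y = x S" by (simp add: y x_def S_def)
  have S: "0 \<le> S" "S \<le> l []" unfolding S_def by (rule exit_time_nonneg[OF l0], rule exit_time_le[OF l0])
  have before: "1 < norm (x s)" "norm (x s) < R" if "0 \<le> s" "s < S" for s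
    using before_exit_time[of s "annulus R" "l []" x] that by (auto simp: S_def annulus_def)
  have y1R: "norm y = 1 \<or> norm y = R" using norm_root_exit assms by (auto simp: annulus_def)
  have root: "([], t) \<in> tree l k" if "0 \<le> t" "t \<le> l []" for t
    using that by (auto simp: tree_def)
  have pos_root: "position z l w [] t = x t" for t by (simp add: x_def)
  have only: "v = ([], S)" if v: "v \<in> pioneers R z l k w" for v
  proof -
    obtain u t where ut: "v = (u, t)" by fastforce
    have tree: "(u, t) \<in> tree l k" and in_ball: "norm (position z l w u t) \<le> 1"
      and anc: "\<And>a. a \<in> tree l k \<Longrightarrow> strict_ancestor a (u, t) \<Longrightarrow>
        norm (position z l w (fst a) (snd a)) \<noteq> R \<and> 1 < norm (position z l w (fst a) (snd a))"
      using v unfolding pioneers_alt ut by auto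
    have "\<not> S < t"
    proof
      assume "S < t"
      then have "strict_ancestor ([], S) (u, t)" by (simp add: strict_ancestor_def)
      from anc[OF root[OF S] this] y1R show False by (auto simp: yS x_def)
    qed
    then have tS: "t \<le> S" by simp
    have "u = []"
    proof (cases u rule: rev_cases)
      case (snoc u' i)
      then have "l [] < t" using tree birth_nonneg[of "\<lambda>u. l (u @ [i])" u'] l
        by (auto simp: tree_def birth_snoc)
      then show ?thesis using tS S by simp
    qed
    moreover have "0 \<le> t" using tree birth_nonneg[of l u] l by (auto simp: tree_def)
    ultimately have "t = S" using before(1)[of t] tS in_ball by (cases "t < S") (auto simp: x_def)
    then show ?thesis using ut \<open>u = []\<close> by simp
  qed
  show ?thesis
  proof (cases "norm y = 1")
    case True
    have "([], S) \<in> pioneers R z l k w"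
      unfolding pioneers_alt
    proof (intro CollectI conjI ballI impI)
      fix a assume a: "a \<in> tree l k" "strict_ancestor a ([], S)"
      then obtain s where as: "a = ([], s)" "s < S" by (cases a) (auto simp: strict_ancestor_def)
      then have "0 \<le> s" using a by (auto simp: tree_def)
      then show "norm (position z l w (fst a) (snd a)) \<noteq> R"
        "1 < norm (position z l w (fst a) (snd a))"
        using before[of s] as by (auto simp: x_def)
    qed (use True root[OF S] in \<open>auto simp: yS x_def\<close>)
    then have "pioneers R z l k w = {([], S)}" using only by blast
    then show ?thesis using True by (simp add: S_def x_def)
  next
    case False
    have "([], S) \<notin> pioneers R z l k w"
      using False y1R R by (auto simp: pioneers_alt yS x_def)
    then have "pioneers R z l k w = {}" using only by blast
    then show ?thesis using False by simp
  qed
qed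

text \<open>The root stays strictly between the spheres, so it neither contributes a pioneer nor
  blocks one. The root point of a child's tree sits at \<open>y\<close>, inside the annulus, and is
  equally harmless.\<close>

lemma pioneers_root_survives:
  assumes "y \<in> annulus R"
  shows "pioneers R z l k w = (\<Union>i<k []. (\<lambda>(u, t). (u @ [i], t + l [])) `
    pioneers R y (\<lambda>u. l (u @ [i])) (\<lambda>u. k (u @ [i])) (\<lambda>u. w (u @ [i])))"
proof -
  define x where "x = (\<lambda>t. z + w [] t)"
  define sh where "sh i = (\<lambda>(u :: label, t). (u @ [i], t + l []))" for i :: nat
  define T where "T i = tree (\<lambda>u. l (u @ [i])) (\<lambda>u. k (u @ [i]))" for i
  define P where "P i = pioneers R y (\<lambda>u. l (u @ [i])) (\<lambda>u. k (u @ [i])) (\<lambda>u. w (u @ [i]))" for i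
  define q where "q v = position z l w (fst v) (snd v)" for v
  define q' where "q' i v = position y (\<lambda>u. l (u @ [i])) (\<lambda>u. w (u @ [i])) (fst v) (snd v)" for i v
  have l0: "0 \<le> l []" using l[of "[]"] by simp
  have alive: "x s \<in> annulus R" if "0 \<le> s" "s \<le> l []" for s
  proof -
    have "x (exit_time (annulus R) (l []) x) \<in> annulus R" using assms by (simp add: x_def y)
    then show ?thesis using exit_time_in_iff[OF l0 open_annulus, of x R] cont_root that by (auto simp: x_def)
  qed
  have "exit_time (annulus R) (l []) x = l []" by (rule exit_time_alive[OF l0]) (use alive in auto)
  then have y': "y = z + w [] (l [])" by (simp add: y x_def)
  have tree: "tree l k = {[]} \<times> {0..l []} \<union> (\<Union>i<k []. sh i ` {v \<in> T i. 0 < snd v})"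
    unfolding sh_def T_def by (rule tree_decomp) (rule l)
  have q_root: "q ([], t) = x t" for t by (simp add: q_def x_def)
  have q_sh: "q (sh i v) = q' i v" if "0 \<le> snd v" for i v
    using that position_snoc[of l w "snd v + l []" z "fst v" i, OF l w0]
    by (simp add: q_def q'_def sh_def case_prod_beta y')
  have T_nn: "0 \<le> snd v" if "v \<in> T i" for v i
    using that birth_nonneg[of "\<lambda>u. l (u @ [i])" "fst v"] l by (auto simp: T_def tree_def)
  have T0: "v = ([], 0)" if "v \<in> T i" "\<not> 0 < snd v" for v i
    using that birth_nonneg[of "\<lambda>u. l (u @ [i])" "fst v"] l by (auto simp: T_def tree_def)
  have q'0: "q' i ([], 0) = y" for i by (simp add: q'_def w0)
  have P: "P i = {v \<in> T i. norm (q' i v) \<le> 1 \<and>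
      (\<forall>a\<in>T i. strict_ancestor a v \<longrightarrow> norm (q' i a) \<noteq> R \<and> 1 < norm (q' i a))}" for i
    unfolding P_def T_def q'_def by (rule pioneers_alt)
  have yR: "1 < norm y" "norm y < R" using assms by (auto simp: annulus_def)
  \<comment> \<open>Points in different subtrees are incomparable, so the conditions on ancestors
    decouple over the children.\<close>
  have anc_sh: "strict_ancestor (sh i a) (sh j v) \<longleftrightarrow> i = j \<and> strict_ancestor a v" for i j a v
    by (auto simp: strict_ancestor_def sh_def case_prod_beta)
  have key: "sh i v \<in> pioneers R z l k w \<longleftrightarrow> v \<in> P i" if i: "i < k []" and v: "v \<in> T i" "0 < snd v" for i v
  proof -
    have "sh i v \<in> tree l k" using tree i v by auto
    moreover have "(\<forall>a\<in>tree l k. strict_ancestor a (sh i v) \<longrightarrow> norm (q a) \<noteq> R \<and> 1 < norm (q a)) \<longleftrightarrow>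
      (\<forall>a\<in>T i. strict_ancestor a v \<longrightarrow> norm (q' i a) \<noteq> R \<and> 1 < norm (q' i a))" (is "?L \<longleftrightarrow> ?R")
    proof
      assume L: ?L
      show ?R
      proof (intro ballI impI)
        fix a assume a: "a \<in> T i" "strict_ancestor a v"
        show "norm (q' i a) \<noteq> R \<and> 1 < norm (q' i a)"
        proof (cases "0 < snd a")
          case True
          then have "sh i a \<in> tree l k" using tree i a by auto
          moreover have "strict_ancestor (sh i a) (sh i v)" using a anc_sh by simp
          ultimately have "norm (q (sh i a)) \<noteq> R \<and> 1 < norm (q (sh i a))" using L by blast
          then show ?thesis using q_sh[of a i] True by simp
        next
          case False
          then show ?thesis using T0[OF a(1)] q'0 yR by auto
        qed
      qed
    next
      assume R': ?R
      show ?L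
      proof (intro ballI impI)
        fix a assume a: "a \<in> tree l k" "strict_ancestor a (sh i v)"
        from a(1) consider (root) t where "a = ([], t)" "0 \<le> t" "t \<le> l []"
          | (sub) j b where "a = sh j b" "b \<in> T j" "0 < snd b"
          unfolding tree by (cases a) auto
        then show "norm (q a) \<noteq> R \<and> 1 < norm (q a)"
        proof cases
          case root
          then show ?thesis using alive[of t] by (simp add: q_root annulus_def)
        next
          case sub
          then have "j = i" "strict_ancestor b v" using a(2) anc_sh by simp_all
          with sub R' have "norm (q' i b) \<noteq> R \<and> 1 < norm (q' i b)" by blast
          then show ?thesis using q_sh[of b j] sub \<open>j = i\<close> by simp
        qed
      qed
    qed
    moreover have "norm (q (sh i v)) \<le> 1 \<longleftrightarrow> norm (q' i v) \<le> 1" using q_sh[of v i] v by simp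
    ultimately show ?thesis using v unfolding P pioneers_alt q_def[symmetric] by simp
  qed
  have pos: "0 < snd v" if "v \<in> P i" for v i
    using that T0[of v i] q'0[of i] yR unfolding P by force
  have sub: "\<exists>i<k []. \<exists>v'\<in>T i. 0 < snd v' \<and> v = sh i v'" if v: "v \<in> pioneers R z l k w" for v
  proof -
    have "v \<in> tree l k" "norm (q v) \<le> 1" using v by (simp_all add: pioneers_alt q_def)
    moreover have "v \<notin> {[]} \<times> {0..l []}"
    proof
      assume "v \<in> {[]} \<times> {0..l []}"
      then obtain t where "v = ([], t)" "0 \<le> t" "t \<le> l []" by auto
      then have "norm (q v) > 1" using alive[of t] by (simp add: q_root annulus_def)
      with \<open>norm (q v) \<le> 1\<close> show False by simp
    qed
    ultimately have "v \<in> (\<Union>i<k []. sh i ` {v \<in> T i. 0 < snd v})" unfolding tree by simp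
    then show ?thesis by blast
  qed
  have "pioneers R z l k w = (\<Union>i<k []. sh i ` P i)"
  proof (intro equalityI subsetI)
    fix v assume v: "v \<in> pioneers R z l k w"
    with sub obtain i v' where "i < k []" "v' \<in> T i" "0 < snd v'" "v = sh i v'" by blast
    then show "v \<in> (\<Union>i<k []. sh i ` P i)" using key[of i v'] v by blast
  next
    fix v assume "v \<in> (\<Union>i<k []. sh i ` P i)"
    then obtain i v' where i: "i < k []" "v' \<in> P i" "v = sh i v'" by blast
    then have "v' \<in> T i" by (simp add: P)
    then show "v \<in> pioneers R z l k w" using key[of i v'] pos[of v' i] i by simp
  qed
  then show ?thesis by (simp add: sh_def P_def)
qed

lemma trunc_pioneers_Suc:
  "trunc_pioneers (Suc n) R z l k w =
    (if norm y \<le> 1 then {([], exit_time (annulus R) (l []) (\<lambda>t. z + w [] t))}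
     else if R \<le> norm y then {}
     else (\<Union>i<k []. (\<lambda>(u, t). (u @ [i], t + l [])) `
       trunc_pioneers n R y (\<lambda>u. l (u @ [i])) (\<lambda>u. k (u @ [i])) (\<lambda>u. w (u @ [i]))))"
proof (cases "y \<in> annulus R")
  case True
  then show ?thesis
    unfolding trunc_pioneers_def pioneers_root_survives[OF True] by (auto simp: annulus_def) force
next
  case False
  then show ?thesis using norm_root_exit R
    unfolding trunc_pioneers_def pioneers_root_exits[OF False] by (auto simp: annulus_def)
qed

end

lemma finite_trunc_pioneers:
  fixes w :: "label \<Rightarrow> real \<Rightarrow> 'v::real_normed_vector"
  assumes "\<And>u. 0 < l u" "\<And>u. w u 0 = 0" "\<And>u. continuous_on {0..} (w u)"
    "1 < R" "1 \<le> norm z" "norm z \<le> R"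
  shows "finite (trunc_pioneers n R z l k w)"
  using assms
proof (induction n arbitrary: z l k w)
  case 0
  then show ?case by (simp add: trunc_pioneers_def)
next
  case (Suc n)
  define y where "y = z + w [] (exit_time (annulus R) (l []) (\<lambda>t. z + w [] t))"
  have "norm y \<in> {1..R}" by (rule norm_root_exit[of l w R z y]) (fact Suc.prems y_def)+
  then have "finite (trunc_pioneers n R y (\<lambda>u. l (u @ [i])) (\<lambda>u. k (u @ [i])) (\<lambda>u. w (u @ [i])))" for i
    by (intro Suc.IH) (use Suc.prems in auto)
  then show ?case by (subst trunc_pioneers_Suc[of l w R z y]) (use Suc.prems y_def in auto)
qed

text \<open>The children contribute disjoint sets, because the last entry of a label records the
  child through which it descends.\<close>

lemma card_trunc_pioneers_Suc:
  fixes w :: "label \<Rightarrow> real \<Rightarrow> 'v::real_normed_vector"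
  assumes prems: "\<And>u. 0 < l u" "\<And>u. w u 0 = 0" "\<And>u. continuous_on {0..} (w u)"
    "1 < R" "1 \<le> norm z" "norm z \<le> R"
    and y: "y = z + w [] (exit_time (annulus R) (l []) (\<lambda>t. z + w [] t))"
  shows "card (trunc_pioneers (Suc n) R z l k w) =
    (if norm y \<le> 1 then 1 else if R \<le> norm y then 0
     else \<Sum>i<k []. card (trunc_pioneers n R y (\<lambda>u. l (u @ [i])) (\<lambda>u. k (u @ [i])) (\<lambda>u. w (u @ [i]))))"
proof -
  define P where "P i = trunc_pioneers n R y (\<lambda>u. l (u @ [i])) (\<lambda>u. k (u @ [i])) (\<lambda>u. w (u @ [i]))" for i
  have "norm y \<in> {1..R}" by (rule norm_root_exit[of l w R z y]) (fact prems y)+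
  then have fin: "finite (P i)" for i
    unfolding P_def by (intro finite_trunc_pioneers) (use prems in auto)
  have "card (\<Union>i<k []. (\<lambda>(u, t). (u @ [i], t + l [])) ` P i) =
      (\<Sum>i<k []. card ((\<lambda>(u, t). (u @ [i], t + l [])) ` P i))"
    by (rule card_UN_disjoint) (use fin in auto)
  also have "\<dots> = (\<Sum>i<k []. card (P i))"
    by (intro sum.cong refl card_image) (auto simp: inj_on_def)
  finally show ?thesis
    by (subst trunc_pioneers_Suc[of l w R z y]) (use prems y in \<open>auto simp: P_def\<close>)
qed

section \<open>Gaussian increments\<close>

text \<open>Lebesgue measure on a Euclidean space is the image of a product of one-dimensional ones
  under recombining the coordinates, which reduces such integrals to Fubini's theorem.\<close>

lemma
  fixes f :: "'v::euclidean_space \<Rightarrow> real \<Rightarrow> real"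
  assumes f: "\<And>b. b \<in> Basis \<Longrightarrow> integrable lborel (f b)"
  shows integrable_lborel_prod: "integrable lborel (\<lambda>x. \<Prod>b\<in>Basis. f b (x \<bullet> b))"
    and integral_lborel_prod: "(\<integral>x. (\<Prod>b\<in>Basis. f b (x \<bullet> b)) \<partial>lborel) = (\<Prod>b\<in>Basis. \<integral>x. f b x \<partial>lborel)"
proof -
  interpret product_sigma_finite "\<lambda>_::'v. lborel :: real measure" by standard
  have [measurable]: "f b \<in> borel_measurable borel" if "b \<in> Basis" for b
    using borel_measurable_integrable[OF f[OF that]] by simp
  have eq: "(\<Prod>b\<in>Basis. f b ((\<Sum>c\<in>Basis. y c *\<^sub>R c) \<bullet> b)) = (\<Prod>b\<in>Basis. f b (y b))" for y :: "'v \<Rightarrow> real"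
    by (intro prod.cong refl) (simp add: inner_sum_left_Basis)
  have "integrable (\<Pi>\<^sub>M b\<in>Basis. lborel) (\<lambda>y. \<Prod>b\<in>Basis. f b (y b))"
    by (rule product_integrable_prod) (use f in auto)
  then show "integrable lborel (\<lambda>x. \<Prod>b\<in>Basis. f b (x \<bullet> b))"
    by (subst lborel_eq) (subst integrable_distr_eq, simp_all add: eq)
  have "(\<integral>y. (\<Prod>b\<in>Basis. f b (y b)) \<partial>(\<Pi>\<^sub>M b\<in>Basis. lborel)) = (\<Prod>b\<in>Basis. \<integral>x. f b x \<partial>lborel)"
    by (rule product_integral_prod) (use f in auto)
  then show "(\<integral>x. (\<Prod>b\<in>Basis. f b (x \<bullet> b)) \<partial>lborel) = (\<Prod>b\<in>Basis. \<integral>x. f b x \<partial>lborel)"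
    by (subst lborel_eq) (subst integral_distr, simp_all add: eq)
qed

context prob_space
begin

lemma
  fixes \<xi> :: "'a \<Rightarrow> 'v::euclidean_space"
  assumes d: "distributed M lborel \<xi> (\<lambda>x. ennreal (\<Prod>b\<in>Basis. normal_density 0 \<sigma> (x \<bullet> b)))"
    and \<sigma>: "0 < \<sigma>"
  shows gaussian_monomial_integrable: "integrable M (\<lambda>\<omega>. \<Prod>b\<in>Basis. (\<xi> \<omega> \<bullet> b) ^ m b)"
    and gaussian_monomial: "expectation (\<lambda>\<omega>. \<Prod>b\<in>Basis. (\<xi> \<omega> \<bullet> b) ^ m b) =
      (\<Prod>b\<in>Basis. \<integral>x. normal_density 0 \<sigma> x * x ^ m b \<partial>lborel)"
proof -
  have int: "integrable lborel (\<lambda>x. normal_density 0 \<sigma> x * x ^ j)" for j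
    using integrable_normal_moment[OF \<sigma>, of 0 j] by simp
  have nn: "0 \<le> (\<Prod>b\<in>Basis. normal_density 0 \<sigma> (x \<bullet> b))" for x :: 'v
    by (intro prod_nonneg) simp
  have eq: "(\<Prod>b\<in>Basis. normal_density 0 \<sigma> (x \<bullet> b)) * (\<Prod>b\<in>Basis. (x \<bullet> b) ^ m b) =
      (\<Prod>b\<in>Basis. normal_density 0 \<sigma> (x \<bullet> b) * (x \<bullet> b) ^ m b)" for x :: 'v
    by (simp add: prod.distrib)
  show "integrable M (\<lambda>\<omega>. \<Prod>b\<in>Basis. (\<xi> \<omega> \<bullet> b) ^ m b)"
    using distributed_integrable[OF d _ nn, of "\<lambda>x. \<Prod>b\<in>Basis. (x \<bullet> b) ^ m b"]
      integrable_lborel_prod[of "\<lambda>b x. normal_density 0 \<sigma> x * x ^ m b", OF int]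
    by (simp add: eq)
  show "expectation (\<lambda>\<omega>. \<Prod>b\<in>Basis. (\<xi> \<omega> \<bullet> b) ^ m b) =
      (\<Prod>b\<in>Basis. \<integral>x. normal_density 0 \<sigma> x * x ^ m b \<partial>lborel)"
    using distributed_integral[OF d _ nn, of "\<lambda>x. \<Prod>b\<in>Basis. (x \<bullet> b) ^ m b"]
      integral_lborel_prod[of "\<lambda>b x. normal_density 0 \<sigma> x * x ^ m b", OF int]
    by (simp add: eq)
qed

context
  fixes \<xi> :: "'a \<Rightarrow> 'v::euclidean_space" and \<sigma> :: real
  assumes d: "distributed M lborel \<xi> (\<lambda>x. ennreal (\<Prod>b\<in>Basis. normal_density 0 \<sigma> (x \<bullet> b)))"
    and \<sigma>: "0 < \<sigma>"
begin

lemma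
  assumes b: "b \<in> Basis"
  shows gaussian_power_integrable: "integrable M (\<lambda>\<omega>. (\<xi> \<omega> \<bullet> b) ^ j)"
    and gaussian_power: "expectation (\<lambda>\<omega>. (\<xi> \<omega> \<bullet> b) ^ j) = (\<integral>x. normal_density 0 \<sigma> x * x ^ j \<partial>lborel)"
proof -
  have eq: "(\<Prod>c\<in>Basis. y c ^ (if c = b then j else 0)) = y b ^ j" for y :: "'v \<Rightarrow> real"
    using b by (simp add: if_distrib[of "power _"] prod.delta' cong: if_cong)
  show "integrable M (\<lambda>\<omega>. (\<xi> \<omega> \<bullet> b) ^ j)"
    using gaussian_monomial_integrable[OF d \<sigma>, of "\<lambda>c. if c = b then j else 0"] by (simp add: eq)
  have "(\<Prod>c\<in>Basis. \<integral>x. normal_density 0 \<sigma> x * x ^ (if c = b then j else 0) \<partial>lborel) =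
     (\<Prod>c\<in>Basis. if c = b then (\<integral>x. normal_density 0 \<sigma> x * x ^ j \<partial>lborel) else 1)"
    using \<sigma> by (intro prod.cong refl) auto
  also have "\<dots> = (\<integral>x. normal_density 0 \<sigma> x * x ^ j \<partial>lborel)"
    using b by simp
  finally show "expectation (\<lambda>\<omega>. (\<xi> \<omega> \<bullet> b) ^ j) = (\<integral>x. normal_density 0 \<sigma> x * x ^ j \<partial>lborel)"
    using gaussian_monomial[OF d \<sigma>, of "\<lambda>c. if c = b then j else 0"] by (simp add: eq)
qed

lemma gaussian_mean: "b \<in> Basis \<Longrightarrow> expectation (\<lambda>\<omega>. \<xi> \<omega> \<bullet> b) = 0"
  using gaussian_power[of b 1] integral_normal_moment_nz_1[OF \<sigma>, of 0] by simp

lemma gaussian_mean_integrable: "b \<in> Basis \<Longrightarrow> integrable M (\<lambda>\<omega>. \<xi> \<omega> \<bullet> b)"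
  using gaussian_power_integrable[of b 1] by simp

lemma
  assumes bc: "b \<in> Basis" "c \<in> Basis"
  shows gaussian_covariance_integrable: "integrable M (\<lambda>\<omega>. (\<xi> \<omega> \<bullet> b) * (\<xi> \<omega> \<bullet> c))"
    and gaussian_covariance: "expectation (\<lambda>\<omega>. (\<xi> \<omega> \<bullet> b) * (\<xi> \<omega> \<bullet> c)) = (if b = c then \<sigma>\<^sup>2 else 0)"
proof -
  \<comment> \<open>A sum of two indicators, so that \<open>b = c\<close> produces the exponent 2
    and \<open>b \<noteq> c\<close> two exponents 1, whose odd moments vanish.\<close>
  let ?m = "\<lambda>a. (if a = b then 1 else 0) + (if a = c then 1 else 0 :: nat)"
  have eq: "(\<Prod>a\<in>Basis. y a ^ ?m a) = y b * y c" for y :: "'v \<Rightarrow> real"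
    using bc by (simp add: power_add prod.distrib if_distrib[of "power _"] prod.delta' cong: if_cong)
  show "integrable M (\<lambda>\<omega>. (\<xi> \<omega> \<bullet> b) * (\<xi> \<omega> \<bullet> c))"
    using gaussian_monomial_integrable[OF d \<sigma>, of ?m] by (simp only: eq)
  have E: "expectation (\<lambda>\<omega>. (\<xi> \<omega> \<bullet> b) * (\<xi> \<omega> \<bullet> c)) = (\<Prod>a\<in>Basis. \<integral>x. normal_density 0 \<sigma> x * x ^ ?m a \<partial>lborel)"
    using gaussian_monomial[OF d \<sigma>, of ?m] by (simp only: eq)
  show "expectation (\<lambda>\<omega>. (\<xi> \<omega> \<bullet> b) * (\<xi> \<omega> \<bullet> c)) = (if b = c then \<sigma>\<^sup>2 else 0)"
  proof (cases "b = c")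
    case True
    have "expectation (\<lambda>\<omega>. (\<xi> \<omega> \<bullet> b) * (\<xi> \<omega> \<bullet> c)) = (\<integral>x. normal_density 0 \<sigma> x * x ^ 2 \<partial>lborel)"
      using gaussian_power[OF bc(1), of 2] True by (simp add: power2_eq_square)
    also have "\<dots> = \<sigma>\<^sup>2"
      using integral_normal_moment_even[OF \<sigma>, of 0 1] by (simp add: fact_numeral)
    finally show ?thesis using True by simp
  next
    case False
    have "(\<integral>x. normal_density 0 \<sigma> x * x ^ ?m b \<partial>lborel) = 0"
      using integral_normal_moment_nz_1[OF \<sigma>, of 0] False by simp
    then have "(\<Prod>a\<in>Basis. \<integral>x. normal_density 0 \<sigma> x * x ^ ?m a \<partial>lborel) = 0"
      by (rule prod_zero[OF finite_Basis bexI[OF _ bc(1)]])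
    then show ?thesis using False E by simp
  qed
qed

lemma norm_square_eq: "(norm x)\<^sup>2 = (\<Sum>b\<in>Basis. (x \<bullet> b) * (x \<bullet> b))" for x :: 'v
  by (simp add: power2_norm_eq_inner euclidean_inner[of x x])

lemma gaussian_norm_square:
  "integrable M (\<lambda>\<omega>. (norm (\<xi> \<omega>))\<^sup>2)" "expectation (\<lambda>\<omega>. (norm (\<xi> \<omega>))\<^sup>2) = DIM('v) * \<sigma>\<^sup>2"
  unfolding norm_square_eq using gaussian_covariance_integrable gaussian_covariance by simp_all

text \<open>Cauchy-Schwarz over the coordinates reduces the fourth power of the norm to fourth
  moments of single coordinates, each equal to \<open>3 * \<sigma> ^ 4\<close>. No higher moment
  enters the Taylor error.\<close>

lemma gaussian_norm_fourth:
  "integrable M (\<lambda>\<omega>. norm (\<xi> \<omega>) ^ 4)" "expectation (\<lambda>\<omega>. norm (\<xi> \<omega>) ^ 4) \<le> 3 * (DIM('v))\<^sup>2 * \<sigma> ^ 4"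
proof -
  have [measurable]: "\<xi> \<in> borel_measurable M" using distributed_measurable[OF d] by simp
  have le: "norm x ^ 4 \<le> DIM('v) * (\<Sum>b\<in>Basis. (x \<bullet> b) ^ 4)" for x :: 'v
  proof -
    have "norm x ^ 4 = (\<Sum>b\<in>Basis. (x \<bullet> b)\<^sup>2)\<^sup>2"
      using norm_square_eq[of x] by (simp add: power2_eq_square power4_eq_xxxx)
    also have "\<dots> \<le> (\<Sum>b\<in>(Basis::'v set). 1) * (\<Sum>b\<in>Basis. ((x \<bullet> b)\<^sup>2)\<^sup>2)"
      using sum_squared_le_sum_of_squares[of "\<lambda>b. (x \<bullet> b)\<^sup>2" Basis] by (simp add: mult.commute)
    finally show ?thesis by (simp flip: power_mult)
  qed
  have int: "integrable M (\<lambda>\<omega>. DIM('v) * (\<Sum>b\<in>Basis. (\<xi> \<omega> \<bullet> b) ^ 4))"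
    using gaussian_power_integrable by (intro integrable_mult_right integrable_sum) auto
  show 1: "integrable M (\<lambda>\<omega>. norm (\<xi> \<omega>) ^ 4)"
    by (rule Bochner_Integration.integrable_bound[OF int])
      (use le in \<open>auto intro!: order_trans[OF le] abs_ge_self\<close>)
  have m4: "expectation (\<lambda>\<omega>. (\<xi> \<omega> \<bullet> b) ^ 4) = 3 * \<sigma> ^ 4" if "b \<in> Basis" for b
    using gaussian_power[OF that, of 4] integral_normal_moment_even[OF \<sigma>, of 0 2]
    by (simp add: fact_numeral power2_eq_square power4_eq_xxxx field_simps)
  have "expectation (\<lambda>\<omega>. norm (\<xi> \<omega>) ^ 4) \<le> expectation (\<lambda>\<omega>. DIM('v) * (\<Sum>b\<in>Basis. (\<xi> \<omega> \<bullet> b) ^ 4))"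
    by (intro integral_mono 1 int le)
  also have "\<dots> = DIM('v) * (\<Sum>b\<in>(Basis::'v set). 3 * \<sigma> ^ 4)"
    using gaussian_power_integrable m4 by (simp add: Bochner_Integration.integral_sum)
  finally show "expectation (\<lambda>\<omega>. norm (\<xi> \<omega>) ^ 4) \<le> 3 * (DIM('v))\<^sup>2 * \<sigma> ^ 4"
    by (simp add: power2_eq_square)
qed

end
end

section \<open>Measurability and independence of the past\<close>

text \<open>By compactness, a path in an open set keeps a positive distance from the complement up
  to time \<open>t\<close>, and by continuity countably many times suffice to test this. All of them
  are at most \<open>t\<close>, so the event belongs to the past of \<open>t\<close>.\<close>

lemma path_in_open_iff_rational:
  fixes x :: "real \<Rightarrow> 'v::euclidean_space"
  assumes x: "continuous_on {0..} x" and U: "open U" "U \<noteq> UNIV" and t: "0 \<le> t"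
  shows "(\<forall>s\<in>{0..t}. x s \<in> U) \<longleftrightarrow>
    (\<exists>m::nat. \<forall>s\<in>insert t (\<rat> \<inter> {0..t}). 1 / (real m + 1) \<le> infdist (x s) (- U))"
proof -
  have cl: "closed (- U)" "- U \<noteq> {}" using U by auto
  have cont: "continuous_on {0..} (\<lambda>s. infdist (x s) (- U))"
    by (intro continuous_on_infdist x)
  show ?thesis
  proof
    assume *: "\<forall>s\<in>{0..t}. x s \<in> U"
    have "compact {0..t}" "{0..t} \<noteq> {}" using t by auto
    from continuous_attains_inf[OF this continuous_on_subset[OF cont]]
    obtain s where s: "s \<in> {0..t}" "\<And>r. r \<in> {0..t} \<Longrightarrow> infdist (x s) (- U) \<le> infdist (x r) (- U)"
      by auto
    have "x s \<notin> - U" using * s by auto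
    then have "infdist (x s) (- U) > 0"
      using in_closed_iff_infdist_zero[OF cl, of "x s"] infdist_nonneg[of "x s" "- U"] by linarith
    then obtain m :: nat where m: "inverse (real (Suc m)) < infdist (x s) (- U)"
      using reals_Archimedean by blast
    show "\<exists>m::nat. \<forall>s\<in>insert t (\<rat> \<inter> {0..t}). 1 / (real m + 1) \<le> infdist (x s) (- U)"
    proof (intro exI[of _ m] ballI)
      fix r assume "r \<in> insert t (\<rat> \<inter> {0..t})"
      then have "r \<in> {0..t}" using t by auto
      from s(2)[OF this] m show "1 / (real m + 1) \<le> infdist (x r) (- U)"
        by (simp add: divide_inverse add.commute)
    qed
  next
    assume "\<exists>m::nat. \<forall>s\<in>insert t (\<rat> \<inter> {0..t}). 1 / (real m + 1) \<le> infdist (x s) (- U)"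
    then obtain m :: nat where m: "\<And>s. s \<in> insert t (\<rat> \<inter> {0..t}) \<Longrightarrow> 1 / (real m + 1) \<le> infdist (x s) (- U)"
      by blast
    show "\<forall>s\<in>{0..t}. x s \<in> U"
    proof (rule ballI, rule ccontr)
      fix s assume s: "s \<in> {0..t}" and "x s \<notin> U"
      then have 0: "infdist (x s) (- U) = 0" by simp
      \<comment> \<open>The time \<open>t\<close> is listed explicitly, since it cannot be
        approached from the right by rationals inside \<open>{0..t}\<close>.\<close>
      have "s \<noteq> t" using m[of t] 0 by auto
      then have "s < t" using s by simp
      have "((\<lambda>s. infdist (x s) (- U)) \<longlongrightarrow> 0) (at s within {0..})"
        using cont s unfolding continuous_on_def 0[symmetric] by auto
      then have "eventually (\<lambda>s. infdist (x s) (- U) < 1 / (real m + 1)) (at s within {0..})"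
        by (rule order_tendstoD) simp
      then obtain d where d: "d > 0"
        "\<And>r. 0 \<le> r \<Longrightarrow> r \<noteq> s \<Longrightarrow> dist r s < d \<Longrightarrow> infdist (x r) (- U) < 1 / (real m + 1)"
        by (auto simp: eventually_at)
      obtain q where q: "q \<in> \<rat>" "s < q" "q < min t (s + d)"
        using Rats_dense_in_real[of s "min t (s + d)"] \<open>s < t\<close> d by auto
      have "infdist (x q) (- U) < 1 / (real m + 1)"
        by (rule d(2)) (use q s in \<open>auto simp: dist_real_def\<close>)
      moreover have "1 / (real m + 1) \<le> infdist (x q) (- U)"
        by (rule m) (use q s in auto)
      ultimately show False by simp
    qed
  qed
qed

lemma sets_path_in_open:
  fixes x :: "'b \<Rightarrow> real \<Rightarrow> 'v::euclidean_space"
  assumes meas: "\<And>s. 0 \<le> s \<Longrightarrow> s \<le> t \<Longrightarrow> (\<lambda>\<omega>. x \<omega> s) \<in> borel_measurable N"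
    and cont: "\<And>\<omega>. \<omega> \<in> space N \<Longrightarrow> continuous_on {0..} (x \<omega>)"
    and U: "open U" and t: "0 \<le> t"
  shows "{\<omega> \<in> space N. \<forall>s\<in>{0..t}. x \<omega> s \<in> U} \<in> sets N"
\<comment> \<open>The distance to the empty set is 0 by convention, so the whole space is treated
  apart.\<close>
proof (cases "U = UNIV")
  case False
  have "{\<omega> \<in> space N. \<forall>s\<in>{0..t}. x \<omega> s \<in> U} =
    (\<Union>m::nat. \<Inter>s\<in>insert t (\<rat> \<inter> {0..t}). {\<omega> \<in> space N. 1 / (real m + 1) \<le> infdist (x \<omega> s) (- U)})"
    using path_in_open_iff_rational[OF cont U False t] by auto
  also have "\<dots> \<in> sets N"
  proof (rule sets.countable_UN''[OF countableI_type], rule sets.countable_INT')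
    show "countable (insert t (\<rat> \<inter> {0..t}))" by (auto intro: countable_rat)
    show "(\<lambda>s. {\<omega> \<in> space N. 1 / (real m + 1) \<le> infdist (x \<omega> s) (- U)}) ` insert t (\<rat> \<inter> {0..t}) \<subseteq> sets N" for m
    proof clarify
      fix s assume "s \<in> insert t (\<rat> \<inter> {0..t})"
      then have [measurable]: "(\<lambda>\<omega>. x \<omega> s) \<in> borel_measurable N" using meas[of s] t by auto
      have [measurable]: "(\<lambda>y. infdist y (- U)) \<in> borel_measurable borel"
        by (intro borel_measurable_continuous_onI continuous_on_infdist continuous_intros)
      show "{\<omega> \<in> space N. 1 / (real m + 1) \<le> infdist (x \<omega> s) (- U)} \<in> sets N" by measurable
    qed
  qed auto
  finally show ?thesis .
qed simp

lemma measurable_exit_time: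
  fixes x :: "'b \<Rightarrow> real \<Rightarrow> 'v::euclidean_space"
  assumes meas: "\<And>s. 0 \<le> s \<Longrightarrow> (\<lambda>\<omega>. x \<omega> s) \<in> borel_measurable N"
    and cont: "\<And>\<omega>. \<omega> \<in> space N \<Longrightarrow> continuous_on {0..} (x \<omega>)"
    and U: "open U"
    and [measurable]: "k \<in> borel_measurable N" and k: "\<And>\<omega>. \<omega> \<in> space N \<Longrightarrow> 0 \<le> k \<omega>"
  shows "(\<lambda>\<omega>. exit_time U (k \<omega>) (x \<omega>)) \<in> borel_measurable N"
  unfolding borel_measurable_iff_greater
proof
  fix c :: real
  show "{\<omega> \<in> space N. c < exit_time U (k \<omega>) (x \<omega>)} \<in> sets N"
  proof (cases "c < 0")
    case True
    then have "{\<omega> \<in> space N. c < exit_time U (k \<omega>) (x \<omega>)} = space N"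
      using exit_time_nonneg[OF k, of _ U] by (force intro: less_le_trans)
    then show ?thesis by simp
  next
    case False
    \<comment> \<open>A rational witness makes the union countable and separates the condition on
      the random cap \<open>k\<close> from the condition on the path.\<close>
    have "c < exit_time U (k \<omega>) (x \<omega>) \<longleftrightarrow>
       (\<exists>q\<in>\<rat> \<inter> {c<..}. q \<le> k \<omega> \<and> (\<forall>s\<in>{0..q}. x \<omega> s \<in> U))" if "\<omega> \<in> space N" for \<omega>
    proof
      assume "c < exit_time U (k \<omega>) (x \<omega>)"
      then have "\<exists>t\<in>insert 0 {t\<in>{0..k \<omega>}. \<forall>s\<in>{0..t}. x \<omega> s \<in> U}. c < t"
        unfolding exit_time_def by (intro less_cSupD) auto
      then obtain t where t: "c < t" "t \<le> k \<omega>" "\<forall>s\<in>{0..t}. x \<omega> s \<in> U" using False by auto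
      obtain q where "q \<in> \<rat>" "c < q" "q < t" using Rats_dense_in_real[OF t(1)] by auto
      then show "\<exists>q\<in>\<rat> \<inter> {c<..}. q \<le> k \<omega> \<and> (\<forall>s\<in>{0..q}. x \<omega> s \<in> U)"
        using t by (intro bexI[of _ q]) auto
    next
      assume "\<exists>q\<in>\<rat> \<inter> {c<..}. q \<le> k \<omega> \<and> (\<forall>s\<in>{0..q}. x \<omega> s \<in> U)"
      then obtain q where "c < q" "q \<le> k \<omega>" "\<forall>s\<in>{0..q}. x \<omega> s \<in> U" by auto
      then show "c < exit_time U (k \<omega>) (x \<omega>)"
        using exit_time_ge[OF k[OF that], of q "x \<omega>" U] False by auto
    qed
    then have "{\<omega> \<in> space N. c < exit_time U (k \<omega>) (x \<omega>)} =
      (\<Union>q\<in>\<rat> \<inter> {c<..}. {\<omega> \<in> space N. q \<le> k \<omega>} \<inter> {\<omega> \<in> space N. \<forall>s\<in>{0..q}. x \<omega> s \<in> U})"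
      by auto
    also have "\<dots> \<in> sets N"
    proof (intro sets.countable_UN'')
      show "countable (\<rat> \<inter> {c<..})" by (auto intro: countable_rat)
      fix q assume q: "q \<in> \<rat> \<inter> {c<..}"
      have "{\<omega> \<in> space N. \<forall>s\<in>{0..q}. x \<omega> s \<in> U} \<in> sets N"
        by (rule sets_path_in_open[OF meas cont U]) (use q False in auto)
      then show "{\<omega> \<in> space N. q \<le> k \<omega>} \<inter> {\<omega> \<in> space N. \<forall>s\<in>{0..q}. x \<omega> s \<in> U} \<in> sets N" by auto
    qed
    finally show ?thesis .
  qed
qed

lemma measurable_path_at:
  fixes x :: "'b \<Rightarrow> real \<Rightarrow> 'v::euclidean_space"
  assumes meas: "\<And>s. 0 \<le> s \<Longrightarrow> (\<lambda>\<omega>. x \<omega> s) \<in> borel_measurable N"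
    and cont: "\<And>\<omega>. \<omega> \<in> space N \<Longrightarrow> continuous_on {0..} (x \<omega>)"
    and S[measurable]: "S \<in> borel_measurable N" and S0: "\<And>\<omega>. \<omega> \<in> space N \<Longrightarrow> 0 \<le> S \<omega>"
  shows "(\<lambda>\<omega>. x \<omega> (S \<omega>)) \<in> borel_measurable N"
proof (rule borel_measurable_LIMSEQ_metric)
  \<comment> \<open>Rounding up to a grid leaves countably many times. The maximum with 0 below
    keeps them in the range where \<open>x\<close> is measurable, also for negative grid
    indices.\<close>
  define g where "g n s = real_of_int \<lceil>s * real (Suc n)\<rceil> / real (Suc n)" for n s
  show "(\<lambda>\<omega>. x \<omega> (max 0 (g n (S \<omega>)))) \<in> borel_measurable N" for n
  proof -
    have "(\<lambda>\<omega>. (\<lambda>i::int. \<lambda>\<omega>. x \<omega> (max 0 (real_of_int i / real (Suc n)))) \<lceil>S \<omega> * real (Suc n)\<rceil> \<omega>) \<in> borel_measurable N"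
      by (rule measurable_compose_countable) (auto intro!: meas)
    then show ?thesis by (simp add: g_def)
  qed
  fix \<omega> assume \<omega>: "\<omega> \<in> space N"
  have "(\<lambda>n. max 0 (g n (S \<omega>))) \<longlonglongrightarrow> S \<omega>"
  proof -
    have "\<bar>max 0 (g n (S \<omega>)) - S \<omega>\<bar> \<le> 1 / real (Suc n)" for n
    proof -
      have "S \<omega> * real (Suc n) \<le> real_of_int \<lceil>S \<omega> * real (Suc n)\<rceil>"
        "real_of_int \<lceil>S \<omega> * real (Suc n)\<rceil> \<le> S \<omega> * real (Suc n) + 1" by linarith+
      then have "S \<omega> * real (Suc n) / real (Suc n) \<le> g n (S \<omega>)"
        "g n (S \<omega>) \<le> (S \<omega> * real (Suc n) + 1) / real (Suc n)"
        unfolding g_def by (intro divide_right_mono; simp)+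
      then have "S \<omega> \<le> g n (S \<omega>)" "g n (S \<omega>) \<le> S \<omega> + 1 / real (Suc n)"
        by (simp_all add: add_divide_distrib del: of_nat_Suc)
      then show ?thesis using S0[OF \<omega>] by simp
    qed
    then have "\<forall>\<^sub>F n in sequentially. norm (max 0 (g n (S \<omega>)) - S \<omega>) \<le> 1 / real (Suc n)"
      unfolding real_norm_def by (intro always_eventually allI)
    moreover have "(\<lambda>n. 1 / real (Suc n)) \<longlonglongrightarrow> 0" by (rule lim_1_over_n[THEN LIMSEQ_Suc])
    ultimately have "(\<lambda>n. max 0 (g n (S \<omega>)) - S \<omega>) \<longlonglongrightarrow> 0"
      by (rule Lim_null_comparison)
    then show ?thesis by (simp add: LIM_zero_iff)
  qed
  then show "(\<lambda>n. x \<omega> (max 0 (g n (S \<omega>)))) \<longlonglongrightarrow> x \<omega> (S \<omega>)"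
    by (intro continuous_on_tendsto_compose[OF cont[OF \<omega>]]) (use S0[OF \<omega>] in auto)
qed

lemma (in prob_space) indep_set_mono:
  assumes "indep_set A B" "A' \<subseteq> A" "B' \<subseteq> B"
  shows "indep_set A' B'"
  using assms indep_sets_mono_sets[of "case_bool A B" UNIV "case_bool A' B'"]
  unfolding indep_set_def by (auto split: bool.split)

section \<open>Independence of an increment from the past\<close>

context brownian_motion
begin

definition past :: "real \<Rightarrow> 'a measure" where
  "past t = sigma (space M) (\<Union>s\<in>{0..t}. {X s -` B \<inter> space M |B. B \<in> sets borel})"

lemma space_past: "space (past t) = space M"
  unfolding past_def by (rule space_measure_of) auto

lemma sets_past: "sets (past t) = sigma_sets (space M) (\<Union>s\<in>{0..t}. {X s -` B \<inter> space M |B. B \<in> sets borel})"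
  unfolding past_def by (rule sets_measure_of) auto

lemma measurable_past:
  assumes "0 \<le> s" "s \<le> t"
  shows "X s \<in> borel_measurable (past t)"
proof (rule measurableI)
  fix B :: "'v set" assume "B \<in> sets borel"
  with assms show "X s -` B \<inter> space (past t) \<in> sets (past t)"
    unfolding sets_past space_past by (intro sigma_sets.Basic UN_I[of s]) auto
qed simp

lemma sets_past_subset: "sets (past t) \<subseteq> events"
  unfolding sets_past by (rule sets.sigma_sets_subset) (use measurable_motion in \<open>auto intro: measurable_sets\<close>)

lemma measurable_from_past: "f \<in> measurable (past t) N \<Longrightarrow> f \<in> measurable M N"
  using measurable_mono[of N N "past t" M] sets_past_subset[of t] by (auto simp: space_past)

text \<open>Independence of increments is given along strictly increasing times, so a finite set of
  times has to be listed in order, from 0 to \<open>t\<close>.\<close>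

lemma finite_set_enumeration:
  fixes J :: "real set"
  assumes "finite J" "{0, t} \<subseteq> J" "J \<subseteq> {0..t}"
  obtains r and n :: nat where "r 0 = 0" "\<And>i. i < n \<Longrightarrow> r i < r (Suc i)" "r n = t" "r ` {..n} = J"
proof -
  define xs where "xs = sorted_list_of_set J"
  have xs: "sorted xs" "distinct xs" "set xs = J" using assms by (simp_all add: xs_def)
  define n where "n = length xs - 1"
  have len: "length xs = Suc n" using xs assms by (cases xs) (auto simp: n_def)
  have lt: "xs ! i < xs ! j" if "i < j" "j \<le> n" for i j
    using sorted_wrt_nth_less[of "(<)" xs i j] xs that len by (simp add: strict_sorted_iff)
  have img: "(\<lambda>i. xs ! i) ` {..n} = J"
    using xs len by (auto simp: set_conv_nth less_Suc_eq_le)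
  show ?thesis
  proof (rule that[of "\<lambda>i. xs ! i" n])
    have J: "0 \<le> xs ! i" "xs ! i \<le> t" if "i \<le> n" for i
      using img assms(3) that by auto
    have "0 \<in> (\<lambda>i. xs ! i) ` {..n}" unfolding img using assms by simp
    then obtain i where i: "i \<le> n" "xs ! i = 0" by auto
    show "xs ! 0 = 0"
    proof (cases "i = 0")
      case False
      then show ?thesis using lt[of 0 i] i J(1)[of 0] by simp
    qed (use i in simp)
    have "t \<in> (\<lambda>i. xs ! i) ` {..n}" unfolding img using assms by simp
    then obtain i where i: "i \<le> n" "xs ! i = t" by auto
    show "xs ! n = t"
    proof (cases "i = n")
      case False
      then show ?thesis using lt[of i n] i J(2)[of n] by simp
    qed (use i in simp)
    show "xs ! i < xs ! Suc i" if "i < n" for i using lt[of i "Suc i"] that by simp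
    show "(\<lambda>i. xs ! i) ` {..n} = J" by (rule img)
  qed
qed

text \<open>The positions at the times \<open>r i\<close> are partial sums of the first
  \<open>n\<close> increments, because the motion starts at 0, and the increment from
  \<open>t\<close> to \<open>u\<close> is one more member of the same independent family.\<close>

lemma indep_finite_past:
  assumes "r 0 = 0" "\<And>i. i < n \<Longrightarrow> r i < r (Suc i)" "r n = t" "t < u"
  shows "indep_set (sigma_sets (space M) (\<Union>s\<in>r ` {..n}. {X s -` B \<inter> space M |B. B \<in> sets borel}))
    (sigma_sets (space M) {(\<lambda>\<omega>. X u \<omega> - X t \<omega>) -` B \<inter> space M |B. B \<in> sets borel})"
proof -
  define r' where "r' i = (if i \<le> n then r i else u)" for i
  define Y where "Y i \<omega> = X (r' (Suc i)) \<omega> - X (r' i) \<omega>" for i \<omega>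
  have r'_less: "r' i < r' (Suc i)" if "i < Suc n" for i
    using assms that by (cases "i = n") (auto simp: r'_def)
  have indep: "indep_vars (\<lambda>_. borel) Y {..<Suc n}"
    unfolding Y_def by (rule independent_increments) (use assms r'_less in \<open>auto simp: r'_def\<close>)
  have nonneg: "0 \<le> r i" if "i \<le> n" for i
    using that by (induction i) (use assms in \<open>auto simp: Suc_le_eq intro: order_trans less_imp_le\<close>)
  have "indep_var (PiM {..<n} (\<lambda>_. borel)) (\<lambda>\<omega>. restrict (\<lambda>i. Y i \<omega>) {..<n})
      (PiM {n} (\<lambda>_. borel)) (\<lambda>\<omega>. restrict (\<lambda>i. Y i \<omega>) {n})"
    by (rule indep_var_restrict[OF indep]) auto
  then have ind: "indep_set
      (sigma_sets (space M) {(\<lambda>\<omega>. restrict (\<lambda>i. Y i \<omega>) {..<n}) -` A \<inter> space M |A. A \<in> sets (PiM {..<n} (\<lambda>_. borel))})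
      (sigma_sets (space M) {(\<lambda>\<omega>. restrict (\<lambda>i. Y i \<omega>) {n}) -` A \<inter> space M |A. A \<in> sets (PiM {n} (\<lambda>_. borel))})"
    (is "indep_set _ ?N")
    by (simp only: indep_var_eq)
  have Yn: "Y n = (\<lambda>\<omega>. X u \<omega> - X t \<omega>)" using assms by (simp add: Y_def r'_def fun_eq_iff)
  have "X s -` B \<inter> space M \<in> sigma_sets (space M)
      {(\<lambda>\<omega>. restrict (\<lambda>i. Y i \<omega>) {..<n}) -` A \<inter> space M |A. A \<in> sets (PiM {..<n} (\<lambda>_. borel))}"
    if s: "s \<in> r ` {..n}" and B: "B \<in> sets borel" for s B
  proof -
    obtain i where i: "i \<le> n" "s = r i" using s by auto
    have eq: "X s \<omega> = (\<Sum>j<i. restrict (\<lambda>i. Y i \<omega>) {..<n} j)" if \<omega>: "\<omega> \<in> space M" for \<omega>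
    proof -
      have "(\<Sum>j<i. restrict (\<lambda>i. Y i \<omega>) {..<n} j) = (\<Sum>j<i. Y j \<omega>)"
        using i by (intro sum.cong) auto
      also have "\<dots> = X (r' i) \<omega> - X (r' 0) \<omega>"
        unfolding Y_def by (rule sum_lessThan_telescope)
      finally show ?thesis using i assms start_at_zero[OF \<omega>] by (simp add: r'_def)
    qed
    define h where "h y = (\<Sum>j<i. y j)" for y :: "nat \<Rightarrow> 'v"
    have h: "h \<in> borel_measurable (PiM {..<n} (\<lambda>_. borel))"
      unfolding h_def using i by (intro borel_measurable_sum measurable_component_singleton) auto
    have "X s -` B \<inter> space M = (\<lambda>\<omega>. restrict (\<lambda>i. Y i \<omega>) {..<n}) -`
        (h -` B \<inter> space (PiM {..<n} (\<lambda>_. borel))) \<inter> space M"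
      using eq by (auto simp: h_def space_PiM)
    moreover have "h -` B \<inter> space (PiM {..<n} (\<lambda>_. borel)) \<in> sets (PiM {..<n} (\<lambda>_. borel))"
      by (rule measurable_sets[OF h B])
    ultimately show ?thesis by (intro sigma_sets.Basic) blast
  qed
  then have "sigma_sets (space M) (\<Union>s\<in>r ` {..n}. {X s -` B \<inter> space M |B. B \<in> sets borel}) \<subseteq>
    sigma_sets (space M) {(\<lambda>\<omega>. restrict (\<lambda>i. Y i \<omega>) {..<n}) -` A \<inter> space M |A. A \<in> sets (PiM {..<n} (\<lambda>_. borel))}"
    by (intro sigma_sets_mono) auto
  moreover have "sigma_sets (space M) {Y n -` B \<inter> space M |B. B \<in> sets borel} \<subseteq> ?N"
  proof (rule sigma_sets_mono', clarify)
    fix B :: "'v set" assume B: "B \<in> sets borel"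
    have m: "(\<lambda>y. y n) \<in> measurable (PiM {n} (\<lambda>_. borel)) (borel :: 'v measure)"
      by (rule measurable_component_singleton) simp
    have "Y n -` B \<inter> space M = (\<lambda>\<omega>. restrict (\<lambda>i. Y i \<omega>) {n}) -`
        ((\<lambda>y. y n) -` B \<inter> space (PiM {n} (\<lambda>_. borel))) \<inter> space M"
      by (auto simp: space_PiM)
    with measurable_sets[OF m B]
    show "\<exists>A. Y n -` B \<inter> space M = (\<lambda>\<omega>. restrict (\<lambda>i. Y i \<omega>) {n}) -` A \<inter> space M \<and>
        A \<in> sets (PiM {n} (\<lambda>_. borel))"
      by blast
  qed
  ultimately show ?thesis using ind unfolding Yn by (rule indep_set_mono[rotated 1])
qed

text \<open>The past is generated by the algebras of finite sets of times. Their union is stable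
  under intersection, as two finite sets have a common finite superset, so independence passes to
  the generated algebra.\<close>

lemma indep_past_increment:
  assumes t: "0 \<le> t" "t < u"
  shows "indep_set (sets (past t))
    (sigma_sets (space M) {(\<lambda>\<omega>. X u \<omega> - X t \<omega>) -` B \<inter> space M |B. B \<in> sets borel})"
    (is "indep_set _ ?I")
proof -
  define C where "C s = {X s -` B \<inter> space M |B. B \<in> sets borel}" for s
  define F where "F J = sigma_sets (space M) (\<Union>s\<in>J. C s)" for J
  define \<J> where "\<J> = {J. finite J \<and> {0, t} \<subseteq> J \<and> J \<subseteq> {0..t}}"
  have C_sub: "C s \<subseteq> Pow (space M)" for s by (auto simp: C_def)
  have F_mono: "F J \<subseteq> F J'" if "J \<subseteq> J'" for J J'
    unfolding F_def by (intro sigma_sets_mono') (use that in auto)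
  have ind: "indep_set (F J) ?I" if "J \<in> \<J>" for J
  proof -
    from that obtain r n where r: "r 0 = 0" "\<And>i. i < n \<Longrightarrow> r i < r (Suc i)" "r n = t" "r ` {..n} = J"
      unfolding \<J>_def using finite_set_enumeration[of J t] by (metis (mono_tags, lifting) mem_Collect_eq)
    from indep_finite_past[OF r(1-3) t(2)] show ?thesis
      unfolding r(4) F_def C_def .
  qed
  have J_un: "J \<union> J' \<in> \<J>" if "J \<in> \<J>" "J' \<in> \<J>" for J J'
    using that by (auto simp: \<J>_def)
  have J_ne: "{0, t} \<in> \<J>" using t by (auto simp: \<J>_def)
  have "indep_set (sigma_sets (space M) (\<Union>J\<in>\<J>. F J)) (sigma_sets (space M) ?I)"
  proof (rule indep_set_sigma_sets)
    show "indep_set (\<Union>J\<in>\<J>. F J) ?I"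
    proof (rule indep_setI)
      show "(\<Union>J\<in>\<J>. F J) \<subseteq> events" using ind indep_setD_ev1 by blast
      show "?I \<subseteq> events" using ind[OF J_ne] indep_setD_ev2 by blast
      show "prob (A \<inter> B) = prob A * prob B" if "A \<in> (\<Union>J\<in>\<J>. F J)" "B \<in> ?I" for A B
        using that ind indep_setD by blast
    qed
    show "Int_stable (\<Union>J\<in>\<J>. F J)"
    proof (rule Int_stableI)
      fix A B assume "A \<in> (\<Union>J\<in>\<J>. F J)" "B \<in> (\<Union>J\<in>\<J>. F J)"
      then obtain J J' where J: "J \<in> \<J>" "A \<in> F J" "J' \<in> \<J>" "B \<in> F J'" by blast
      interpret S: sigma_algebra "space M" "F (J \<union> J')"
        unfolding F_def by (rule sigma_algebra_sigma_sets) (use C_sub in auto)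
      have "A \<in> F (J \<union> J')" "B \<in> F (J \<union> J')" using J F_mono by blast+
      then have "A \<inter> B \<in> F (J \<union> J')" by (rule S.Int)
      then show "A \<inter> B \<in> (\<Union>J\<in>\<J>. F J)" using J_un J by blast
    qed
    show "Int_stable ?I"
    proof (rule Int_stableI)
      interpret S: sigma_algebra "space M" ?I
        by (rule sigma_algebra_sigma_sets) auto
      show "A \<inter> B \<in> ?I" if "A \<in> ?I" "B \<in> ?I" for A B using that by (rule S.Int)
    qed
  qed
  then show ?thesis
  proof (rule indep_set_mono)
    show "sets (past t) \<subseteq> sigma_sets (space M) (\<Union>J\<in>\<J>. F J)"
      unfolding sets_past
    proof (rule sigma_sets_mono, rule subsetI)
      fix A assume "A \<in> (\<Union>s\<in>{0..t}. {X s -` B \<inter> space M |B. B \<in> sets borel})"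
      then obtain s B where "s \<in> {0..t}" "A = X s -` B \<inter> space M" "B \<in> sets borel" by blast
      then have s: "s \<in> {0..t}" "A \<in> C s" unfolding C_def by blast+
      then have "{0, t, s} \<in> \<J>" "A \<in> F {0, t, s}"
        using t by (auto simp: \<J>_def F_def intro: sigma_sets.Basic)
      then show "A \<in> sigma_sets (space M) (\<Union>J\<in>\<J>. F J)" by (intro sigma_sets.Basic) blast
    qed
  qed (auto intro: sigma_sets.Basic)
qed

lemma indep_var_past_increment:
  fixes h g :: "_ \<Rightarrow> real"
  assumes t: "0 \<le> t" "t < u" and h: "h \<in> borel_measurable (past t)" and g: "g \<in> borel_measurable borel"
  shows "indep_var borel h borel (\<lambda>\<omega>. g (X u \<omega> - X t \<omega>))"
  unfolding indep_var_eq
proof (intro conjI)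
  have [measurable]: "X u \<in> borel_measurable M" "X t \<in> borel_measurable M"
    using t by (auto intro: measurable_motion)
  show "random_variable borel h" by (rule measurable_from_past[OF h])
  show "random_variable borel (\<lambda>\<omega>. g (X u \<omega> - X t \<omega>))" using g by measurable
  show "indep_set (sigma_sets (space M) {h -` A \<inter> space M |A. A \<in> sets borel})
     (sigma_sets (space M) {(\<lambda>\<omega>. g (X u \<omega> - X t \<omega>)) -` A \<inter> space M |A. A \<in> sets borel})"
  proof (rule indep_set_mono[OF indep_past_increment[OF t]])
    have "sigma_sets (space (past t)) {h -` A \<inter> space M |A. A \<in> sets borel} \<subseteq> sets (past t)"
      by (rule sets.sigma_sets_subset) (use measurable_sets[OF h] in \<open>auto simp: space_past\<close>)
    then show "sigma_sets (space M) {h -` A \<inter> space M |A. A \<in> sets borel} \<subseteq> sets (past t)"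
      by (simp add: space_past)
    show "sigma_sets (space M) {(\<lambda>\<omega>. g (X u \<omega> - X t \<omega>)) -` A \<inter> space M |A. A \<in> sets borel} \<subseteq>
      sigma_sets (space M) {(\<lambda>\<omega>. X u \<omega> - X t \<omega>) -` B \<inter> space M |B. B \<in> sets borel}"
    proof (rule sigma_sets_mono')
      have "g -` A \<in> sets borel" if "A \<in> sets borel" for A
        using measurable_sets[OF g that] by simp
      moreover have "(\<lambda>\<omega>. g (X u \<omega> - X t \<omega>)) -` A = (\<lambda>\<omega>. X u \<omega> - X t \<omega>) -` (g -` A)" for A by auto
      ultimately show "{(\<lambda>\<omega>. g (X u \<omega> - X t \<omega>)) -` A \<inter> space M |A. A \<in> sets borel} \<subseteq>
         {(\<lambda>\<omega>. X u \<omega> - X t \<omega>) -` B \<inter> space M |B. B \<in> sets borel}" by auto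
    qed
  qed
qed

end

section \<open>Radial functions of Brownian motion\<close>

text \<open>Radial functions are written in the variable \<open>r = (norm y)\<^sup>2\<close>, which
  is polynomial in \<open>y\<close>. Derivatives are available near \<open>{a..b}\<close> only,
  whereas \<open>F\<close> is bounded and measurable everywhere, because a Gaussian step from the
  annulus can land anywhere.\<close>

locale radial_function =
  fixes F F1 F2 F3 :: "real \<Rightarrow> real" and a' a b b' B :: real
  assumes ab: "a' < a" "a \<le> b" "b < b'" "0 \<le> a"
    and F_deriv: "\<And>r. r \<in> {a'<..<b'} \<Longrightarrow> (F has_real_derivative F1 r) (at r)"
    and F1_deriv: "\<And>r. r \<in> {a'<..<b'} \<Longrightarrow> (F1 has_real_derivative F2 r) (at r)"
    and F2_deriv: "\<And>r. r \<in> {a'<..<b'} \<Longrightarrow> (F2 has_real_derivative F3 r) (at r)"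
    and F3_bound: "\<And>r. r \<in> {a'<..<b'} \<Longrightarrow> \<bar>F3 r\<bar> \<le> B"
    and F_bound: "\<And>r. \<bar>F r\<bar> \<le> B"
    and F_measurable[measurable]: "F \<in> borel_measurable borel"
    and F1_measurable[measurable]: "F1 \<in> borel_measurable borel"
    and F2_measurable[measurable]: "F2 \<in> borel_measurable borel"
begin

lemma F_isCont: "r \<in> {a..b} \<Longrightarrow> isCont F r" "r \<in> {a..b} \<Longrightarrow> isCont F1 r" "r \<in> {a..b} \<Longrightarrow> isCont F2 r"
  using ab by (auto intro!: DERIV_isCont[OF F_deriv] DERIV_isCont[OF F1_deriv] DERIV_isCont[OF F2_deriv])

lemma derivs_bounded: "\<exists>C\<ge>0. \<forall>r\<in>{a..b}. \<bar>F1 r\<bar> \<le> C \<and> \<bar>F2 r\<bar> \<le> C"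
proof -
  have "bounded (F1 ` {a..b})" "bounded (F2 ` {a..b})"
    by (intro compact_imp_bounded compact_continuous_image continuous_at_imp_continuous_on ballI F_isCont;
        simp)+
  then obtain C1 C2 where "\<forall>r\<in>{a..b}. \<bar>F1 r\<bar> \<le> C1" "\<forall>r\<in>{a..b}. \<bar>F2 r\<bar> \<le> C2"
    unfolding bounded_iff ball_simps real_norm_def by blast
  then show ?thesis by (intro exI[of _ "max 0 (max C1 C2)"]) fastforce
qed

lemma B_nonneg: "0 \<le> B" using F_bound[of 0] by simp

definition remainder :: "real \<Rightarrow> real \<Rightarrow> real" where
  "remainder r h = F (r + h) - F r - F1 r * h - F2 r / 2 * h\<^sup>2"

lemma remainder_taylor:
  assumes r: "r \<in> {a..b}" and h: "r + h \<in> {a'<..<b'}"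
  shows "\<bar>remainder r h\<bar> \<le> B * \<bar>h\<bar> ^ 3"
proof (cases "h = 0")
  case True
  then show ?thesis by (simp add: remainder_def)
next
  case False
  define D where "D n = (if n = 0 then F else if n = 1 then F1 else if n = 2 then F2 else F3)" for n :: nat
  let ?l = "min r (r + h)" and ?u = "max r (r + h)"
  have "\<exists>t. (if r + h < r then r + h < t \<and> t < r else r < t \<and> t < r + h) \<and>
    F (r + h) = (\<Sum>m<3. (D m r / fact m) * (r + h - r) ^ m) + (D 3 t / fact 3) * (r + h - r) ^ 3"
  proof (rule Taylor[where a = ?l and b = ?u])
    show "\<forall>m t. m < 3 \<and> ?l \<le> t \<and> t \<le> ?u \<longrightarrow> (D m has_real_derivative D (Suc m) t) (at t)"
    proof (intro allI impI)
      fix m :: nat and t assume m: "m < 3 \<and> ?l \<le> t \<and> t \<le> ?u"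
      then have "t \<in> {a'<..<b'}" using r h ab by (auto simp: min_def max_def split: if_splits)
      moreover have "m = 0 \<or> m = 1 \<or> m = 2" using m by auto
      ultimately show "(D m has_real_derivative D (Suc m) t) (at t)"
        using F_deriv[of t] F1_deriv[of t] F2_deriv[of t] by (auto simp: D_def numeral_2_eq_2)
    qed
  qed (use False in \<open>auto simp: D_def\<close>)
  then obtain t where t0: "if r + h < r then r + h < t \<and> t < r else r < t \<and> t < r + h"
    and F: "F (r + h) = (\<Sum>m<3. (D m r / fact m) * (r + h - r) ^ m) + (D 3 t / fact 3) * (r + h - r) ^ 3"
    by blast
  have t: "?l \<le> t" "t \<le> ?u" using t0 by (auto split: if_splits)
  have "t \<in> {a'<..<b'}" using r h ab t(1,2) by (auto simp: min_def max_def split: if_splits)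
  then have "\<bar>F3 t\<bar> / 6 \<le> B" using F3_bound[of t] B_nonneg by simp
  then have "\<bar>F3 t\<bar> / 6 * \<bar>h\<bar> ^ 3 \<le> B * \<bar>h\<bar> ^ 3" by (intro mult_right_mono) auto
  moreover have "remainder r h = F3 t / 6 * h ^ 3"
    using F by (simp add: remainder_def D_def eval_nat_numeral)
  then have "\<bar>remainder r h\<bar> = \<bar>F3 t\<bar> / 6 * \<bar>h\<bar> ^ 3"
    by (simp only: abs_mult power_abs abs_divide abs_numeral)
  ultimately show ?thesis by linarith
qed

text \<open>Inside the margin Taylor's formula gives the cubic bound; outside it
  \<open>\<bar>h\<bar> \<ge> e\<close>, and the crude bound of order \<open>h\<^sup>2\<close> is
  absorbed. The second bound serves long steps: \<open>h\<close> is quadratic in the step, so a cube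
  would call for sixth moments.\<close>

lemma remainder_bound:
  "\<exists>C\<ge>0. \<forall>r\<in>{a..b}. \<forall>h. \<bar>remainder r h\<bar> \<le> C * \<bar>h\<bar> ^ 3 \<and> \<bar>remainder r h\<bar> \<le> C * (1 + h\<^sup>2)"
proof -
  obtain D where D: "D \<ge> 0" "\<And>r. r \<in> {a..b} \<Longrightarrow> \<bar>F1 r\<bar> \<le> D \<and> \<bar>F2 r\<bar> \<le> D"
    using derivs_bounded by blast
  have crude: "\<bar>remainder r h\<bar> \<le> 2 * B + D * \<bar>h\<bar> + D * h\<^sup>2" if r: "r \<in> {a..b}" for r h
  proof -
    have "\<bar>remainder r h\<bar> \<le> \<bar>F (r + h)\<bar> + \<bar>F r\<bar> + \<bar>F1 r\<bar> * \<bar>h\<bar> + \<bar>F2 r\<bar> / 2 * h\<^sup>2"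
    proof -
      have "\<bar>F2 r / 2 * h\<^sup>2\<bar> = \<bar>F2 r\<bar> / 2 * h\<^sup>2" "\<bar>F1 r * h\<bar> = \<bar>F1 r\<bar> * \<bar>h\<bar>"
        by (simp_all add: abs_mult)
      then show ?thesis unfolding remainder_def by linarith
    qed
    also have "\<dots> \<le> B + B + D * \<bar>h\<bar> + D * h\<^sup>2"
      using D(2)[OF r] D(1) by (intro add_mono F_bound mult_right_mono) auto
    finally show ?thesis by simp
  qed
  define e where "e = min 1 (min (a - a') (b' - b))"
  have e: "0 < e" "e \<le> 1" using ab by (auto simp: e_def)
  define C where "C = max (B + (2 * B + D + D) / e ^ 3) (2 * B + 2 * D)"
  have "\<bar>remainder r h\<bar> \<le> C * \<bar>h\<bar> ^ 3" if r: "r \<in> {a..b}" for r h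
  proof -
    have C: "B + (2 * B + D + D) / e ^ 3 \<le> C" by (simp add: C_def)
    have nn: "0 \<le> (2 * B + D + D) / e ^ 3" using e B_nonneg D by simp
    show ?thesis
    proof (cases "r + h \<in> {a'<..<b'}")
      case True
      have "B * \<bar>h\<bar> ^ 3 \<le> C * \<bar>h\<bar> ^ 3" using C nn by (intro mult_right_mono) auto
      then show ?thesis using remainder_taylor[OF r True] by linarith
    next
      case False
      then have he: "e \<le> \<bar>h\<bar>" using r by (auto simp: e_def abs_if)
      define q where "q = \<bar>h\<bar> / e"
      have q: "1 \<le> q" "\<bar>h\<bar> = e * q" using he e by (auto simp: q_def field_simps)
      have "q \<le> q ^ 3" "q\<^sup>2 \<le> q ^ 3" "1 \<le> q ^ 3"
        using power_increasing[of 1 3 q] power_increasing[of 2 3 q] power_increasing[of 0 3 q] q by auto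
      moreover have "\<bar>h\<bar> \<le> q" using q e mult_right_mono[of e 1 q] by simp
      moreover have "h\<^sup>2 \<le> q\<^sup>2" using \<open>\<bar>h\<bar> \<le> q\<close> by (metis abs_ge_zero power2_abs power_mono)
      ultimately have "2 * B * 1 + D * \<bar>h\<bar> + D * h\<^sup>2 \<le> 2 * B * q ^ 3 + D * q ^ 3 + D * q ^ 3"
        using B_nonneg D(1) by (intro add_mono mult_left_mono) auto
      also have "\<dots> = (2 * B + D + D) / e ^ 3 * \<bar>h\<bar> ^ 3"
        using e by (simp add: q_def power_divide field_simps)
      also have "\<dots> \<le> C * \<bar>h\<bar> ^ 3" using C B_nonneg by (intro mult_right_mono) auto
      finally show ?thesis using crude[OF r, of h] by simp
    qed
  qed
  moreover have "\<bar>remainder r h\<bar> \<le> C * (1 + h\<^sup>2)" if r: "r \<in> {a..b}" for r h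
  proof -
    have "\<bar>h\<bar> \<le> 1 + h\<^sup>2" using sum_squares_bound[of "\<bar>h\<bar>" 1] by simp
    then have "2 * B + D * \<bar>h\<bar> + D * h\<^sup>2 \<le> 2 * B * (1 + h\<^sup>2) + D * (1 + h\<^sup>2) + D * (1 + h\<^sup>2)"
      using mult_left_mono[of 1 "1 + h\<^sup>2" "2 * B"] B_nonneg D(1)
      by (intro add_mono mult_left_mono) auto
    also have "\<dots> = (2 * B + 2 * D) * (1 + h\<^sup>2)" by (simp add: algebra_simps)
    also have "\<dots> \<le> C * (1 + h\<^sup>2)" by (intro mult_right_mono) (auto simp: C_def)
    finally show ?thesis using crude[OF r, of h] by simp
  qed
  moreover have "C \<ge> 0" using B_nonneg D by (simp add: C_def)
  ultimately show ?thesis by blast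
qed

text \<open>The terms of order one and two in \<open>x\<close> of the increment
  \<open>F ((norm (y + x))\<^sup>2) - F ((norm y)\<^sup>2)\<close>.\<close>

definition linearized :: "'v::real_inner \<Rightarrow> 'v \<Rightarrow> real" where
  "linearized y x = F1 ((norm y)\<^sup>2) * (2 * (y \<bullet> x) + (norm x)\<^sup>2) + 2 * F2 ((norm y)\<^sup>2) * (y \<bullet> x)\<^sup>2"

text \<open>With \<open>h = 2 * (y \<bullet> x) + (norm x)\<^sup>2\<close>, the part of
  \<open>h\<^sup>2\<close> beyond \<open>4 * (y \<bullet> x)\<^sup>2\<close> is of order three and
  four, and the remainder is cubic for short steps and quartic for long ones.\<close>

lemma radial_taylor:
  "\<exists>C\<ge>0. \<forall>y x :: 'v::real_inner. (norm y)\<^sup>2 \<in> {a..b} \<longrightarrow>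
     \<bar>F ((norm (y + x))\<^sup>2) - F ((norm y)\<^sup>2) - linearized y x\<bar> \<le> C * (norm x ^ 3 + norm x ^ 4)"
proof -
  obtain D where D: "D \<ge> 0" "\<And>r. r \<in> {a..b} \<Longrightarrow> \<bar>F1 r\<bar> \<le> D \<and> \<bar>F2 r\<bar> \<le> D"
    using derivs_bounded by blast
  obtain C where C: "C \<ge> 0" "\<And>r h. r \<in> {a..b} \<Longrightarrow> \<bar>remainder r h\<bar> \<le> C * \<bar>h\<bar> ^ 3"
    "\<And>r h. r \<in> {a..b} \<Longrightarrow> \<bar>remainder r h\<bar> \<le> C * (1 + h\<^sup>2)"
    using remainder_bound by blast
  \<comment> \<open>\<open>q\<close> serves both regimes:
    \<open>\<bar>h\<bar> \<le> q * norm x\<close> for \<open>norm x \<le> 1\<close>, and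
    \<open>\<bar>h\<bar> \<le> q * (norm x)\<^sup>2\<close> otherwise.\<close>
  define q where "q = 2 * sqrt b + 1"
  have q: "1 \<le> q" using ab by (simp add: q_def)
  define K where "K = C * q ^ 3 + C * (1 + q\<^sup>2) + D * q"
  have nn: "0 \<le> C * q ^ 3" "0 \<le> C * (1 + q\<^sup>2)" "0 \<le> D * q" using C D q by auto
  have "\<bar>F ((norm (y + x))\<^sup>2) - F ((norm y)\<^sup>2) - linearized y x\<bar> \<le> K * (norm x ^ 3 + norm x ^ 4)"
    if y: "(norm y)\<^sup>2 \<in> {a..b}" for y x :: 'v
  proof -
    define r h where "r = (norm y)\<^sup>2" and "h = 2 * (y \<bullet> x) + (norm x)\<^sup>2"
    have r: "r \<in> {a..b}" using y by (simp add: r_def)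
    have "norm y \<le> sqrt b" using y by (simp add: real_le_rsqrt)
    have yx: "\<bar>y \<bullet> x\<bar> \<le> sqrt b * norm x"
      using Cauchy_Schwarz_ineq2[of y x] mult_right_mono[OF \<open>norm y \<le> sqrt b\<close>, of "norm x"] by simp
    have rh: "(norm (y + x))\<^sup>2 = r + h"
      unfolding r_def h_def power2_norm_eq_inner by (simp add: inner_add inner_commute)
    have eq: "F ((norm (y + x))\<^sup>2) - F ((norm y)\<^sup>2) - linearized y x =
      remainder r h + F2 r / 2 * (4 * (y \<bullet> x) * (norm x)\<^sup>2 + norm x ^ 4)"
    proof -
      have "h\<^sup>2 = 4 * (y \<bullet> x)\<^sup>2 + (4 * (y \<bullet> x) * (norm x)\<^sup>2 + norm x ^ 4)"
        unfolding h_def by (simp add: power2_eq_square power4_eq_xxxx algebra_simps)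
      then show ?thesis unfolding rh unfolding remainder_def linearized_def h_def[symmetric] r_def[symmetric]
        by (simp add: algebra_simps)
    qed
    have h: "\<bar>h\<bar> \<le> 2 * sqrt b * norm x + (norm x)\<^sup>2" using yx abs_triangle_ineq[of "2 * (y \<bullet> x)" "(norm x)\<^sup>2"]
      unfolding h_def by (simp add: abs_mult)
    have 1: "\<bar>remainder r h\<bar> \<le> C * q ^ 3 * norm x ^ 3 + C * (1 + q\<^sup>2) * norm x ^ 4"
    proof (cases "norm x \<le> 1")
      case True
      have "\<bar>h\<bar> \<le> q * norm x"
        using h mult_right_mono[OF True, of "norm x"] by (simp add: q_def power2_eq_square algebra_simps)
      then have "\<bar>h\<bar> ^ 3 \<le> (q * norm x) ^ 3" by (intro power_mono) auto
      then have "C * \<bar>h\<bar> ^ 3 \<le> C * q ^ 3 * norm x ^ 3"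
        using C(1) by (simp add: power_mult_distrib mult.assoc mult_left_mono)
      moreover have "0 \<le> C * (1 + q\<^sup>2) * norm x ^ 4" using nn by simp
      ultimately show ?thesis using C(2)[OF r, of h] by linarith
    next
      case False
      have "norm x * 1 \<le> norm x * norm x" using False by (intro mult_left_mono) auto
      then have "norm x \<le> (norm x)\<^sup>2" by (simp add: power2_eq_square)
      then have "\<bar>h\<bar> \<le> q * (norm x)\<^sup>2"
        using h mult_left_mono[of "norm x" "(norm x)\<^sup>2" "2 * sqrt b"] ab
        by (simp add: q_def algebra_simps)
      then have "\<bar>h\<bar>\<^sup>2 \<le> (q * (norm x)\<^sup>2)\<^sup>2" by (intro power_mono) auto
      then have "h\<^sup>2 \<le> q\<^sup>2 * norm x ^ 4" by (simp add: power_mult_distrib flip: power_mult)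
      moreover have "1 \<le> norm x ^ 4" using False by (simp add: one_le_power)
      ultimately have "1 + h\<^sup>2 \<le> (1 + q\<^sup>2) * norm x ^ 4" by (simp add: algebra_simps)
      then have "C * (1 + h\<^sup>2) \<le> C * (1 + q\<^sup>2) * norm x ^ 4"
        using C(1) by (simp add: mult.assoc mult_left_mono)
      moreover have "0 \<le> C * q ^ 3 * norm x ^ 3" using nn by simp
      ultimately show ?thesis using C(3)[OF r, of h] by linarith
    qed
    have 2: "\<bar>F2 r / 2 * (4 * (y \<bullet> x) * (norm x)\<^sup>2 + norm x ^ 4)\<bar> \<le> D * q * (norm x ^ 3 + norm x ^ 4)"
    proof -
      have "\<bar>4 * (y \<bullet> x) * (norm x)\<^sup>2 + norm x ^ 4\<bar> \<le> 4 * \<bar>y \<bullet> x\<bar> * (norm x)\<^sup>2 + norm x ^ 4"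
        by (rule order_trans[OF abs_triangle_ineq]) (simp add: abs_mult)
      also have "\<dots> \<le> 4 * (sqrt b * norm x) * (norm x)\<^sup>2 + norm x ^ 4"
        using yx by (intro add_mono mult_right_mono mult_left_mono) auto
      also have "\<dots> \<le> 2 * q * (norm x ^ 3 + norm x ^ 4)"
      proof -
        have "0 \<le> sqrt b * norm x ^ 4" "0 \<le> norm x ^ 3" "0 \<le> norm x ^ 4" using ab by auto
        then show ?thesis by (simp add: q_def power2_eq_square power3_eq_cube algebra_simps)
      qed
      finally have "\<bar>4 * (y \<bullet> x) * (norm x)\<^sup>2 + norm x ^ 4\<bar> \<le> 2 * q * (norm x ^ 3 + norm x ^ 4)" .
      then have "\<bar>F2 r / 2\<bar> * \<bar>4 * (y \<bullet> x) * (norm x)\<^sup>2 + norm x ^ 4\<bar> \<le>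
          D / 2 * (2 * q * (norm x ^ 3 + norm x ^ 4))"
        using D(2)[OF r] D(1) by (intro mult_mono) auto
      then show ?thesis by (simp add: abs_mult)
    qed
    have "C * q ^ 3 * norm x ^ 3 + C * (1 + q\<^sup>2) * norm x ^ 4 + D * q * (norm x ^ 3 + norm x ^ 4) \<le>
        K * (norm x ^ 3 + norm x ^ 4)"
    proof -
      have "0 \<le> C * q ^ 3 * norm x ^ 4" "0 \<le> C * (1 + q\<^sup>2) * norm x ^ 3" using nn by simp_all
      then show ?thesis by (simp add: K_def algebra_simps)
    qed
    then show ?thesis using 1 2 abs_triangle_ineq[of "remainder r h" "F2 r / 2 * (4 * (y \<bullet> x) * (norm x)\<^sup>2 + norm x ^ 4)"]
      unfolding eq by linarith
  qed
  moreover have "K \<ge> 0" using nn by (simp add: K_def)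
  ultimately show ?thesis by blast
qed

end

section \<open>Expected change over one time step\<close>

locale radial_brownian = brownian_motion M X + radial_function F F1 F2 F3 a' a b b' B
  for M :: "'a measure" and X :: "real \<Rightarrow> 'a \<Rightarrow> 'v::euclidean_space"
    and F F1 F2 F3 a' a b b' B
begin

text \<open>Half the Laplacian of \<open>F ((norm y)\<^sup>2)\<close>, expressed in
  \<open>r = (norm y)\<^sup>2\<close>.\<close>

definition generator :: "real \<Rightarrow> real" where
  "generator r = DIM('v) * F1 r + 2 * r * F2 r"

lemma increment_product:
  fixes h :: "'a \<Rightarrow> real" and g :: "'v \<Rightarrow> real"
  assumes t: "0 \<le> t" "0 < d" and h: "h \<in> borel_measurable (past t)"
    and C: "\<And>\<omega>. \<omega> \<in> space M \<Longrightarrow> \<bar>h \<omega>\<bar> \<le> C"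
    and g: "g \<in> borel_measurable borel" "integrable M (\<lambda>\<omega>. g (X (t + d) \<omega> - X t \<omega>))"
  shows "integrable M (\<lambda>\<omega>. h \<omega> * g (X (t + d) \<omega> - X t \<omega>))"
    and "expectation (\<lambda>\<omega>. h \<omega> * g (X (t + d) \<omega> - X t \<omega>)) =
      expectation h * expectation (\<lambda>\<omega>. g (X (t + d) \<omega> - X t \<omega>))"
proof -
  have hM: "h \<in> borel_measurable M" by (rule measurable_from_past[OF h])
  have int: "integrable M h"
    by (rule integrable_const_bound[of _ C]) (use hM C in auto)
  have "indep_var borel h borel (\<lambda>\<omega>. g (X (t + d) \<omega> - X t \<omega>))"
    by (rule indep_var_past_increment) (use t h g in auto)
  from indep_var_lebesgue_integral[OF this int g(2)] indep_var_integrable[OF this int g(2)]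
  show "integrable M (\<lambda>\<omega>. h \<omega> * g (X (t + d) \<omega> - X t \<omega>))"
    "expectation (\<lambda>\<omega>. h \<omega> * g (X (t + d) \<omega> - X t \<omega>)) =
      expectation h * expectation (\<lambda>\<omega>. g (X (t + d) \<omega> - X t \<omega>))" by auto
qed

text \<open>Each term of \<open>linearized\<close> is a bounded function of the past times a
  polynomial in the independent increment. Means vanish and the covariance is \<open>d\<close> times
  the identity; what survives is \<open>d\<close> times half the Laplacian. The event
  \<open>A\<close> keeps the coefficients bounded.\<close>

lemma
  fixes z :: 'v
  assumes t: "0 \<le> t" "0 < d" and A: "A \<in> sets (past t)"
    and A_ab: "\<And>\<omega>. \<omega> \<in> A \<Longrightarrow> (norm (z + X t \<omega>))\<^sup>2 \<in> {a..b}"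
  shows linearized_integrable:
      "integrable M (\<lambda>\<omega>. indicator A \<omega> * linearized (z + X t \<omega>) (X (t + d) \<omega> - X t \<omega>))"
    and linearized_expectation:
      "expectation (\<lambda>\<omega>. indicator A \<omega> * linearized (z + X t \<omega>) (X (t + d) \<omega> - X t \<omega>)) =
       d * expectation (\<lambda>\<omega>. indicator A \<omega> * generator ((norm (z + X t \<omega>))\<^sup>2))"
proof -
  define Y where "Y \<omega> = z + X t \<omega>" for \<omega>
  define \<xi> where "\<xi> \<omega> = X (t + d) \<omega> - X t \<omega>" for \<omega>
  have A_sub: "A \<subseteq> space M" using sets.sets_into_space[OF A] by (simp add: space_past)
  have [measurable]: "X t \<in> borel_measurable (past t)" using t by (intro measurable_past) auto
  have Y[measurable]: "Y \<in> borel_measurable (past t)" unfolding Y_def by measurable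
  note A[measurable]
  obtain D where D: "D \<ge> 0" "\<And>r. r \<in> {a..b} \<Longrightarrow> \<bar>F1 r\<bar> \<le> D \<and> \<bar>F2 r\<bar> \<le> D"
    using derivs_bounded by blast
  have dist: "distributed M lborel \<xi> (\<lambda>x. ennreal (\<Prod>b\<in>Basis. normal_density 0 (sqrt d) (x \<bullet> b)))"
    using gaussian_increments[of t "t + d"] t unfolding \<xi>_def by simp
  have sd: "0 < sqrt d" using t by simp
  \<comment> \<open>In this order, \<open>h0\<close>, \<open>h1\<close> and \<open>h2\<close> are
    the coefficients of \<open>(norm \<xi>)\<^sup>2\<close>, of one coordinate of
    \<open>\<xi>\<close>, and of a product of two coordinates.\<close>
  define h0 where "h0 \<omega> = indicator A \<omega> * F1 ((norm (Y \<omega>))\<^sup>2)" for \<omega>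
  define h1 where "h1 e \<omega> = indicator A \<omega> * (F1 ((norm (Y \<omega>))\<^sup>2) * (2 * (Y \<omega> \<bullet> e)))" for e \<omega>
  define h2 where "h2 e e' \<omega> = indicator A \<omega> * (2 * F2 ((norm (Y \<omega>))\<^sup>2) * ((Y \<omega> \<bullet> e) * (Y \<omega> \<bullet> e')))" for e e' \<omega>
  have meas[measurable]: "h0 \<in> borel_measurable (past t)" "h1 e \<in> borel_measurable (past t)"
    "h2 e e' \<in> borel_measurable (past t)" for e e'
    unfolding h0_def h1_def h2_def by measurable
  have Yb: "\<bar>Y \<omega> \<bullet> e\<bar> \<le> sqrt b" if "\<omega> \<in> A" "e \<in> Basis" for \<omega> e
  proof -
    have "norm (Y \<omega>) \<le> sqrt b" using A_ab[OF that(1)] by (simp add: real_le_rsqrt Y_def)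
    with Basis_le_norm[OF that(2), of "Y \<omega>"] show ?thesis by simp
  qed
  have b0: "\<bar>h0 \<omega>\<bar> \<le> D" for \<omega>
    using D A_ab[of \<omega>] by (auto simp: h0_def Y_def indicator_def)
  have b1: "\<bar>h1 e \<omega>\<bar> \<le> D * (2 * sqrt b)" if e: "e \<in> Basis" for e \<omega>
  proof (cases "\<omega> \<in> A")
    case True
    then have "\<bar>F1 ((norm (Y \<omega>))\<^sup>2)\<bar> \<le> D" using D A_ab[of \<omega>] by (auto simp: Y_def)
    then have "\<bar>F1 ((norm (Y \<omega>))\<^sup>2)\<bar> * \<bar>2 * (Y \<omega> \<bullet> e)\<bar> \<le> D * (2 * sqrt b)"
      using Yb[OF True e] D by (intro mult_mono) auto
    then show ?thesis using True by (simp add: h1_def abs_mult)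
  next
    case False
    then show ?thesis using D ab by (simp add: h1_def)
  qed
  have b2: "\<bar>h2 e e' \<omega>\<bar> \<le> 2 * D * (sqrt b * sqrt b)" if e: "e \<in> Basis" "e' \<in> Basis" for e e' \<omega>
  proof (cases "\<omega> \<in> A")
    case True
    then have "\<bar>F2 ((norm (Y \<omega>))\<^sup>2)\<bar> \<le> D" using D A_ab[of \<omega>] by (auto simp: Y_def)
    have "\<bar>Y \<omega> \<bullet> e\<bar> * \<bar>Y \<omega> \<bullet> e'\<bar> \<le> sqrt b * sqrt b"
      using Yb[OF True] e ab by (intro mult_mono) auto
    then have "(2 * \<bar>F2 ((norm (Y \<omega>))\<^sup>2)\<bar>) * (\<bar>Y \<omega> \<bullet> e\<bar> * \<bar>Y \<omega> \<bullet> e'\<bar>) \<le> 2 * D * (sqrt b * sqrt b)"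
      using \<open>\<bar>F2 ((norm (Y \<omega>))\<^sup>2)\<bar> \<le> D\<close> by (intro mult_mono[of "2 * \<bar>F2 ((norm (Y \<omega>))\<^sup>2)\<bar>" "2 * D"]) (use D in auto)
    then show ?thesis using True by (simp add: h2_def abs_mult)
  next
    case False
    then show ?thesis using D ab by (simp add: h2_def)
  qed
  have p0: "integrable M (\<lambda>\<omega>. h0 \<omega> * (norm (\<xi> \<omega>))\<^sup>2)"
    "expectation (\<lambda>\<omega>. h0 \<omega> * (norm (\<xi> \<omega>))\<^sup>2) = expectation h0 * (DIM('v) * d)"
    using increment_product[OF t meas(1) b0, of "\<lambda>x. (norm x)\<^sup>2"] gaussian_norm_square[OF dist sd] t
    by (simp_all add: \<xi>_def)
  have p1: "integrable M (\<lambda>\<omega>. h1 e \<omega> * (\<xi> \<omega> \<bullet> e))" "expectation (\<lambda>\<omega>. h1 e \<omega> * (\<xi> \<omega> \<bullet> e)) = 0"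
    if e: "e \<in> Basis" for e
    using increment_product[OF t meas(2) b1[OF e], of "\<lambda>x. x \<bullet> e"] gaussian_mean[OF dist sd e]
      gaussian_mean_integrable[OF dist sd e]
    by (simp_all add: \<xi>_def)
  have p2: "integrable M (\<lambda>\<omega>. h2 e e' \<omega> * ((\<xi> \<omega> \<bullet> e) * (\<xi> \<omega> \<bullet> e')))"
    "expectation (\<lambda>\<omega>. h2 e e' \<omega> * ((\<xi> \<omega> \<bullet> e) * (\<xi> \<omega> \<bullet> e'))) =
      (if e = e' then expectation (h2 e e) * d else 0)"
    if e: "e \<in> Basis" "e' \<in> Basis" for e e'
    using increment_product[OF t meas(3) b2[OF e], of "\<lambda>x. (x \<bullet> e) * (x \<bullet> e')"]
      gaussian_covariance[OF dist sd e] gaussian_covariance_integrable[OF dist sd e] t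
    by (simp_all add: \<xi>_def)
  have inner: "y \<bullet> x = (\<Sum>e\<in>Basis. (y \<bullet> e) * (x \<bullet> e))" for x y :: 'v by (rule euclidean_inner)
  have eq: "indicator A \<omega> * linearized (Y \<omega>) (\<xi> \<omega>) =
      (\<Sum>e\<in>Basis. h1 e \<omega> * (\<xi> \<omega> \<bullet> e)) + h0 \<omega> * (norm (\<xi> \<omega>))\<^sup>2 +
      (\<Sum>e\<in>Basis. \<Sum>e'\<in>Basis. h2 e e' \<omega> * ((\<xi> \<omega> \<bullet> e) * (\<xi> \<omega> \<bullet> e')))" for \<omega>
  proof -
    have 1: "(\<Sum>e\<in>Basis. h1 e \<omega> * (\<xi> \<omega> \<bullet> e)) = indicator A \<omega> * (F1 ((norm (Y \<omega>))\<^sup>2) * (2 * (Y \<omega> \<bullet> \<xi> \<omega>)))"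
      unfolding inner[of "Y \<omega>" "\<xi> \<omega>"] sum_distrib_left h1_def by (intro sum.cong) (simp_all add: algebra_simps)
    have 2: "(\<Sum>e\<in>Basis. \<Sum>e'\<in>Basis. h2 e e' \<omega> * ((\<xi> \<omega> \<bullet> e) * (\<xi> \<omega> \<bullet> e'))) =
       indicator A \<omega> * (2 * F2 ((norm (Y \<omega>))\<^sup>2) * (Y \<omega> \<bullet> \<xi> \<omega>)\<^sup>2)"
    proof -
      have "(Y \<omega> \<bullet> \<xi> \<omega>)\<^sup>2 = (\<Sum>e\<in>Basis. \<Sum>e'\<in>Basis. ((Y \<omega> \<bullet> e) * (\<xi> \<omega> \<bullet> e)) * ((Y \<omega> \<bullet> e') * (\<xi> \<omega> \<bullet> e')))"
        unfolding power2_eq_square inner[of "Y \<omega>" "\<xi> \<omega>"] sum_product ..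
      then show ?thesis
        unfolding h2_def sum_distrib_left by (simp only: sum_distrib_left ac_simps)
    qed
    show ?thesis unfolding 1 2 linearized_def h0_def by (simp add: algebra_simps)
  qed
  have int2: "integrable M (\<lambda>\<omega>. \<Sum>e'\<in>Basis. h2 e e' \<omega> * ((\<xi> \<omega> \<bullet> e) * (\<xi> \<omega> \<bullet> e')))" if "e \<in> Basis" for e
    using p2(1)[OF that] by (intro Bochner_Integration.integrable_sum)
  have int: "integrable M (\<lambda>\<omega>. \<Sum>e\<in>Basis. h1 e \<omega> * (\<xi> \<omega> \<bullet> e))"
    "integrable M (\<lambda>\<omega>. \<Sum>e\<in>Basis. \<Sum>e'\<in>Basis. h2 e e' \<omega> * ((\<xi> \<omega> \<bullet> e) * (\<xi> \<omega> \<bullet> e')))"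
    using p1(1) int2 by (auto intro!: Bochner_Integration.integrable_sum)
  have "integrable M (\<lambda>\<omega>. indicator A \<omega> * linearized (Y \<omega>) (\<xi> \<omega>))"
    unfolding eq by (intro Bochner_Integration.integrable_add int p0)
  then show "integrable M (\<lambda>\<omega>. indicator A \<omega> * linearized (z + X t \<omega>) (X (t + d) \<omega> - X t \<omega>))"
    by (simp add: Y_def \<xi>_def)
  have E1: "expectation (\<lambda>\<omega>. \<Sum>e\<in>Basis. h1 e \<omega> * (\<xi> \<omega> \<bullet> e)) = 0"
    using p1 by (simp add: Bochner_Integration.integral_sum)
  have E2: "expectation (\<lambda>\<omega>. \<Sum>e\<in>Basis. \<Sum>e'\<in>Basis. h2 e e' \<omega> * ((\<xi> \<omega> \<bullet> e) * (\<xi> \<omega> \<bullet> e'))) =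
      (\<Sum>e\<in>Basis. expectation (h2 e e) * d)"
    using p2 int2 by (simp add: Bochner_Integration.integral_sum)
  have i0: "integrable M (h2 e e)" if "e \<in> Basis" for e
    using measurable_from_past[OF meas(3)] b2[OF that that]
    by (intro integrable_const_bound[of _ "2 * D * (sqrt b * sqrt b)"]) auto
  have i0': "integrable M h0"
    using measurable_from_past[OF meas(1)] b0 by (auto intro!: integrable_const_bound[of _ D])
  have "expectation (\<lambda>\<omega>. indicator A \<omega> * linearized (Y \<omega>) (\<xi> \<omega>)) =
      expectation h0 * (DIM('v) * d) + (\<Sum>e\<in>Basis. expectation (h2 e e) * d)"
    unfolding eq using int p0 E1 E2 by simp
  also have "\<dots> = d * (DIM('v) * expectation h0 + (\<Sum>e\<in>Basis. expectation (h2 e e)))"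
    by (simp add: sum_distrib_left[symmetric] sum_distrib_right[symmetric] algebra_simps)
  also have "DIM('v) * expectation h0 + (\<Sum>e\<in>Basis. expectation (h2 e e)) =
      expectation (\<lambda>\<omega>. DIM('v) * h0 \<omega> + (\<Sum>e\<in>Basis. h2 e e \<omega>))"
    using i0 i0' by (simp add: Bochner_Integration.integral_sum)
  also have "(\<lambda>\<omega>. DIM('v) * h0 \<omega> + (\<Sum>e\<in>Basis. h2 e e \<omega>)) =
      (\<lambda>\<omega>. indicator A \<omega> * generator ((norm (Y \<omega>))\<^sup>2))"
  proof
    fix \<omega>
    have "(\<Sum>e\<in>Basis. h2 e e \<omega>) = indicator A \<omega> * (2 * F2 ((norm (Y \<omega>))\<^sup>2) * (norm (Y \<omega>))\<^sup>2)"
      unfolding power2_norm_eq_inner inner[of "Y \<omega>" "Y \<omega>"] sum_distrib_left h2_def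
      by (intro sum.cong) (simp_all add: power2_norm_eq_inner[symmetric] inner[symmetric])
    then show "DIM('v) * h0 \<omega> + (\<Sum>e\<in>Basis. h2 e e \<omega>) = indicator A \<omega> * generator ((norm (Y \<omega>))\<^sup>2)"
      by (simp add: h0_def generator_def algebra_simps)
  qed
  finally show "expectation (\<lambda>\<omega>. indicator A \<omega> * linearized (z + X t \<omega>) (X (t + d) \<omega> - X t \<omega>)) =
       d * expectation (\<lambda>\<omega>. indicator A \<omega> * generator ((norm (z + X t \<omega>))\<^sup>2))"
    by (simp add: Y_def \<xi>_def)
qed

text \<open>The constant is uniform in the starting point, the time and the event. An error of order
  \<open>d * sqrt d\<close> per step, over about \<open>K / d\<close> steps, vanishes with the
  mesh.\<close>

lemma one_step:
  "\<exists>C\<ge>0. \<forall>z t d A. 0 \<le> t \<longrightarrow> 0 < d \<longrightarrow> A \<in> sets (past t) \<longrightarrow>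
      (\<forall>\<omega>\<in>A. (norm (z + X t \<omega>))\<^sup>2 \<in> {a..b}) \<longrightarrow>
      \<bar>expectation (\<lambda>\<omega>. indicator A \<omega> * (F ((norm (z + X (t + d) \<omega>))\<^sup>2) - F ((norm (z + X t \<omega>))\<^sup>2))) -
        d * expectation (\<lambda>\<omega>. indicator A \<omega> * generator ((norm (z + X t \<omega>))\<^sup>2))\<bar> \<le> C * (d * sqrt d + d\<^sup>2)"
proof -
  obtain C where C: "C \<ge> 0" "\<And>y x :: 'v. (norm y)\<^sup>2 \<in> {a..b} \<Longrightarrow>
     \<bar>F ((norm (y + x))\<^sup>2) - F ((norm y)\<^sup>2) - linearized y x\<bar> \<le> C * (norm x ^ 3 + norm x ^ 4)"
    using radial_taylor by blast
  define m where "m = DIM('v) + 3 * (DIM('v))\<^sup>2"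
  have "\<bar>expectation (\<lambda>\<omega>. indicator A \<omega> * (F ((norm (z + X (t + d) \<omega>))\<^sup>2) - F ((norm (z + X t \<omega>))\<^sup>2))) -
        d * expectation (\<lambda>\<omega>. indicator A \<omega> * generator ((norm (z + X t \<omega>))\<^sup>2))\<bar> \<le> (C * m) * (d * sqrt d + d\<^sup>2)"
    if t: "0 \<le> t" "0 < d" and A: "A \<in> sets (past t)" and A_ab: "\<forall>\<omega>\<in>A. (norm (z + X t \<omega>))\<^sup>2 \<in> {a..b}"
    for z t d A
  proof -
    define Y where "Y \<omega> = z + X t \<omega>" for \<omega>
    define \<xi> where "\<xi> \<omega> = X (t + d) \<omega> - X t \<omega>" for \<omega>
    have [measurable]: "X t \<in> borel_measurable M" "X (t + d) \<in> borel_measurable M"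
      using t by (auto intro: measurable_motion)
    have [measurable]: "A \<in> events" using A sets_past_subset by blast
    have [measurable]: "Y \<in> borel_measurable M" "\<xi> \<in> borel_measurable M" unfolding Y_def \<xi>_def by measurable
    have dist: "distributed M lborel \<xi> (\<lambda>x. ennreal (\<Prod>b\<in>Basis. normal_density 0 (sqrt d) (x \<bullet> b)))"
      using gaussian_increments[of t "t + d"] t unfolding \<xi>_def by simp
    have sd: "0 < sqrt d" using t by simp
    note sq = gaussian_norm_square[OF dist sd] and fo = gaussian_norm_fourth[OF dist sd]
    \<comment> \<open>Splitting at \<open>sqrt d\<close> replaces the cube by even powers, whose
      moments give an expectation of order \<open>d * sqrt d\<close>.\<close>
    have cube: "norm x ^ 3 \<le> sqrt d * (norm x)\<^sup>2 + norm x ^ 4 / sqrt d" for x :: 'v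
    proof (cases "norm x \<le> sqrt d")
      case True
      then have "norm x * (norm x)\<^sup>2 \<le> sqrt d * (norm x)\<^sup>2" by (intro mult_right_mono) auto
      moreover have "0 \<le> norm x ^ 4 / sqrt d" using sd by simp
      moreover have "norm x ^ 3 = norm x * (norm x)\<^sup>2" by (simp add: power3_eq_cube power2_eq_square)
      ultimately show ?thesis by linarith
    next
      case False
      then have "norm x ^ 3 * sqrt d \<le> norm x ^ 3 * norm x" by (intro mult_left_mono) auto
      then have "norm x ^ 3 \<le> norm x ^ 4 / sqrt d"
        using sd by (simp add: pos_le_divide_eq power3_eq_cube power4_eq_xxxx)
      moreover have "0 \<le> sqrt d * (norm x)\<^sup>2" using sd by simp
      ultimately show ?thesis by linarith
    qed
    define e where "e \<omega> = C * (sqrt d * (norm (\<xi> \<omega>))\<^sup>2 + norm (\<xi> \<omega>) ^ 4 / sqrt d + norm (\<xi> \<omega>) ^ 4)" for \<omega>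
    have e_int: "integrable M e" unfolding e_def using sq fo by simp
    have "expectation e = C * (sqrt d * (DIM('v) * d) + expectation (\<lambda>\<omega>. norm (\<xi> \<omega>) ^ 4) / sqrt d +
        expectation (\<lambda>\<omega>. norm (\<xi> \<omega>) ^ 4))"
      unfolding e_def using sq fo t by simp
    also have "\<dots> \<le> C * (sqrt d * (DIM('v) * d) + 3 * (DIM('v))\<^sup>2 * sqrt d ^ 4 / sqrt d + 3 * (DIM('v))\<^sup>2 * sqrt d ^ 4)"
      using fo(2) C(1) sd by (intro mult_left_mono add_mono divide_right_mono) auto
    also have "3 * (DIM('v))\<^sup>2 * sqrt d ^ 4 / sqrt d = 3 * (DIM('v))\<^sup>2 * (d * sqrt d)"
      using t by (simp add: power4_eq_xxxx)
    also have "sqrt d ^ 4 = d\<^sup>2" using t by (simp add: power4_eq_xxxx power2_eq_square)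
    also have "C * (sqrt d * (DIM('v) * d) + 3 * (DIM('v))\<^sup>2 * (d * sqrt d) + 3 * (DIM('v))\<^sup>2 * d\<^sup>2) \<le>
        (C * m) * (d * sqrt d + d\<^sup>2)"
    proof -
      have "0 \<le> C * (DIM('v) * d\<^sup>2)" using C by simp
      then show ?thesis by (simp add: m_def algebra_simps)
    qed
    finally have Ee: "expectation e \<le> (C * m) * (d * sqrt d + d\<^sup>2)" .
    define G where "G \<omega> = indicator A \<omega> * (F ((norm (Y \<omega> + \<xi> \<omega>))\<^sup>2) - F ((norm (Y \<omega>))\<^sup>2))" for \<omega>
    define P where "P \<omega> = indicator A \<omega> * linearized (Y \<omega>) (\<xi> \<omega>)" for \<omega>
    have G_int: "integrable M G"
    proof (rule integrable_const_bound[of _ "B + B"])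
      have "\<bar>G \<omega>\<bar> \<le> B + B" for \<omega>
        using F_bound[of "(norm (Y \<omega> + \<xi> \<omega>))\<^sup>2"] F_bound[of "(norm (Y \<omega>))\<^sup>2"] B_nonneg
        by (auto simp: G_def indicator_def)
      then show "AE \<omega> in M. norm (G \<omega>) \<le> B + B" by simp
    qed (unfold G_def, measurable)
    have P_int: "integrable M P"
      using linearized_integrable[OF t A, of z] A_ab by (simp add: P_def[abs_def] Y_def \<xi>_def)
    have "\<bar>expectation G - expectation P\<bar> = \<bar>expectation (\<lambda>\<omega>. G \<omega> - P \<omega>)\<bar>"
      using G_int P_int by simp
    also have "\<dots> \<le> expectation (\<lambda>\<omega>. \<bar>G \<omega> - P \<omega>\<bar>)" by (rule integral_abs_bound)
    also have "\<dots> \<le> expectation e"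
    proof (rule integral_mono)
      show "integrable M (\<lambda>\<omega>. \<bar>G \<omega> - P \<omega>\<bar>)" using G_int P_int by simp
      fix \<omega> assume "\<omega> \<in> space M"
      have "0 \<le> e \<omega>" using C(1) sd by (simp add: e_def)
      show "\<bar>G \<omega> - P \<omega>\<bar> \<le> e \<omega>"
      proof (cases "\<omega> \<in> A")
        case True
        then have "\<bar>G \<omega> - P \<omega>\<bar> \<le> C * (norm (\<xi> \<omega>) ^ 3 + norm (\<xi> \<omega>) ^ 4)"
          using C(2)[of "Y \<omega>" "\<xi> \<omega>"] A_ab by (simp add: G_def P_def Y_def)
        also have "\<dots> \<le> e \<omega>" unfolding e_def using cube[of "\<xi> \<omega>"] C(1) by (intro mult_left_mono) auto
        finally show ?thesis .
      qed (use \<open>0 \<le> e \<omega>\<close> in \<open>simp add: G_def P_def\<close>)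
    qed (rule e_int)
    also note Ee
    also have "expectation P = d * expectation (\<lambda>\<omega>. indicator A \<omega> * generator ((norm (z + X t \<omega>))\<^sup>2))"
      using linearized_expectation[OF t A, of z] A_ab by (simp add: P_def[abs_def] Y_def \<xi>_def)
    also have "G = (\<lambda>\<omega>. indicator A \<omega> * (F ((norm (z + X (t + d) \<omega>))\<^sup>2) - F ((norm (z + X t \<omega>))\<^sup>2)))"
      by (simp add: G_def Y_def \<xi>_def fun_eq_iff)
    finally show ?thesis .
  qed
  moreover have "0 \<le> C * m" using C by simp
  ultimately show ?thesis by blast
qed

end

section \<open>Dynkin's formula\<close>

text \<open>Discrete stopping: for a property that stays lost once lost, the increments taken while
  it holds telescope to the value at the first index where it fails, or at \<open>n\<close>.\<close>

lemma sum_telescope_until: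
  fixes f :: "nat \<Rightarrow> real"
  assumes P: "\<And>k. P (Suc k) \<Longrightarrow> P k"
  shows "{k. k < n \<and> P k} = {..<card {k. k < n \<and> P k}} \<and>
    (\<Sum>k<n. if P k then f (Suc k) - f k else 0) = f (card {k. k < n \<and> P k}) - f 0"
proof (induction n)
  case (Suc n)
  have down: "P j" if "P i" "j \<le> i" for i j
    using that(2,1) by (induction rule: dec_induct) (auto intro: P)
  show ?case
  proof (cases "P n")
    case True
    then have "{k. k < Suc n \<and> P k} = {..<Suc n}" "{k. k < n \<and> P k} = {..<n}"
      using down[of n] by auto
    then show ?thesis using Suc True by simp
  next
    case False
    then have "{k. k < Suc n \<and> P k} = {k. k < n \<and> P k}" using less_Suc_eq by auto
    then show ?thesis using Suc False by simp
  qed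
qed simp

text \<open>The step functions sample \<open>f\<close> at the right end of each cell, the side on
  which continuity is given, and converge boundedly. The left sums exceed the right ones by
  \<open>K / Suc n * (f 0 - f K)\<close>, by telescoping.\<close>

lemma riemann_sums_right_continuous:
  fixes f :: "real \<Rightarrow> real"
  assumes K: "0 < K" and C: "\<And>t. t \<in> {0..K} \<Longrightarrow> \<bar>f t\<bar> \<le> C"
    and right_cont: "\<And>t s. 0 \<le> t \<Longrightarrow> t < K \<Longrightarrow> (\<And>n. t \<le> s n) \<Longrightarrow> s \<longlonglongrightarrow> t \<Longrightarrow> (\<lambda>n. f (s n)) \<longlonglongrightarrow> f t"
  shows "integrable lborel (\<lambda>t. indicator {0..<K} t * f t)"
    and "(\<lambda>n. \<Sum>k<Suc n. K / real (Suc n) * f (real k * (K / real (Suc n))))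
      \<longlonglongrightarrow> (\<integral>t. indicator {0..<K} t * f t \<partial>lborel)"
proof -
  define d where "d n = K / real (Suc n)" for n
  have d: "0 < d n" "real (Suc n) * d n = K" for n using K by (simp_all add: d_def)
  have d0: "d \<longlonglongrightarrow> 0"
    using tendsto_mult_right_zero[OF LIMSEQ_inverse_real_of_nat, of K]
    by (simp add: d_def[abs_def] divide_inverse)
  define g where "g n t = (\<Sum>k<Suc n. indicator {real k * d n..<real (Suc k) * d n} t * f (real (Suc k) * d n))" for n t
  define j where "j n t = nat \<lfloor>t / d n\<rfloor>" for n t
  have j: "real (j n t) * d n \<le> t" "t < real (Suc (j n t)) * d n" "j n t < Suc n"
    if "0 \<le> t" "t < K" for n t
  proof -
    have "real (j n t) = real_of_int \<lfloor>t / d n\<rfloor>" using that d[of n] by (simp add: j_def)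
    then have "real (j n t) \<le> t / d n" "t / d n < real (j n t) + 1" by linarith+
    then show 1: "real (j n t) * d n \<le> t" "t < real (Suc (j n t)) * d n"
      using d[of n] by (simp_all add: pos_le_divide_eq pos_divide_less_eq algebra_simps)
    have "real (j n t) * d n < real (Suc n) * d n" unfolding d(2) using 1(1) that(2) by simp
    then show "j n t < Suc n" by (simp only: mult_less_cancel_right_pos[OF d(1)] of_nat_less_iff)
  qed
  have g_in: "g n t = f (real (Suc (j n t)) * d n)" if t: "0 \<le> t" "t < K" for n t
  proof -
    have "indicator {real k * d n..<real (Suc k) * d n} t * f (real (Suc k) * d n) =
        (if k = j n t then f (real (Suc k) * d n) else 0)" for k
    proof (cases "t \<in> {real k * d n..<real (Suc k) * d n}")
      case True
      then have "real k \<le> t / d n" "t / d n < real k + 1"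
        using d[of n] by (simp_all add: pos_le_divide_eq pos_divide_less_eq algebra_simps)
      then have "\<lfloor>t / d n\<rfloor> = int k" by (simp add: floor_eq_iff)
      then show ?thesis using True by (simp add: j_def)
    next
      case False
      then have "k \<noteq> j n t" using j(1,2)[OF t, of n] by auto
      then show ?thesis using False by simp
    qed
    then show ?thesis unfolding g_def using j(3)[OF t, of n] by (simp only: sum.delta finite_lessThan) simp
  qed
  have g_out: "g n t = 0" if "\<not> (0 \<le> t \<and> t < K)" for n t
  proof -
    have "t \<notin> {real k * d n..<real (Suc k) * d n}" if "k < Suc n" for k
    proof
      assume "t \<in> {real k * d n..<real (Suc k) * d n}"
      then have "0 \<le> t" "t < real (Suc k) * d n" using d(1)[of n] by (auto intro: order_trans[rotated])
      moreover have "real (Suc k) * d n \<le> real (Suc n) * d n"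
        using that d(1)[of n] by (intro mult_right_mono) auto
      ultimately show False using \<open>\<not> (0 \<le> t \<and> t < K)\<close> d(2)[of n] by linarith
    qed
    then show ?thesis unfolding g_def by (intro sum.neutral) auto
  qed
  have C0: "0 \<le> C" using C[of 0] K by simp
  have g_bound: "\<bar>g n t\<bar> \<le> C * indicator {0..K} t" for n t
  proof (cases "0 \<le> t \<and> t < K")
    case True
    then have "j n t < Suc n" using j by simp
    then have "real (Suc (j n t)) * d n \<le> real (Suc n) * d n"
      using d(1)[of n] by (intro mult_right_mono) auto
    then have "real (Suc (j n t)) * d n \<in> {0..K}" unfolding d(2) using d(1)[of n] by (simp add: less_imp_le)
    from C[OF this] show ?thesis using True g_in[of t n] by simp
  next
    case False
    then show ?thesis using g_out[of t n] C0 by (simp add: indicator_def)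
  qed
  have lim: "(\<lambda>n. g n t) \<longlonglongrightarrow> indicator {0..<K} t * f t" for t
  proof (cases "0 \<le> t \<and> t < K")
    case True
    have "(\<lambda>n. real (Suc (j n t)) * d n) \<longlonglongrightarrow> t"
    proof (rule tendsto_sandwich)
      show "\<forall>\<^sub>F n in sequentially. t \<le> real (Suc (j n t)) * d n"
        using less_imp_le[OF j(2)] True by (intro always_eventually allI) blast
      show "\<forall>\<^sub>F n in sequentially. real (Suc (j n t)) * d n \<le> t + d n"
        using j(1) True by (intro always_eventually allI) (simp add: algebra_simps)
      show "(\<lambda>n. t + d n) \<longlonglongrightarrow> t" using tendsto_add[OF tendsto_const d0, of t] by simp
    qed simp
    then have "(\<lambda>n. f (real (Suc (j n t)) * d n)) \<longlonglongrightarrow> f t"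
      using True j(2) by (intro right_cont) (auto intro: less_imp_le)
    then show ?thesis using True g_in[of t] by simp
  next
    case False
    then have "t \<notin> {0..<K}" by auto
    then show ?thesis using g_out[OF False] by simp
  qed
  have g_meas: "g n \<in> borel_measurable lborel" for n unfolding g_def by measurable
  have bound_int: "integrable lborel (\<lambda>t. C * indicator {0..K} t)"
    by (intro integrable_mult_right integrable_real_indicator) (auto simp: emeasure_lborel_Icc_eq)
  have lim_meas: "(\<lambda>t. indicator {0..<K} t * f t) \<in> borel_measurable lborel"
    by (rule borel_measurable_LIMSEQ_real[OF lim g_meas])
  show "integrable lborel (\<lambda>t. indicator {0..<K} t * f t)"
    by (rule integrable_dominated_convergence[OF lim_meas g_meas bound_int AE_I2 AE_I2])
      (use lim g_bound in auto)
  have conv: "(\<lambda>n. integral\<^sup>L lborel (g n)) \<longlonglongrightarrow> (\<integral>t. indicator {0..<K} t * f t \<partial>lborel)"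
    by (rule integral_dominated_convergence[OF lim_meas g_meas bound_int AE_I2 AE_I2])
      (use lim g_bound in auto)
  have int_g: "integral\<^sup>L lborel (g n) = (\<Sum>k<Suc n. d n * f (real (Suc k) * d n))" for n
  proof -
    have "integrable lborel (\<lambda>t. indicator {real k * d n..<real (Suc k) * d n} t * f (real (Suc k) * d n))" for k
      using d(1)[of n] by (intro integrable_mult_left integrable_real_indicator) auto
    moreover have "(\<integral>t. indicator {real k * d n..<real (Suc k) * d n} t * f (real (Suc k) * d n) \<partial>lborel) =
        d n * f (real (Suc k) * d n)" for k
    proof -
      have "measure lborel {real k * d n..<real (Suc k) * d n} = d n"
        using d(1)[of n] by (subst measure_lborel_Ico) (auto simp: algebra_simps)
      then show ?thesis by simp
    qed
    ultimately show ?thesis unfolding g_def by (subst Bochner_Integration.integral_sum) (simp_all only:)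
  qed
  have "(\<Sum>k<Suc n. d n * f (real k * d n)) = integral\<^sup>L lborel (g n) + d n * (f 0 - f K)" for n
  proof -
    have "(\<Sum>k<Suc n. d n * f (real (Suc k) * d n)) - (\<Sum>k<Suc n. d n * f (real k * d n)) =
        d n * (\<Sum>k<Suc n. f (real (Suc k) * d n) - f (real k * d n))"
      by (simp only: sum_subtractf sum_distrib_left right_diff_distrib)
    also have "(\<Sum>k<Suc n. f (real (Suc k) * d n) - f (real k * d n)) = f (real (Suc n) * d n) - f (real 0 * d n)"
      by (rule sum_lessThan_telescope)
    finally show ?thesis unfolding int_g d(2) by (simp add: algebra_simps)
  qed
  moreover have "(\<lambda>n. integral\<^sup>L lborel (g n) + d n * (f 0 - f K)) \<longlonglongrightarrow>
      (\<integral>t. indicator {0..<K} t * f t \<partial>lborel) + 0 * (f 0 - f K)"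
    by (intro tendsto_intros conv d0)
  ultimately show "(\<lambda>n. \<Sum>k<Suc n. K / real (Suc n) * f (real k * (K / real (Suc n))))
      \<longlonglongrightarrow> (\<integral>t. indicator {0..<K} t * f t \<partial>lborel)"
    unfolding d_def by simp
qed

section \<open>Dynkin's formula up to a capped exit time\<close>

context radial_brownian
begin

lemma generator_bounded: "\<exists>C\<ge>0. \<forall>r\<in>{a..b}. \<bar>generator r\<bar> \<le> C"
proof -
  have "bounded (generator ` {a..b})" unfolding generator_def
    by (intro compact_imp_bounded compact_continuous_image continuous_at_imp_continuous_on ballI F_isCont
        continuous_intros; simp)
  then obtain C where "\<forall>r\<in>{a..b}. \<bar>generator r\<bar> \<le> C"
    unfolding bounded_iff ball_simps real_norm_def by blast
  then show ?thesis by (intro exI[of _ "max 0 C"]) fastforce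
qed

lemma generator_measurable[measurable]: "generator \<in> borel_measurable borel"
  unfolding generator_def by measurable

lemma generator_isCont: "r \<in> {a..b} \<Longrightarrow> isCont generator r"
  unfolding generator_def by (intro continuous_intros F_isCont)

context
  fixes U :: "'v set" and z :: 'v
  assumes U: "open U" and U_ab: "\<And>y. y \<in> U \<Longrightarrow> (norm y)\<^sup>2 \<in> {a..b}" and z: "z \<in> closure U"
begin

definition alive :: "real \<Rightarrow> 'a set" where
  "alive t = {\<omega>\<in>space M. \<forall>s\<in>{0..t}. z + X s \<omega> \<in> U}"

text \<open>Formally the time derivative of the expectation of \<open>F\<close> along the motion
  stopped on leaving \<open>U\<close>: only paths still inside contribute.\<close>

definition rate :: "real \<Rightarrow> real" where
  "rate t = expectation (\<lambda>\<omega>. indicator (alive t) \<omega> * generator ((norm (z + X t \<omega>))\<^sup>2))"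

lemma path_continuous: "\<omega> \<in> space M \<Longrightarrow> continuous_on {0..} (\<lambda>t. z + X t \<omega>)"
  by (intro continuous_intros continuous_paths)

lemma closure_ab: "y \<in> closure U \<Longrightarrow> (norm y)\<^sup>2 \<in> {a..b}"
proof -
  have "closed ({y :: 'v. a \<le> (norm y)\<^sup>2} \<inter> {y. (norm y)\<^sup>2 \<le> b})"
    by (intro closed_Int closed_Collect_le continuous_intros)
  then have "closure U \<subseteq> {y. a \<le> (norm y)\<^sup>2} \<inter> {y. (norm y)\<^sup>2 \<le> b}"
    by (rule closure_minimal[rotated]) (use U_ab in auto)
  then show "y \<in> closure U \<Longrightarrow> (norm y)\<^sup>2 \<in> {a..b}" by auto
qed

lemma alive_past: "0 \<le> t \<Longrightarrow> alive t \<in> sets (past t)"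
  unfolding alive_def space_past[of t, symmetric]
  by (rule sets_path_in_open) (use U path_continuous measurable_past in \<open>auto simp: space_past\<close>)

lemma alive_measurable[measurable]: "0 \<le> t \<Longrightarrow> alive t \<in> events"
  using alive_past sets_past_subset by blast

lemma alive_ab: "0 \<le> t \<Longrightarrow> \<omega> \<in> alive t \<Longrightarrow> (norm (z + X t \<omega>))\<^sup>2 \<in> {a..b}"
  using U_ab by (auto simp: alive_def)

lemma rate_bounded: "\<exists>C\<ge>0. \<forall>t\<ge>0. \<bar>rate t\<bar> \<le> C \<and>
   (\<forall>\<omega>. \<bar>indicator (alive t) \<omega> * generator ((norm (z + X t \<omega>))\<^sup>2)\<bar> \<le> C)"
proof -
  obtain C where C: "C \<ge> 0" "\<And>r. r \<in> {a..b} \<Longrightarrow> \<bar>generator r\<bar> \<le> C" using generator_bounded by blast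
  have 1: "\<bar>indicator (alive t) \<omega> * generator ((norm (z + X t \<omega>))\<^sup>2)\<bar> \<le> C" if "0 \<le> t" for t \<omega>
    using C alive_ab[OF that] by (auto simp: indicator_def)
  have "\<bar>rate t\<bar> \<le> C" if t: "0 \<le> t" for t
  proof -
    have "\<bar>rate t\<bar> \<le> expectation (\<lambda>\<omega>. \<bar>indicator (alive t) \<omega> * generator ((norm (z + X t \<omega>))\<^sup>2)\<bar>)"
      unfolding rate_def by (rule integral_abs_bound)
    also have "\<dots> \<le> expectation (\<lambda>_. C)"
      by (rule integral_mono') (use 1[OF t] C in auto)
    finally show ?thesis by (simp add: prob_space)
  qed
  with 1 C show ?thesis by blast
qed

text \<open>A path that has left \<open>U\<close> by time \<open>t\<close> stays excluded
  afterwards, and a path still inside at \<open>t\<close> remains in the open set for a while.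
  Dominated convergence gives continuity from the right.\<close>

lemma rate_right_continuous:
  assumes t: "0 \<le> t" and s: "\<And>n. t \<le> s n" "s \<longlonglongrightarrow> t"
  shows "(\<lambda>n. rate (s n)) \<longlonglongrightarrow> rate t"
proof -
  obtain C where C: "\<And>t \<omega>. t \<ge> 0 \<Longrightarrow> \<bar>indicator (alive t) \<omega> * generator ((norm (z + X t \<omega>))\<^sup>2)\<bar> \<le> C"
    using rate_bounded by blast
  have s0: "0 \<le> s n" for n using t s(1)[of n] by linarith
  have meas: "(\<lambda>\<omega>. indicator (alive t) \<omega> * generator ((norm (z + X t \<omega>))\<^sup>2)) \<in> borel_measurable M" if "0 \<le> t" for t
  proof -
    have [measurable]: "alive t \<in> events" "X t \<in> borel_measurable M"
      using that by (auto intro: measurable_motion)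
    show ?thesis by measurable
  qed
  show ?thesis unfolding rate_def
  proof (rule integral_dominated_convergence[where w = "\<lambda>_. C"])
    show "AE \<omega> in M. (\<lambda>n. indicator (alive (s n)) \<omega> * generator ((norm (z + X (s n) \<omega>))\<^sup>2))
        \<longlonglongrightarrow> indicator (alive t) \<omega> * generator ((norm (z + X t \<omega>))\<^sup>2)"
    proof (rule AE_I2)
      fix \<omega> assume \<omega>: "\<omega> \<in> space M"
      note cont = path_continuous[OF \<omega>]
      show "(\<lambda>n. indicator (alive (s n)) \<omega> * generator ((norm (z + X (s n) \<omega>))\<^sup>2))
        \<longlonglongrightarrow> indicator (alive t) \<omega> * generator ((norm (z + X t \<omega>))\<^sup>2)"
      proof (cases "\<omega> \<in> alive t")
        case False
        have "\<omega> \<notin> alive (s n)" for n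
          using False s(1)[of n] t by (auto simp: alive_def)
        with False show ?thesis by simp
      next
        case True
        have "((\<lambda>t. z + X t \<omega>) \<longlongrightarrow> z + X t \<omega>) (at t within {0..})"
          using cont t by (auto simp: continuous_on_def)
        moreover have "z + X t \<omega> \<in> U" using True t by (auto simp: alive_def)
        ultimately have "eventually (\<lambda>u. z + X u \<omega> \<in> U) (at t within {0..})"
          using U by (intro topological_tendstoD) auto
        then obtain e where e: "e > 0" "\<And>u. 0 \<le> u \<Longrightarrow> u \<noteq> t \<Longrightarrow> dist u t < e \<Longrightarrow> z + X u \<omega> \<in> U"
          by (auto simp: eventually_at)
        have "eventually (\<lambda>n. dist (s n) t < e) sequentially" using s(2) e(1) by (rule tendstoD)
        then have ev: "eventually (\<lambda>n. \<omega> \<in> alive (s n)) sequentially"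
        proof eventually_elim
          case (elim n)
          have "z + X u \<omega> \<in> U" if "0 \<le> u" "u \<le> s n" for u
            using True e(2)[of u] that elim s(1)[of n] by (cases "u \<le> t") (auto simp: alive_def dist_real_def)
          then show ?case using \<omega> by (auto simp: alive_def)
        qed
        have "(\<lambda>n. z + X (s n) \<omega>) \<longlonglongrightarrow> z + X t \<omega>"
          by (rule continuous_on_tendsto_compose[OF cont s(2)]) (use s0 t in auto)
        then have "(\<lambda>n. generator ((norm (z + X (s n) \<omega>))\<^sup>2)) \<longlonglongrightarrow> generator ((norm (z + X t \<omega>))\<^sup>2)"
          by (intro isCont_tendsto_compose[OF generator_isCont[OF alive_ab[OF t True]]] tendsto_power tendsto_norm)
        then have "(\<lambda>n. generator ((norm (z + X (s n) \<omega>))\<^sup>2)) \<longlonglongrightarrow> indicator (alive t) \<omega> * generator ((norm (z + X t \<omega>))\<^sup>2)"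
          using True by simp
        then show ?thesis
          by (rule Lim_transform_eventually) (use ev in \<open>auto elim: eventually_mono\<close>)
      qed
    qed
  qed (use meas s0 t C in auto)
qed

lemma exit_measurable:
  assumes K: "0 \<le> K"
  shows "(\<lambda>\<omega>. z + X (exit_time U K (\<lambda>t. z + X t \<omega>)) \<omega>) \<in> borel_measurable M"
proof -
  have X: "(\<lambda>\<omega>. z + X s \<omega>) \<in> borel_measurable M" if "0 \<le> s" for s
  proof -
    have [measurable]: "X s \<in> borel_measurable M" using that by (rule measurable_motion)
    show ?thesis by measurable
  qed
  show ?thesis
    by (rule measurable_path_at[where x = "\<lambda>\<omega> t. z + X t \<omega>"])
      (use X path_continuous K U in \<open>auto intro!: measurable_exit_time exit_time_nonneg\<close>)
qed

text \<open>The motion is stopped on a grid of mesh \<open>d n\<close> and \<open>one_step\<close>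
  is summed over the grid; then the mesh tends to 0 on both sides.\<close>

theorem dynkin_fixed_time:
  assumes K: "0 < K"
  shows "integrable lborel (\<lambda>t. indicator {0..<K} t * rate t)"
    and "expectation (\<lambda>\<omega>. F ((norm (z + X (exit_time U K (\<lambda>t. z + X t \<omega>)) \<omega>))\<^sup>2)) =
      F ((norm z)\<^sup>2) + (\<integral>t. indicator {0..<K} t * rate t \<partial>lborel)"
proof -
  define S where "S \<omega> = exit_time U K (\<lambda>t. z + X t \<omega>)" for \<omega>
  define G where "G t \<omega> = F ((norm (z + X t \<omega>))\<^sup>2)" for t \<omega>
  define d where "d n = K / real (Suc n)" for n
  have d: "0 < d n" "real (Suc n) * d n = K" for n using K by (simp_all add: d_def)
  have d0: "d \<longlonglongrightarrow> 0"
    using tendsto_mult_right_zero[OF LIMSEQ_inverse_real_of_nat, of K]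
    by (simp add: d_def[abs_def] divide_inverse)
  obtain Cr where Cr: "\<And>t. t \<ge> 0 \<Longrightarrow> \<bar>rate t\<bar> \<le> Cr" using rate_bounded by blast
  have riem: "integrable lborel (\<lambda>t. indicator {0..<K} t * rate t)"
    "(\<lambda>n. \<Sum>k<Suc n. d n * rate (real k * d n)) \<longlonglongrightarrow> (\<integral>t. indicator {0..<K} t * rate t \<partial>lborel)"
    using riemann_sums_right_continuous[OF K, of rate Cr] Cr rate_right_continuous
    by (auto simp: d_def)
  show "integrable lborel (\<lambda>t. indicator {0..<K} t * rate t)" by (rule riem)
  have X_meas: "X s \<in> borel_measurable M" if "0 \<le> s" for s using that by (rule measurable_motion)
  have G_meas: "G t \<in> borel_measurable M" if "0 \<le> t" for t
  proof -
    have [measurable]: "X t \<in> borel_measurable M" using that by (rule X_meas)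
    show ?thesis unfolding G_def by measurable
  qed
  define P where "P n \<omega> k = (\<omega> \<in> alive (real k * d n))" for n \<omega> and k :: nat
  have P_Suc: "P n \<omega> k" if "P n \<omega> (Suc k)" for n \<omega> k
  proof -
    have "real k * d n \<le> real (Suc k) * d n" using d(1)[of n] by (intro mult_right_mono) auto
    with that show ?thesis by (auto simp: P_def alive_def)
  qed
  \<comment> \<open>\<open>m\<close> counts the grid times at which the path is still alive, so
    \<open>\<sigma>\<close> is the first grid time at which it is not, or \<open>K\<close>.\<close>
  define m where "m n \<omega> = card {k. k < Suc n \<and> P n \<omega> k}" for n \<omega>
  define \<sigma> where "\<sigma> n \<omega> = real (m n \<omega>) * d n" for n \<omega>
  have m_set: "{k. k < Suc n \<and> P n \<omega> k} = {..<m n \<omega>}" for n \<omega>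
    unfolding m_def by (rule sum_telescope_until[where P = "P n \<omega>", OF P_Suc, THEN conjunct1])
  have G_sum: "G (\<sigma> n \<omega>) \<omega> = G 0 \<omega> + (\<Sum>k<Suc n. indicator (alive (real k * d n)) \<omega> *
      (G (real k * d n + d n) \<omega> - G (real k * d n) \<omega>))" for n \<omega>
  proof -
    have "(\<Sum>k<Suc n. indicator (alive (real k * d n)) \<omega> * (G (real k * d n + d n) \<omega> - G (real k * d n) \<omega>)) =
      (\<Sum>k<Suc n. if P n \<omega> k then G (real (Suc k) * d n) \<omega> - G (real k * d n) \<omega> else 0)"
      by (intro sum.cong refl) (auto simp: P_def indicator_def algebra_simps)
    also have "\<dots> = G (real (m n \<omega>) * d n) \<omega> - G (real 0 * d n) \<omega>"
      unfolding m_def by (rule sum_telescope_until[where P = "P n \<omega>" and f = "\<lambda>k. G (real k * d n) \<omega>", OF P_Suc, THEN conjunct2])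
    finally show ?thesis by (simp add: \<sigma>_def)
  qed
  have close: "\<bar>\<sigma> n \<omega> - S \<omega>\<bar> \<le> d n" if \<omega>: "\<omega> \<in> space M" for n \<omega>
  proof -
    have K0: "0 \<le> K" using K by simp
    have m_le: "m n \<omega> \<le> Suc n"
      using m_set[of n \<omega>] by (metis (no_types, lifting) lessThan_iff lessThan_subset_iff mem_Collect_eq subsetI)
    \<comment> \<open>The path was alive at the preceding grid time, so \<open>\<sigma>\<close>
      overshoots the exit time by at most one mesh width.\<close>
    have "\<sigma> n \<omega> - d n \<le> S \<omega>"
    proof (cases "m n \<omega>")
      case 0
      then show ?thesis using d(1)[of n] exit_time_nonneg[OF K0, of U "\<lambda>t. z + X t \<omega>"] by (simp add: \<sigma>_def S_def)
    next
      case (Suc j)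
      then have "j \<in> {k. k < Suc n \<and> P n \<omega> k}" using m_set[of n \<omega>] by simp
      then have j: "j < Suc n" "\<omega> \<in> alive (real j * d n)" by (auto simp: P_def)
      have "real j * d n \<le> K" using j(1) d[of n] mult_right_mono[of "real j" "real (Suc n)" "d n"] by simp
      then have "real j * d n \<le> S \<omega>" unfolding S_def
        by (intro exit_time_ge[OF K0]) (use j(2) d(1)[of n] in \<open>auto simp: alive_def\<close>)
      then show ?thesis using Suc by (simp add: \<sigma>_def algebra_simps)
    qed
    moreover have "S \<omega> \<le> \<sigma> n \<omega>"
    proof (cases "m n \<omega> = Suc n")
      case True
      then show ?thesis using exit_time_le[OF K0, of U "\<lambda>t. z + X t \<omega>"] d(2)[of n] by (simp add: \<sigma>_def S_def)
    next
      case False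
      then have "m n \<omega> < Suc n" "m n \<omega> \<notin> {k. k < Suc n \<and> P n \<omega> k}" using m_le m_set[of n \<omega>] by auto
      then have "\<omega> \<notin> alive (\<sigma> n \<omega>)" by (simp add: P_def \<sigma>_def)
      then obtain s where "0 \<le> s" "s \<le> \<sigma> n \<omega>" "z + X s \<omega> \<notin> U" using \<omega> by (auto simp: alive_def)
      then show ?thesis using before_exit_time[of s U K "\<lambda>t. z + X t \<omega>"] by (force simp: S_def)
    qed
    ultimately show ?thesis using d(1)[of n] by linarith
  qed
  have \<sigma>_nonneg: "0 \<le> \<sigma> n \<omega>" for n \<omega> using d(1)[of n] by (simp add: \<sigma>_def)
  have step_meas: "(\<lambda>\<omega>. indicator (alive (real k * d n)) \<omega> * (G (real k * d n + d n) \<omega> - G (real k * d n) \<omega>))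
      \<in> borel_measurable M" for n k
  proof -
    have "0 \<le> real k * d n" using d(1)[of n] by simp
    then have [measurable]: "alive (real k * d n) \<in> events" "G (real k * d n) \<in> borel_measurable M"
      "G (real k * d n + d n) \<in> borel_measurable M"
      using d(1)[of n] by (auto intro!: G_meas)
    show ?thesis by measurable
  qed
  have step_int: "integrable M (\<lambda>\<omega>. indicator (alive (real k * d n)) \<omega> * (G (real k * d n + d n) \<omega> - G (real k * d n) \<omega>))" for n k
  proof (rule integrable_const_bound[of _ "B + B"])
    have GB: "\<bar>G t \<omega>\<bar> \<le> B" for t \<omega> using F_bound by (simp add: G_def)
    have "\<bar>indicator (alive (real k * d n)) \<omega> * (G (real k * d n + d n) \<omega> - G (real k * d n) \<omega>)\<bar> \<le> B + B" for \<omega>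
      using GB[of "real k * d n + d n" \<omega>] GB[of "real k * d n" \<omega>] B_nonneg
      by (auto simp: indicator_def)
    then show "AE \<omega> in M. norm (indicator (alive (real k * d n)) \<omega> * (G (real k * d n + d n) \<omega> - G (real k * d n) \<omega>)) \<le> B + B"
      by simp
  qed (rule step_meas)
  have G0: "G 0 \<omega> = F ((norm z)\<^sup>2)" if "\<omega> \<in> space M" for \<omega> using start_at_zero[OF that] by (simp add: G_def)
  have int0: "integrable M (G 0)" "expectation (G 0) = F ((norm z)\<^sup>2)"
  proof -
    have "integrable M (G 0) \<longleftrightarrow> integrable M (\<lambda>_. F ((norm z)\<^sup>2))" by (rule Bochner_Integration.integrable_cong) (auto simp: G0)
    then show "integrable M (G 0)" by simp
    have "expectation (G 0) = expectation (\<lambda>_. F ((norm z)\<^sup>2))" by (rule Bochner_Integration.integral_cong) (auto simp: G0)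
    then show "expectation (G 0) = F ((norm z)\<^sup>2)" by (simp add: prob_space)
  qed
  have "(\<lambda>n. expectation (\<lambda>\<omega>. G (\<sigma> n \<omega>) \<omega>)) \<longlonglongrightarrow> expectation (\<lambda>\<omega>. G (S \<omega>) \<omega>)"
  proof (rule integral_dominated_convergence[where w = "\<lambda>_. B"])
    have [measurable]: "(\<lambda>\<omega>. z + X (S \<omega>) \<omega>) \<in> borel_measurable M"
      unfolding S_def using K by (intro exit_measurable) simp
    show "(\<lambda>\<omega>. G (S \<omega>) \<omega>) \<in> borel_measurable M" unfolding G_def by measurable
    show "(\<lambda>\<omega>. G (\<sigma> n \<omega>) \<omega>) \<in> borel_measurable M" for n
      unfolding G_sum by (intro borel_measurable_add borel_measurable_sum step_meas G_meas order_refl)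
    show "AE \<omega> in M. (\<lambda>n. G (\<sigma> n \<omega>) \<omega>) \<longlonglongrightarrow> G (S \<omega>) \<omega>"
    proof (rule AE_I2)
      fix \<omega> assume \<omega>: "\<omega> \<in> space M"
      have "(\<lambda>n. \<sigma> n \<omega> - S \<omega>) \<longlonglongrightarrow> 0"
        by (rule Lim_null_comparison[OF _ d0]) (use close[OF \<omega>] in \<open>auto intro!: always_eventually\<close>)
      then have "(\<lambda>n. \<sigma> n \<omega>) \<longlonglongrightarrow> S \<omega>" by (rule LIM_zero_cancel)
      then have "(\<lambda>n. z + X (\<sigma> n \<omega>) \<omega>) \<longlonglongrightarrow> z + X (S \<omega>) \<omega>"
        by (rule continuous_on_tendsto_compose[OF path_continuous[OF \<omega>]])
          (use \<sigma>_nonneg exit_time_nonneg[of K U] K in \<open>auto simp: S_def\<close>)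
      \<comment> \<open>The grid positions may lie outside \<open>U\<close>, but their limit is in
        the closure, where \<open>F\<close> is continuous.\<close>
      moreover have "z + X (S \<omega>) \<omega> \<in> closure U" unfolding S_def
        using exit_time_closure[OF _ path_continuous[OF \<omega>], of K U] K z start_at_zero[OF \<omega>] by simp
      ultimately show "(\<lambda>n. G (\<sigma> n \<omega>) \<omega>) \<longlonglongrightarrow> G (S \<omega>) \<omega>" unfolding G_def
        by (intro isCont_tendsto_compose[OF F_isCont(1)[OF closure_ab]] tendsto_power tendsto_norm)
    qed
    show "AE \<omega> in M. norm (G (\<sigma> n \<omega>) \<omega>) \<le> B" for n using F_bound by (simp add: G_def)
  qed simp
  moreover have "(\<lambda>n. expectation (\<lambda>\<omega>. G (\<sigma> n \<omega>) \<omega>)) \<longlonglongrightarrow>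
      F ((norm z)\<^sup>2) + (\<integral>t. indicator {0..<K} t * rate t \<partial>lborel)"
  proof -
    obtain C where C: "C \<ge> 0" "\<And>t d A. 0 \<le> t \<Longrightarrow> 0 < d \<Longrightarrow> A \<in> sets (past t) \<Longrightarrow>
      (\<forall>\<omega>\<in>A. (norm (z + X t \<omega>))\<^sup>2 \<in> {a..b}) \<Longrightarrow>
      \<bar>expectation (\<lambda>\<omega>. indicator A \<omega> * (F ((norm (z + X (t + d) \<omega>))\<^sup>2) - F ((norm (z + X t \<omega>))\<^sup>2))) -
        d * expectation (\<lambda>\<omega>. indicator A \<omega> * generator ((norm (z + X t \<omega>))\<^sup>2))\<bar> \<le> C * (d * sqrt d + d\<^sup>2)"
      using one_step by blast
    have E: "expectation (\<lambda>\<omega>. G (\<sigma> n \<omega>) \<omega>) = F ((norm z)\<^sup>2) + (\<Sum>k<Suc n.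
        expectation (\<lambda>\<omega>. indicator (alive (real k * d n)) \<omega> * (G (real k * d n + d n) \<omega> - G (real k * d n) \<omega>)))" for n
      unfolding G_sum using step_int int0
      by (simp only: Bochner_Integration.integral_add Bochner_Integration.integral_sum
          Bochner_Integration.integrable_sum)
    \<comment> \<open>The steps have total length \<open>K\<close>, so the summed errors are of
      order \<open>sqrt (d n)\<close>.\<close>
    have "\<bar>expectation (\<lambda>\<omega>. G (\<sigma> n \<omega>) \<omega>) - F ((norm z)\<^sup>2) - (\<Sum>k<Suc n. d n * rate (real k * d n))\<bar> \<le>
        C * K * (sqrt (d n) + d n)" for n
    proof -
      have "\<bar>(\<Sum>k<Suc n. expectation (\<lambda>\<omega>. indicator (alive (real k * d n)) \<omega> *
            (G (real k * d n + d n) \<omega> - G (real k * d n) \<omega>)) - d n * rate (real k * d n))\<bar> \<le>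
         (\<Sum>k<Suc n. C * (d n * sqrt (d n) + (d n)\<^sup>2))"
      proof (rule order_trans[OF sum_abs sum_mono])
        fix k assume "k \<in> {..<Suc n}"
        have t: "0 \<le> real k * d n" using d(1)[of n] by simp
        show "\<bar>expectation (\<lambda>\<omega>. indicator (alive (real k * d n)) \<omega> *
            (G (real k * d n + d n) \<omega> - G (real k * d n) \<omega>)) - d n * rate (real k * d n)\<bar> \<le>
            C * (d n * sqrt (d n) + (d n)\<^sup>2)"
          unfolding G_def rate_def
          by (rule C(2)[OF t d(1) alive_past[OF t]]) (use alive_ab[OF t] in blast)
      qed
      also have "\<dots> = C * (real (Suc n) * d n) * (sqrt (d n) + d n)"
        by (simp add: power2_eq_square algebra_simps)
      finally show ?thesis unfolding E d(2) by (simp only: sum_subtractf add_diff_cancel_left')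
    qed
    note bnd = this
    have "(\<lambda>n. C * K * (sqrt (d n) + d n)) \<longlonglongrightarrow> C * K * (sqrt 0 + 0)"
      by (intro tendsto_intros d0)
    then have lim0: "(\<lambda>n. C * K * (sqrt (d n) + d n)) \<longlonglongrightarrow> 0" by simp
    have "(\<lambda>n. expectation (\<lambda>\<omega>. G (\<sigma> n \<omega>) \<omega>) - F ((norm z)\<^sup>2) -
        (\<Sum>k<Suc n. d n * rate (real k * d n))) \<longlonglongrightarrow> 0"
      by (rule Lim_null_comparison[OF always_eventually lim0]) (unfold real_norm_def, intro allI bnd)
    from tendsto_add[OF this tendsto_add[OF tendsto_const[of "F ((norm z)\<^sup>2)"] riem(2)]]
    show ?thesis by (simp del: sum.lessThan_Suc)
  qed
  ultimately have "expectation (\<lambda>\<omega>. G (S \<omega>) \<omega>) = F ((norm z)\<^sup>2) + (\<integral>t. indicator {0..<K} t * rate t \<partial>lborel)"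
    by (rule LIMSEQ_unique)
  then show "expectation (\<lambda>\<omega>. F ((norm (z + X (exit_time U K (\<lambda>t. z + X t \<omega>)) \<omega>))\<^sup>2)) =
      F ((norm z)\<^sup>2) + (\<integral>t. indicator {0..<K} t * rate t \<partial>lborel)"
    by (simp add: G_def S_def)
qed

end
end

section \<open>Independence of the sources\<close>

text \<open>Independence of two subalgebras as a freezing rule: the diagonal map has the product of
  the two laws as its distribution, so the argument that depends on \<open>A\<close> can be held
  fixed while the other is averaged.\<close>

lemma (in prob_space) nn_integral_indep:
  assumes A: "space A = space M" "sets A \<subseteq> events" and B: "space B = space M" "sets B \<subseteq> events"
    and indep: "indep_set (sets A) (sets B)"
    and f: "f \<in> borel_measurable (A \<Otimes>\<^sub>M B)"
  shows "(\<integral>\<^sup>+\<omega>. f (\<omega>, \<omega>) \<partial>M) = (\<integral>\<^sup>+\<omega>. \<integral>\<^sup>+\<omega>'. f (\<omega>, \<omega>') \<partial>M \<partial>M)"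
proof -
  have id_A: "(\<lambda>\<omega>. \<omega>) \<in> measurable M A" and id_B: "(\<lambda>\<omega>. \<omega>) \<in> measurable M B"
    using A B by (auto intro!: measurableI dest: sets.sets_into_space)
  have vimage: "sigma_sets (space M) {(\<lambda>\<omega>. \<omega>) -` S \<inter> space M |S. S \<in> sets N} \<subseteq> sets N"
    if "space N = space M" for N :: "'a measure"
  proof -
    have "{(\<lambda>\<omega>. \<omega>) -` S \<inter> space N |S. S \<in> sets N} \<subseteq> sets N"
      by auto
    from sets.sigma_sets_subset[OF this] show ?thesis using that by simp
  qed
  have "indep_var A (\<lambda>\<omega>. \<omega>) B (\<lambda>\<omega>. \<omega>)"
    unfolding indep_var_eq using id_A id_B vimage[OF A(1)] vimage[OF B(1)]
    by (intro conjI indep_set_mono[OF indep])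
  then have eq: "distr M A (\<lambda>\<omega>. \<omega>) \<Otimes>\<^sub>M distr M B (\<lambda>\<omega>. \<omega>) = distr M (A \<Otimes>\<^sub>M B) (\<lambda>\<omega>. (\<omega>, \<omega>))"
    using indep_var_distribution_eq[of A "\<lambda>\<omega>. \<omega>" B "\<lambda>\<omega>. \<omega>"] by blast
  interpret PB: prob_space "distr M B (\<lambda>\<omega>. \<omega>)" by (rule prob_space_distr[OF id_B])
  have pair: "(\<lambda>\<omega>. (\<omega>, \<omega>)) \<in> measurable M (A \<Otimes>\<^sub>M B)"
    by (rule measurable_Pair[OF id_A id_B])
  have sets_eq: "sets (distr M A (\<lambda>\<omega>. \<omega>) \<Otimes>\<^sub>M distr M B (\<lambda>\<omega>. \<omega>)) = sets (A \<Otimes>\<^sub>M B)"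
    by (intro sets_pair_measure_cong) auto
  have f': "f \<in> borel_measurable (distr M A (\<lambda>\<omega>. \<omega>) \<Otimes>\<^sub>M distr M B (\<lambda>\<omega>. \<omega>))"
    using f by (simp add: measurable_cong_sets[OF sets_eq refl])
  have fst: "(\<lambda>\<omega>. \<integral>\<^sup>+\<omega>'. f (\<omega>, \<omega>') \<partial>distr M B (\<lambda>\<omega>. \<omega>)) \<in> borel_measurable A"
    using PB.borel_measurable_nn_integral_fst[OF f'] by simp
  have "(\<integral>\<^sup>+\<omega>. f (\<omega>, \<omega>) \<partial>M) = integral\<^sup>N (distr M (A \<Otimes>\<^sub>M B) (\<lambda>\<omega>. (\<omega>, \<omega>))) f"
    using nn_integral_distr[OF pair, of f] f by simp
  also have "\<dots> = (\<integral>\<^sup>+\<omega>. \<integral>\<^sup>+\<omega>'. f (\<omega>, \<omega>') \<partial>distr M B (\<lambda>\<omega>. \<omega>) \<partial>distr M A (\<lambda>\<omega>. \<omega>))"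
    unfolding eq[symmetric] by (rule PB.nn_integral_fst[symmetric, OF f'])
  also have "\<dots> = (\<integral>\<^sup>+\<omega>. \<integral>\<^sup>+\<omega>'. f (\<omega>, \<omega>') \<partial>distr M B (\<lambda>\<omega>. \<omega>) \<partial>M)"
    using nn_integral_distr[OF id_A, of "\<lambda>\<omega>. \<integral>\<^sup>+\<omega>'. f (\<omega>, \<omega>') \<partial>distr M B (\<lambda>\<omega>. \<omega>)"] fst by simp
  also have "\<dots> = (\<integral>\<^sup>+\<omega>. \<integral>\<^sup>+\<omega>'. f (\<omega>, \<omega>') \<partial>M \<partial>M)"
  proof (rule nn_integral_cong)
    fix \<omega> assume "\<omega> \<in> space M"
    then have "\<omega> \<in> space A" using A by simp
    then have "(\<lambda>\<omega>'. f (\<omega>, \<omega>')) \<in> borel_measurable B" using f by simp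
    then show "(\<integral>\<^sup>+\<omega>'. f (\<omega>, \<omega>') \<partial>distr M B (\<lambda>\<omega>. \<omega>)) = (\<integral>\<^sup>+\<omega>'. f (\<omega>, \<omega>') \<partial>M)"
      using nn_integral_distr[OF id_B, of "\<lambda>\<omega>'. f (\<omega>, \<omega>')"] by simp
  qed
  finally show ?thesis .
qed

text \<open>For an exponential time of mean 1 the tail \<open>exp (- t)\<close> is also the density.
  By Fubini's theorem both sides are the integral of \<open>exp (- t) * r t\<close> over
  \<open>t \<ge> 0\<close>.\<close>

lemma (in prob_space)
  fixes r :: "real \<Rightarrow> real"
  assumes D: "distributed M lborel T (exponential_density 1)"
    and r[measurable]: "r \<in> borel_measurable borel" and C: "\<And>t. \<bar>r t\<bar> \<le> C"
  shows exponential_time_integral_integrable: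
      "integrable M (\<lambda>\<omega>. \<integral>t. indicator {0..<T \<omega>} t * r t \<partial>lborel)"
    and exponential_time_integral:
      "expectation (\<lambda>\<omega>. \<integral>t. indicator {0..<T \<omega>} t * r t \<partial>lborel) = expectation (\<lambda>\<omega>. r (T \<omega>))"
proof -
  have T[measurable]: "T \<in> borel_measurable M" using distributed_measurable[OF D] by simp
  define f where "f \<omega> t = (if 0 \<le> t \<and> t < T \<omega> then r t else 0)" for \<omega> t
  have f_eq: "f \<omega> t = indicator {0..<T \<omega>} t * r t" for \<omega> t by (simp add: f_def)
  have [measurable]: "case_prod f \<in> borel_measurable (M \<Otimes>\<^sub>M lborel)"
    unfolding f_def[abs_def] by measurable
  interpret P: pair_sigma_finite M lborel by standard
  have C0: "0 \<le> C" using C[of 0] by simp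
  have gt: "emeasure M {\<omega>\<in>space M. t < T \<omega>} = ennreal (exp (- t))" if "0 \<le> t" for t
    using exponential_distributedD_gt[OF D that] by (simp add: emeasure_eq_measure)
  have inner: "(\<integral>\<^sup>+\<omega>. ennreal \<bar>f \<omega> t\<bar> \<partial>M) \<le> ennreal (C * exponential_density 1 t)" for t
  proof (cases "0 \<le> t")
    case True
    have "(\<integral>\<^sup>+\<omega>. ennreal \<bar>f \<omega> t\<bar> \<partial>M) \<le> (\<integral>\<^sup>+\<omega>. ennreal C * indicator {\<omega>\<in>space M. t < T \<omega>} \<omega> \<partial>M)"
      by (intro nn_integral_mono) (auto simp: f_def indicator_def C0 intro!: ennreal_leI C)
    also have "\<dots> = ennreal C * ennreal (exp (- t))"
      using gt[OF True] by (subst nn_integral_cmult_indicator) auto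
    finally show ?thesis using True C0 by (simp add: exponential_density_def ennreal_mult)
  qed (simp add: f_def exponential_density_def)
  have int: "integrable (M \<Otimes>\<^sub>M lborel) (case_prod f)"
  proof (rule integrableI_bounded)
    have "(\<integral>\<^sup>+x. ennreal (norm (case_prod f x)) \<partial>(M \<Otimes>\<^sub>M lborel)) = (\<integral>\<^sup>+t. \<integral>\<^sup>+\<omega>. ennreal \<bar>f \<omega> t\<bar> \<partial>M \<partial>lborel)"
      by (subst P.nn_integral_snd[symmetric]) simp_all
    also have "\<dots> \<le> (\<integral>\<^sup>+t. ennreal C * ennreal (exponential_density 1 t) \<partial>lborel)"
      using inner C0 by (intro nn_integral_mono) (simp add: ennreal_mult exponential_density_nonneg)
    also have "\<dots> = ennreal C * (\<integral>\<^sup>+t. ennreal (exponential_density 1 t) \<partial>lborel)"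
      by (rule nn_integral_cmult) simp
    also have "(\<integral>\<^sup>+t. ennreal (exponential_density 1 t) \<partial>lborel) = 1"
      using prob_space.emeasure_space_1[OF prob_space_exponential_density[of 1]]
      by (simp add: emeasure_density)
    finally show "(\<integral>\<^sup>+x. ennreal (norm (case_prod f x)) \<partial>(M \<Otimes>\<^sub>M lborel)) < \<infinity>"
      by (auto simp: order_le_less_trans[OF _ ennreal_less_top[of C]])
  qed simp
  show "integrable M (\<lambda>\<omega>. \<integral>t. indicator {0..<T \<omega>} t * r t \<partial>lborel)"
    using P.integrable_fst[OF int] by (simp add: f_eq)
  have "expectation (\<lambda>\<omega>. \<integral>t. indicator {0..<T \<omega>} t * r t \<partial>lborel) = (\<integral>\<omega>. \<integral>t. f \<omega> t \<partial>lborel \<partial>M)"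
    by (simp add: f_eq)
  also have "\<dots> = (\<integral>t. \<integral>\<omega>. f \<omega> t \<partial>M \<partial>lborel)"
    by (rule P.Fubini_integral[symmetric, OF int])
  also have "\<dots> = (\<integral>t. exponential_density 1 t * r t \<partial>lborel)"
  proof (rule Bochner_Integration.integral_cong[OF refl])
    fix t :: real
    show "(\<integral>\<omega>. f \<omega> t \<partial>M) = exponential_density 1 t * r t"
    proof (cases "0 \<le> t")
      case True
      have "(\<integral>\<omega>. f \<omega> t \<partial>M) = (\<integral>\<omega>. indicator {\<omega>\<in>space M. t < T \<omega>} \<omega> * r t \<partial>M)"
        by (rule Bochner_Integration.integral_cong) (use True in \<open>auto simp: f_def indicator_def\<close>)
      also have "\<dots> = exp (- t) * r t"
        using exponential_distributedD_gt[OF D True] by simp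
      finally show ?thesis using True by (simp add: exponential_density_def)
    qed (simp add: f_def exponential_density_def)
  qed
  also have "\<dots> = expectation (\<lambda>\<omega>. r (T \<omega>))"
    by (rule distributed_integral[OF D]) (auto simp: exponential_density_nonneg)
  finally show "expectation (\<lambda>\<omega>. \<integral>t. indicator {0..<T \<omega>} t * r t \<partial>lborel) = expectation (\<lambda>\<omega>. r (T \<omega>))" .
qed

section \<open>The sources that drive a subtree\<close>

primrec source_label :: "source \<Rightarrow> label" where
  "source_label (Lifetime u) = u"
| "source_label (Offspring u) = u"
| "source_label (Motion u) = u"

text \<open>All the randomness of the subtree of \<open>p\<close>, with \<open>p\<close> itself
  included.\<close>

definition descent :: "label \<Rightarrow> source set" where
  "descent p = {c. suffix p (source_label c)}"

lemma descent_Cons_subset: "descent (i # p) \<subseteq> descent p - {Lifetime p, Motion p, Offspring p}"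
  by (auto simp: descent_def dest: suffix_ConsD suffix_length_le)

lemma descent_Cons_disjoint: "i \<noteq> j \<Longrightarrow> descent (i # p) \<inter> descent (j # p) = {}"
  by (auto simp: descent_def suffix_def) 

context critical_binary_bbm
begin

definition src :: "source \<Rightarrow> 'a set set" where
  "src c = (case c of
      Lifetime u \<Rightarrow> sets (vimage_algebra (space M) (life u) borel)
    | Offspring u \<Rightarrow> sets (vimage_algebra (space M) (offspring u) (count_space UNIV))
    | Motion u \<Rightarrow> sets (vimage_algebra (space M)
        (\<lambda>\<omega>. \<lambda>t\<in>{0..}. motion u t \<omega>) (Pi\<^sub>M {0..} (\<lambda>_. borel))))"

text \<open>Kept as a measure on the same space, so that ordinary measurability statements express
  dependence on the chosen sources only.\<close>

definition info :: "source set \<Rightarrow> 'a measure" where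
  "info C = sigma (space M) (\<Union>c\<in>C. src c)"

lemma indep_src: "indep_sets src UNIV"
  using independent_sources unfolding src_def[abs_def] .

lemma src_events: "src c \<subseteq> events"
  using indep_src by (auto simp: indep_sets_def)

lemma src_Pow: "src c \<subseteq> Pow (space M)"
  using src_events[of c] sets.sets_into_space by blast

lemma space_info[simp]: "space (info C) = space M"
  unfolding info_def using src_Pow by (intro space_measure_of) blast

lemma sets_info: "sets (info C) = sigma_sets (space M) (\<Union>c\<in>C. src c)"
  unfolding info_def using src_Pow by (intro sets_measure_of) blast

lemma sets_info_events: "sets (info C) \<subseteq> events"
  unfolding sets_info using src_events by (intro sets.sigma_sets_subset) blast

lemma sets_info_mono: "C \<subseteq> D \<Longrightarrow> sets (info C) \<subseteq> sets (info D)"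
  unfolding sets_info by (intro sigma_sets_mono') blast

lemma measurable_info_mono: "C \<subseteq> D \<Longrightarrow> f \<in> measurable (info C) N \<Longrightarrow> f \<in> measurable (info D) N"
  using measurable_mono[of N N "info C" "info D"] sets_info_mono by auto

lemma measurable_info_events: "f \<in> measurable (info C) N \<Longrightarrow> f \<in> measurable M N"
  using measurable_mono[of N N "info C" M] sets_info_events by auto

lemma measurable_pair_info_mono:
  assumes "C \<subseteq> D" "f \<in> measurable (L \<Otimes>\<^sub>M info C) N"
  shows "f \<in> measurable (L \<Otimes>\<^sub>M info D) N"
proof -
  have "(\<lambda>\<omega>. \<omega>) \<in> measurable (info D) (info C)"
    by (rule measurable_info_mono[OF assms(1)]) simp
  then have "(\<lambda>x. (fst x, snd x)) \<in> measurable (L \<Otimes>\<^sub>M info D) (L \<Otimes>\<^sub>M info C)"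
    by (intro measurable_Pair measurable_compose[OF measurable_snd] measurable_fst)
  from measurable_compose[OF this assms(2)] show ?thesis by simp
qed

lemma indep_info:
  assumes "C \<inter> D = {}"
  shows "indep_set (sets (info C)) (sets (info D))"
proof -
  have "indep_sets (\<lambda>b. sigma_sets (space M) (\<Union>c\<in>case_bool C D b. src c)) UNIV"
  proof (rule indep_sets_collect_sigma)
    show "indep_sets src (\<Union>b. case_bool C D b)" by (rule indep_sets_mono_index[OF _ indep_src]) simp
    show "Int_stable (src c)" for c
      unfolding src_def by (cases c) (auto intro!: Int_stableI)
    show "disjoint_family (case_bool C D)"
      using assms by (auto simp: disjoint_family_on_def split: bool.split)
  qed
  also have "(\<lambda>b. sigma_sets (space M) (\<Union>c\<in>case_bool C D b. src c)) = case_bool (sets (info C)) (sets (info D))"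
    by (auto simp: sets_info fun_eq_iff split: bool.split)
  finally show ?thesis unfolding indep_set_def .
qed

lemma nn_integral_info:
  assumes "C \<inter> D = {}" "f \<in> borel_measurable (info C \<Otimes>\<^sub>M info D)"
  shows "(\<integral>\<^sup>+\<omega>. f (\<omega>, \<omega>) \<partial>M) = (\<integral>\<^sup>+\<omega>. \<integral>\<^sup>+\<omega>'. f (\<omega>, \<omega>') \<partial>M \<partial>M)"
  by (rule nn_integral_indep[OF _ _ _ _ indep_info[OF assms(1)] assms(2)]) (auto simp: sets_info_events[THEN subsetD])

lemma src_info: "c \<in> C \<Longrightarrow> A \<in> src c \<Longrightarrow> A \<in> sets (info C)"
  unfolding sets_info by (intro sigma_sets.Basic) blast

lemma life_info: "Lifetime u \<in> C \<Longrightarrow> life u \<in> borel_measurable (info C)"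
  by (rule measurableI) (auto intro!: src_info[of "Lifetime u"] simp: src_def in_vimage_algebra)

lemma offspring_info: "Offspring u \<in> C \<Longrightarrow> offspring u \<in> measurable (info C) (count_space UNIV)"
  by (rule measurableI) (auto intro!: src_info[of "Offspring u"] simp: src_def in_vimage_algebra)

lemma motion_info:
  assumes "Motion u \<in> C" "0 \<le> t"
  shows "motion u t \<in> borel_measurable (info C)"
proof (rule measurableI)
  fix B :: "'v set" assume B: "B \<in> sets borel"
  let ?w = "\<lambda>\<omega>. \<lambda>t\<in>{0..}. motion u t \<omega>"
  have "(\<lambda>x. x t) \<in> measurable (Pi\<^sub>M {0..} (\<lambda>_. borel)) (borel :: 'v measure)"
    using assms(2) by (intro measurable_component_singleton) auto
  from measurable_sets[OF this B]
  have "?w -` ((\<lambda>x. x t) -` B \<inter> space (Pi\<^sub>M {0..} (\<lambda>_. borel))) \<inter> space M \<in> src (Motion u)"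
    by (simp only: src_def source.case in_vimage_algebra)
  also have "?w -` ((\<lambda>x. x t) -` B \<inter> space (Pi\<^sub>M {0..} (\<lambda>_. borel))) \<inter> space M = motion u t -` B \<inter> space M"
    using assms(2) by (auto simp: space_PiM)
  finally show "motion u t -` B \<inter> space (info C) \<in> sets (info C)"
    using src_info[OF assms(1)] by simp
qed simp

lemma motion_zero: "\<omega> \<in> space M \<Longrightarrow> motion u 0 \<omega> = 0"
  using brownian_motion.start_at_zero[OF motion_brownian] .

lemma motion_continuous: "\<omega> \<in> space M \<Longrightarrow> continuous_on {0..} (\<lambda>t. motion u t \<omega>)"
  using brownian_motion.continuous_paths[OF motion_brownian] .

lemma offspring_AE: "AE \<omega> in M. offspring u \<omega> \<in> {0, 2}"
proof -
  have "AE k in distr M (count_space UNIV) (offspring u). k \<in> {0, 2}"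
    unfolding offspring_law by (simp add: AE_measure_pmf_iff)
  then show ?thesis by (subst (asm) AE_distr_iff) (use offspring_measurable in auto)
qed

lemma offspring_prob:
  assumes "j \<in> {0, 2}"
  shows "emeasure M {\<omega>\<in>space M. offspring u \<omega> = j} = ennreal (1 / 2)"
proof -
  have "emeasure M {\<omega>\<in>space M. offspring u \<omega> = j} = emeasure (distr M (count_space UNIV) (offspring u)) {j}"
    by (subst emeasure_distr) (auto simp: offspring_measurable intro!: arg_cong[where f = "emeasure M"])
  also have "\<dots> = ennreal (1 / 2)"
    unfolding offspring_law using assms by (simp add: emeasure_pmf_single)
  finally show ?thesis .
qed

end

section \<open>Branching at the end of the first lifetime\<close>

text \<open>Identity minus half the Laplacian inside the annulus, and the function itself outside.
  For an exponential lifetime of mean 1 this is the payoff at exit or death whose expectation is the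
  function at the starting point.\<close>

definition resolvent_data ::
  "(real \<Rightarrow> real) \<Rightarrow> (real \<Rightarrow> real) \<Rightarrow> (real \<Rightarrow> real) \<Rightarrow> real \<Rightarrow> 'v::euclidean_space \<Rightarrow> real"
where
  "resolvent_data F F1 F2 R y = (if y \<in> annulus R then F ((norm y)\<^sup>2) -
     (real DIM('v) * F1 ((norm y)\<^sup>2) + 2 * (norm y)\<^sup>2 * F2 ((norm y)\<^sup>2)) else F ((norm y)\<^sup>2))"

lemma resolvent_data_measurable:
  assumes "F \<in> borel_measurable borel" "F1 \<in> borel_measurable borel" "F2 \<in> borel_measurable borel"
  shows "(resolvent_data F F1 F2 R :: 'v::euclidean_space \<Rightarrow> real) \<in> borel_measurable borel"
proof -
  have radial: "(\<lambda>y::'v. G ((norm y)\<^sup>2)) \<in> borel_measurable borel" if "G \<in> borel_measurable borel" for G :: "real \<Rightarrow> real"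
    by (rule measurable_compose[OF _ that]) measurable
  have "{y \<in> space borel. y \<in> annulus R} \<in> sets (borel :: 'v measure)"
    using borel_open[OF open_annulus[of R, where 'a = 'v]] by simp
  then show ?thesis
    unfolding resolvent_data_def[abs_def]
    by (intro measurable_If borel_measurable_diff borel_measurable_add borel_measurable_times
        borel_measurable_power borel_measurable_norm borel_measurable_const measurable_ident_sets refl
        radial[OF assms(1)] radial[OF assms(2)] radial[OF assms(3)])
qed

context critical_binary_bbm
begin

definition exit_point :: "real \<Rightarrow> label \<Rightarrow> 'v \<Rightarrow> 'a \<Rightarrow> 'v" where
  "exit_point R p z \<omega> = z + motion p (exit_time (annulus R) (life p \<omega>) (\<lambda>t. z + motion p t \<omega>)) \<omega>"

text \<open>A recursive copy of the size of \<open>trunc_pioneers\<close> for the subtree of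
  \<open>p\<close> started at \<open>z\<close>, in a form for which measurability goes by induction.
  The count 0 at \<open>n = 0\<close> makes the iteration of generating functions start at
  1.\<close>

primrec pioneer_count :: "real \<Rightarrow> nat \<Rightarrow> label \<Rightarrow> 'v \<Rightarrow> 'a \<Rightarrow> nat" where
  "pioneer_count R 0 p z \<omega> = 0"
| "pioneer_count R (Suc n) p z \<omega> =
    (if norm (exit_point R p z \<omega>) \<le> 1 then 1 else if R \<le> norm (exit_point R p z \<omega>) then 0
     else \<Sum>i<offspring p \<omega>. pioneer_count R n (i # p) (exit_point R p z \<omega>) \<omega>)"

lemma exit_point_annulus:
  assumes "\<omega> \<in> space M" "1 < R" "1 \<le> norm z" "norm z \<le> R"
  shows "norm (exit_point R p z \<omega>) \<in> {1..R}"
  unfolding exit_point_def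
  by (rule exit_time_annulus[where x = "\<lambda>t. z + motion p t \<omega>"])
    (use assms life_pos[of \<omega> p] motion_zero[of \<omega> p] motion_continuous in
      \<open>auto intro!: continuous_intros\<close>)

lemma card_trunc_pioneers:
  assumes "\<omega> \<in> space M" "1 < R" "1 \<le> norm z" "norm z \<le> R"
  shows "card (trunc_pioneers n R z (\<lambda>u. life (u @ p) \<omega>) (\<lambda>u. offspring (u @ p) \<omega>)
    (\<lambda>u t. motion (u @ p) t \<omega>)) = pioneer_count R n p z \<omega>"
  using assms
proof (induction n arbitrary: p z)
  case 0
  then show ?case by (simp add: trunc_pioneers_def)
next
  case (Suc n)
  have prems: "\<And>u. 0 < life (u @ p) \<omega>" "\<And>u. motion (u @ p) 0 \<omega> = 0"
    "\<And>u. continuous_on {0..} (\<lambda>t. motion (u @ p) t \<omega>)"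
    using Suc.prems life_pos motion_zero motion_continuous by auto
  define y where "y = exit_point R p z \<omega>"
  have y: "y = z + motion ([] @ p) (exit_time (annulus R) (life ([] @ p) \<omega>) (\<lambda>t. z + motion ([] @ p) t \<omega>)) \<omega>"
    by (simp add: y_def exit_point_def)
  have "norm y \<in> {1..R}" unfolding y_def by (rule exit_point_annulus) (use Suc.prems in auto)
  then have IH: "card (trunc_pioneers n R y (\<lambda>u. life ((u @ [i]) @ p) \<omega>) (\<lambda>u. offspring ((u @ [i]) @ p) \<omega>)
      (\<lambda>u t. motion ((u @ [i]) @ p) t \<omega>)) = pioneer_count R n (i # p) y \<omega>" for i
    using Suc.IH[of y "i # p"] Suc.prems by simp
  show ?case
    using card_trunc_pioneers_Suc[of "\<lambda>u. life (u @ p) \<omega>" "\<lambda>u t. motion (u @ p) t \<omega>" R z y n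
        "\<lambda>u. offspring (u @ p) \<omega>", OF prems Suc.prems(2-4) y] IH
    by (simp add: y_def)
qed

text \<open>The lifetime \<open>k\<close> and the realisation \<open>q\<close> of the motion are
  separate functions, so that the two may come from different factors of a product space.\<close>

lemma measurable_exit_point:
  assumes [measurable]: "zz \<in> borel_measurable N" "k \<in> borel_measurable N"
    and k: "\<And>x. x \<in> space N \<Longrightarrow> 0 \<le> k x"
    and q: "q \<in> measurable N (info C)" and C: "Motion p \<in> C"
  shows "(\<lambda>x. zz x + motion p (exit_time (annulus R) (k x) (\<lambda>t. zz x + motion p t (q x))) (q x)) \<in> borel_measurable N"
proof -
  have q_space: "q x \<in> space M" if "x \<in> space N" for x using measurable_space[OF q that] by simp
  have X: "(\<lambda>x. zz x + motion p t (q x)) \<in> borel_measurable N" if "0 \<le> t" for t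
  proof -
    have [measurable]: "(\<lambda>x. motion p t (q x)) \<in> borel_measurable N"
      by (rule measurable_compose[OF q motion_info[OF C that]])
    show ?thesis by measurable
  qed
  have cont: "continuous_on {0..} (\<lambda>t. zz x + motion p t (q x))" if "x \<in> space N" for x
    by (intro continuous_intros motion_continuous q_space that)
  have S: "(\<lambda>x. exit_time (annulus R) (k x) (\<lambda>t. zz x + motion p t (q x))) \<in> borel_measurable N"
    by (rule measurable_exit_time[OF X cont open_annulus]) (use k in auto)
  show ?thesis
    by (rule measurable_path_at[OF X cont S]) (use k in \<open>auto intro: exit_time_nonneg\<close>)
qed

lemma exit_point_measurable_pair:
  assumes "Lifetime p \<in> C" "Motion p \<in> C"
  shows "(\<lambda>x. exit_point R p (fst x) (snd x)) \<in> borel_measurable (borel \<Otimes>\<^sub>M info C)"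
  unfolding exit_point_def
proof (rule measurable_exit_point[OF _ _ _ measurable_snd assms(2)])
  show "(\<lambda>x. life p (snd x)) \<in> borel_measurable (borel \<Otimes>\<^sub>M info C)"
    by (rule measurable_compose[OF measurable_snd life_info[OF assms(1)]])
  show "0 \<le> life p (snd x)" if "x \<in> space (borel \<Otimes>\<^sub>M info C)" for x
    using that life_pos[of "snd x" p] by (auto simp: space_pair_measure)
qed simp

lemma exit_point_measurable:
  assumes "Lifetime p \<in> C" "Motion p \<in> C"
  shows "exit_point R p z \<in> borel_measurable (info C)"
proof -
  have "(\<lambda>\<omega>. (z, \<omega>)) \<in> measurable (info C) (borel \<Otimes>\<^sub>M info C)" by simp
  from measurable_compose[OF this exit_point_measurable_pair[OF assms]] show ?thesis by simp
qed

lemma root_in_descent: "Lifetime p \<in> descent p" "Motion p \<in> descent p" "Offspring p \<in> descent p"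
  by (auto simp: descent_def)

text \<open>Joint measurability in starting point and realisation is required because a child starts
  at a random place. The realisation enters through the sources of the subtree, which yields
  independence of the children.\<close>

lemma measurable_pioneer_count:
  "(\<lambda>x. real (pioneer_count R n p (fst x) (snd x))) \<in> borel_measurable (borel \<Otimes>\<^sub>M info (descent p))"
proof (induction n arbitrary: p)
  case 0
  then show ?case by simp
next
  case (Suc n)
  let ?N = "borel \<Otimes>\<^sub>M info (descent p)"
  have Y[measurable]: "(\<lambda>x. exit_point R p (fst x) (snd x)) \<in> borel_measurable ?N"
    by (rule exit_point_measurable_pair) (rule root_in_descent)+
  have o: "(\<lambda>x. offspring p (snd x)) \<in> measurable ?N (count_space UNIV)"
    by (rule measurable_compose[OF measurable_snd offspring_info[OF root_in_descent(3)]])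
  have child: "(\<lambda>x. real (pioneer_count R n (i # p) (exit_point R p (fst x) (snd x)) (snd x))) \<in> borel_measurable ?N" for i
  proof -
    have "(\<lambda>x. real (pioneer_count R n (i # p) (fst x) (snd x))) \<in> borel_measurable ?N"
      by (rule measurable_pair_info_mono[OF _ Suc.IH]) (use descent_Cons_subset in blast)
    from measurable_compose[OF _ this, of "\<lambda>x. (exit_point R p (fst x) (snd x), snd x)" ?N]
    show ?thesis by simp
  qed
  have [measurable]: "(\<lambda>x. \<Sum>i<offspring p (snd x). real (pioneer_count R n (i # p) (exit_point R p (fst x) (snd x)) (snd x)))
      \<in> borel_measurable ?N"
    by (rule measurable_compose_countable[OF _ o,
          where f = "\<lambda>k x. \<Sum>i<k. real (pioneer_count R n (i # p) (exit_point R p (fst x) (snd x)) (snd x))"])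
      (intro borel_measurable_sum child)
  show ?case
    unfolding pioneer_count.simps if_distrib[of real] of_nat_sum of_nat_1 of_nat_0 by measurable
qed

section \<open>Moments of the truncated counts\<close>

context
  fixes R c :: real
  assumes R: "1 < R" and c: "0 < c"
begin

text \<open>The base \<open>c\<close> may exceed 1, so finiteness of expectations is not known in
  advance and values are taken in \<open>ennreal\<close>.\<close>

definition weight :: "nat \<Rightarrow> label \<Rightarrow> 'v \<Rightarrow> 'a \<Rightarrow> ennreal" where
  "weight n p z \<omega> = ennreal (c ^ pioneer_count R n p z \<omega>)"

definition moment :: "nat \<Rightarrow> label \<Rightarrow> 'v \<Rightarrow> ennreal" where
  "moment n p z = (\<integral>\<^sup>+\<omega>. weight n p z \<omega> \<partial>M)"

lemma measurable_weight_pair: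
  assumes "descent p \<subseteq> C"
  shows "(\<lambda>x. weight n p (fst x) (snd x)) \<in> borel_measurable (borel \<Otimes>\<^sub>M info C)"
proof -
  have [measurable]: "(\<lambda>x. real (pioneer_count R n p (fst x) (snd x))) \<in> borel_measurable (borel \<Otimes>\<^sub>M info C)"
    by (rule measurable_pair_info_mono[OF assms measurable_pioneer_count])
  \<comment> \<open>A real exponent gives access to the measurability of the real-valued
    count.\<close>
  have "weight n p z \<omega> = ennreal (c powr real (pioneer_count R n p z \<omega>))" for z \<omega>
    using c by (simp add: weight_def powr_realpow)
  then show ?thesis by simp
qed

lemma measurable_weight:
  assumes "descent p \<subseteq> C"
  shows "weight n p z \<in> borel_measurable (info C)"
proof -
  have "(\<lambda>\<omega>. (z, \<omega>)) \<in> measurable (info C) (borel \<Otimes>\<^sub>M info C)" by simp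
  from measurable_compose[OF this measurable_weight_pair[OF assms]] show ?thesis by simp
qed

lemma weight_Suc:
  "weight (Suc n) p z \<omega> =
    (if norm (exit_point R p z \<omega>) \<le> 1 then ennreal c else if R \<le> norm (exit_point R p z \<omega>) then 1
     else \<Prod>i<offspring p \<omega>. weight n (i # p) (exit_point R p z \<omega>) \<omega>)"
  using c by (simp add: weight_def power_sum prod_ennreal)

text \<open>At a fixed branch point the offspring number and the two subtrees use disjoint sources,
  so the expectation factorises into the offspring generating function
  \<open>(1 + s\<^sup>2) / 2\<close>, with the square split into the moments of the two
  children.\<close>

lemma offspring_average:
  "(\<integral>\<^sup>+\<omega>. (\<Prod>i<offspring p \<omega>. weight n (i # p) y \<omega>) \<partial>M) =
    ennreal (1 / 2) + ennreal (1 / 2) * (moment n (0 # p) y * moment n (1 # p) y)"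
proof -
  define Ev where "Ev j = {\<omega>\<in>space M. offspring p \<omega> = j}" for j
  define X where "X i = weight n (i # p) y" for i
  define D where "D = descent (0 # p) \<union> descent (1 # p)"
  have Ev_info: "Ev j \<in> sets (info {Offspring p})" for j
    using measurable_sets[OF offspring_info[of p "{Offspring p}"], of "{j}"]
    by (auto simp: Ev_def vimage_def Int_def conj_commute)
  then have [measurable]: "Ev j \<in> events" for j using sets_info_events by blast
  have X_D: "X i \<in> borel_measurable (info D)" if "i \<in> {0, 1}" for i
    unfolding X_def by (rule measurable_weight) (use that in \<open>auto simp: D_def\<close>)
  have X_own: "X i \<in> borel_measurable (info (descent (i # p)))" for i
    unfolding X_def by (rule measurable_weight) simp
  have X_meas[measurable]: "X i \<in> borel_measurable M" for i by (rule measurable_info_events[OF X_own])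
  have emO: "emeasure M (Ev j) = ennreal (1 / 2)" if "j \<in> {0, 2}" for j
    unfolding Ev_def by (rule offspring_prob[OF that])
  have "(\<integral>\<^sup>+\<omega>. (\<Prod>i<offspring p \<omega>. weight n (i # p) y \<omega>) \<partial>M) =
      (\<integral>\<^sup>+\<omega>. indicator (Ev 0) \<omega> + indicator (Ev 2) \<omega> * (X 0 \<omega> * X 1 \<omega>) \<partial>M)"
  proof (rule nn_integral_cong_AE)
    show "AE \<omega> in M. (\<Prod>i<offspring p \<omega>. weight n (i # p) y \<omega>) =
        indicator (Ev 0) \<omega> + indicator (Ev 2) \<omega> * (X 0 \<omega> * X 1 \<omega>)"
      using offspring_AE[of p] AE_space
    proof eventually_elim
      case (elim \<omega>)
      then show ?case
        by (auto simp: Ev_def X_def indicator_def lessThan_Suc numeral_2_eq_2 mult.commute)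
    qed
  qed
  also have "\<dots> = (\<integral>\<^sup>+\<omega>. indicator (Ev 0) \<omega> \<partial>M) + (\<integral>\<^sup>+\<omega>. indicator (Ev 2) \<omega> * (X 0 \<omega> * X 1 \<omega>) \<partial>M)"
    by (rule nn_integral_add) auto
  also have "(\<integral>\<^sup>+\<omega>. indicator (Ev 0) \<omega> \<partial>M) = ennreal (1 / 2)"
    using emO[of 0] by simp
  also have "(\<integral>\<^sup>+\<omega>. indicator (Ev 2) \<omega> * (X 0 \<omega> * X 1 \<omega>) \<partial>M) =
      (\<integral>\<^sup>+\<omega>. \<integral>\<^sup>+\<omega>'. indicator (Ev 2) \<omega> * (X 0 \<omega>' * X 1 \<omega>') \<partial>M \<partial>M)"
  proof (rule nn_integral_info[where C = "{Offspring p}" and D = D and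
        f = "\<lambda>x. indicator (Ev 2) (fst x) * (X 0 (snd x) * X 1 (snd x))", simplified fst_conv snd_conv])
    show "{Offspring p} \<inter> D = {}" unfolding D_def using descent_Cons_subset by blast
    note [measurable] = Ev_info X_D
    show "(\<lambda>x. indicator (Ev 2) (fst x) * (X 0 (snd x) * X 1 (snd x))) \<in> borel_measurable (info {Offspring p} \<Otimes>\<^sub>M info D)"
      by measurable
  qed
  also have "\<dots> = (\<integral>\<^sup>+\<omega>. (\<integral>\<^sup>+\<omega>'. X 0 \<omega>' * X 1 \<omega>' \<partial>M) * indicator (Ev 2) \<omega> \<partial>M)"
    by (simp add: nn_integral_cmult mult.commute)
  also have "\<dots> = (\<integral>\<^sup>+\<omega>'. X 0 \<omega>' * X 1 \<omega>' \<partial>M) * ennreal (1 / 2)"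
    using emO[of 2] by (subst nn_integral_cmult_indicator) auto
  also have "(\<integral>\<^sup>+\<omega>. X 0 \<omega> * X 1 \<omega> \<partial>M) = (\<integral>\<^sup>+\<omega>. \<integral>\<^sup>+\<omega>'. X 0 \<omega> * X 1 \<omega>' \<partial>M \<partial>M)"
  proof (rule nn_integral_info[where C = "descent (0 # p)" and D = "descent (1 # p)" and
        f = "\<lambda>x. X 0 (fst x) * X 1 (snd x)", simplified fst_conv snd_conv])
    show "descent (0 # p) \<inter> descent (1 # p) = {}" by (rule descent_Cons_disjoint) simp
    note [measurable] = X_own
    show "(\<lambda>x. X 0 (fst x) * X 1 (snd x)) \<in> borel_measurable (info (descent (0 # p)) \<Otimes>\<^sub>M info (descent (1 # p)))"
      by measurable
  qed
  also have "\<dots> = moment n (0 # p) y * moment n (1 # p) y"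
    by (simp add: moment_def X_def[symmetric] nn_integral_cmult nn_integral_multc)
  finally show ?thesis by (simp add: mult.commute)
qed

text \<open>The exit point depends on the lifetime and motion of \<open>p\<close>, all else on the
  remaining sources. Freezing the exit point makes \<open>offspring_average\<close> applicable: this
  is the branching property.\<close>

lemma moment_Suc:
  "moment (Suc n) p z = (\<integral>\<^sup>+\<omega>. (let y = exit_point R p z \<omega> in
     if norm y \<le> 1 then ennreal c else if R \<le> norm y then 1
     else ennreal (1 / 2) + ennreal (1 / 2) * (moment n (0 # p) y * moment n (1 # p) y)) \<partial>M)"
proof -
  define C where "C = {Lifetime p, Motion p}"
  define D where "D = descent p - C"
  define f where "f x = (if norm (exit_point R p z (fst x)) \<le> 1 then ennreal c
     else if R \<le> norm (exit_point R p z (fst x)) then 1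
     else \<Prod>i<offspring p (snd x). weight n (i # p) (exit_point R p z (fst x)) (snd x))" for x
  have f_meas: "f \<in> borel_measurable (info C \<Otimes>\<^sub>M info D)"
  proof -
    have [measurable]: "exit_point R p z \<in> borel_measurable (info C)"
      by (rule exit_point_measurable) (auto simp: C_def)
    have o: "(\<lambda>x. offspring p (snd x)) \<in> measurable (info C \<Otimes>\<^sub>M info D) (count_space UNIV)"
      by (rule measurable_compose[OF measurable_snd offspring_info]) (auto simp: C_def D_def root_in_descent)
    have child: "(\<lambda>x. weight n (i # p) (exit_point R p z (fst x)) (snd x)) \<in> borel_measurable (info C \<Otimes>\<^sub>M info D)" for i
    proof -
      have "(\<lambda>x. weight n (i # p) (fst x) (snd x)) \<in> borel_measurable (borel \<Otimes>\<^sub>M info D)"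
        by (rule measurable_weight_pair) (use descent_Cons_subset in \<open>auto simp: C_def D_def\<close>)
      from measurable_compose[OF _ this, of "\<lambda>x. (exit_point R p z (fst x), snd x)" "info C \<Otimes>\<^sub>M info D"]
      show ?thesis by simp
    qed
    have [measurable]: "(\<lambda>x. \<Prod>i<offspring p (snd x). weight n (i # p) (exit_point R p z (fst x)) (snd x))
        \<in> borel_measurable (info C \<Otimes>\<^sub>M info D)"
      by (rule measurable_compose_countable[OF _ o,
            where f = "\<lambda>k x. \<Prod>i<k. weight n (i # p) (exit_point R p z (fst x)) (snd x)"])
        (intro borel_measurable_prod_ennreal child)
    show ?thesis unfolding f_def by measurable
  qed
  have "moment (Suc n) p z = (\<integral>\<^sup>+\<omega>. f (\<omega>, \<omega>) \<partial>M)"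
    unfolding moment_def weight_Suc f_def fst_conv snd_conv ..
  also have "\<dots> = (\<integral>\<^sup>+\<omega>. \<integral>\<^sup>+\<omega>'. f (\<omega>, \<omega>') \<partial>M \<partial>M)"
    by (rule nn_integral_info[OF _ f_meas]) (auto simp: D_def)
  also have "\<dots> = (\<integral>\<^sup>+\<omega>. (let y = exit_point R p z \<omega> in
     if norm y \<le> 1 then ennreal c else if R \<le> norm y then 1
     else ennreal (1 / 2) + ennreal (1 / 2) * (moment n (0 # p) y * moment n (1 # p) y)) \<partial>M)"
    by (intro nn_integral_cong) (simp add: f_def Let_def offspring_average emeasure_space_1)
  finally show ?thesis .
qed

text \<open>For a fixed lifetime \<open>K\<close> the expectation is
  \<open>F ((norm z)\<^sup>2)\<close> plus the integral of the rate over \<open>{0..<K}\<close>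
  minus the rate at \<open>K\<close>. Averaged over an exponential \<open>K\<close>, the last two
  terms cancel.\<close>

theorem dynkin_exponential_time:
  fixes z :: 'v
  assumes rf: "radial_function F F1 F2 F3 a' 1 (R\<^sup>2) b' B"
    and z: "1 \<le> norm z" "norm z \<le> R"
    and nonneg: "\<And>y :: 'v. norm y \<in> {1..R} \<Longrightarrow> 0 \<le> resolvent_data F F1 F2 R y"
  shows "(\<integral>\<^sup>+\<omega>. ennreal (resolvent_data F F1 F2 R (exit_point R p z \<omega>)) \<partial>M) = ennreal (F ((norm z)\<^sup>2))"
proof (cases "z \<in> annulus R")
  case False
  have "exit_point R p z \<omega> = z" if \<omega>: "\<omega> \<in> space M" for \<omega>
  proof -
    have l: "0 \<le> life p \<omega>" using life_pos[OF \<omega>, of p] by simp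
    have "\<not> 0 < exit_time (annulus R) (life p \<omega>) (\<lambda>t. z + motion p t \<omega>)"
      using before_exit_time[of 0 "annulus R" "life p \<omega>" "\<lambda>t. z + motion p t \<omega>"] False motion_zero[OF \<omega>] by auto
    then have "exit_time (annulus R) (life p \<omega>) (\<lambda>t. z + motion p t \<omega>) = 0"
      using exit_time_nonneg[OF l, of "annulus R" "\<lambda>t. z + motion p t \<omega>"] by simp
    then show ?thesis using motion_zero[OF \<omega>] by (simp add: exit_point_def)
  qed
  then have "(\<integral>\<^sup>+\<omega>. ennreal (resolvent_data F F1 F2 R (exit_point R p z \<omega>)) \<partial>M) =
      (\<integral>\<^sup>+\<omega>. ennreal (F ((norm z)\<^sup>2)) \<partial>M)"
    using False by (intro nn_integral_cong) (simp add: resolvent_data_def)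
  then show ?thesis by (simp add: emeasure_space_1)
next
  case True
  interpret rf: radial_function F F1 F2 F3 a' 1 "R\<^sup>2" b' B by (rule rf)
  interpret bm: brownian_motion M "motion p" by (rule motion_brownian)
  interpret rb: radial_brownian M "motion p" F F1 F2 F3 a' 1 "R\<^sup>2" b' B ..
  define \<Theta> :: "'v \<Rightarrow> real" where "\<Theta> = resolvent_data F F1 F2 R"
  have \<Theta>: "\<Theta> y = (if y \<in> annulus R then F ((norm y)\<^sup>2) - rb.generator ((norm y)\<^sup>2) else F ((norm y)\<^sup>2))" for y
    by (simp add: \<Theta>_def resolvent_data_def rb.generator_def)
  define U where "U = (annulus R :: 'v set)"
  have openU: "open U" unfolding U_def by (rule open_annulus)
  have U_ab: "(norm y)\<^sup>2 \<in> {1..R\<^sup>2}" if "y \<in> U" for y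
    using that R by (auto simp: U_def annulus_def intro!: power_mono)
  have zU: "z \<in> closure U" using True closure_subset by (auto simp: U_def)
  note ctx = openU U_ab zU
  define Z where "Z K \<omega> = z + motion p (exit_time U K (\<lambda>t. z + motion p t \<omega>)) \<omega>" for K \<omega>
  \<comment> \<open>The rate is extended by 0 to negative times, since the exponential identity
    takes a function on the whole line.\<close>
  define r where "r t = indicator {0..} t * rb.rate U z t" for t
  obtain C where C: "C \<ge> 0" "\<And>t. 0 \<le> t \<Longrightarrow> \<bar>rb.rate U z t\<bar> \<le> C"
    "\<And>t \<omega>. 0 \<le> t \<Longrightarrow> \<bar>indicator (rb.alive U z t) \<omega> * rb.generator ((norm (z + motion p t \<omega>))\<^sup>2)\<bar> \<le> C"
    using rb.rate_bounded[OF ctx] by blast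
  have r_bound: "\<bar>r t\<bar> \<le> C" for t using C by (simp add: r_def indicator_def)
  have r_restrict: "indicator {0..<K} t * r t = indicator {0..<K} t * rb.rate U z t" for t K :: real
    by (simp add: r_def indicator_def)
  \<comment> \<open>The rate inherits measurability from its integrable restrictions to bounded
    intervals.\<close>
  have r_meas: "r \<in> borel_measurable borel"
  proof (rule borel_measurable_LIMSEQ_real)
    show "(\<lambda>t. indicator {0..<real (Suc n)} t * rb.rate U z t) \<in> borel_measurable borel" for n
      using borel_measurable_integrable[OF rb.dynkin_fixed_time(1)[OF ctx, of "real (Suc n)"]] by simp
    fix t :: real
    have "eventually (\<lambda>n. indicator {0..<real (Suc n)} t * rb.rate U z t = r t) sequentially"
    proof -
      obtain m :: nat where "t < real m" using reals_Archimedean2 by blast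
      then show ?thesis
        unfolding eventually_sequentially by (intro exI[of _ m]) (auto simp: r_def indicator_def)
    qed
    then show "(\<lambda>n. indicator {0..<real (Suc n)} t * rb.rate U z t) \<longlonglongrightarrow> r t"
      by (rule tendsto_eventually)
  qed
  define H where "H K = F ((norm z)\<^sup>2) + (\<integral>t. indicator {0..<K} t * r t \<partial>lborel) - r K" for K
  have [measurable]: "\<Theta> \<in> borel_measurable borel"
    unfolding \<Theta>_def by (rule resolvent_data_measurable) (rule rf.F_measurable rf.F1_measurable rf.F2_measurable)+
  have fixed: "(\<integral>\<^sup>+\<omega>. ennreal (\<Theta> (Z K \<omega>)) \<partial>M) = ennreal (H K)" "0 \<le> H K" if K: "0 < K" for K
  proof -
    have [measurable]: "Z K \<in> borel_measurable M"
      unfolding Z_def by (rule rb.exit_measurable[OF ctx less_imp_le[OF K]])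
    have Z_ann: "norm (Z K \<omega>) \<in> {1..R}" if "\<omega> \<in> space M" for \<omega>
      unfolding Z_def U_def
      by (rule exit_time_annulus[where x = "\<lambda>t. z + motion p t \<omega>"])
        (use K z R motion_zero[OF that] motion_continuous[OF that] in \<open>auto intro!: continuous_intros\<close>)
    \<comment> \<open>The capped exit position lies in the annulus exactly when the path survives,
      and then it is the position at time \<open>K\<close>.\<close>
    have eq: "\<Theta> (Z K \<omega>) = F ((norm (Z K \<omega>))\<^sup>2) -
        indicator (rb.alive U z K) \<omega> * rb.generator ((norm (z + motion p K \<omega>))\<^sup>2)" if \<omega>: "\<omega> \<in> space M" for \<omega>
    proof -
      have cont: "continuous_on {0..} (\<lambda>t. z + motion p t \<omega>)" by (intro continuous_intros motion_continuous \<omega>)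
      have "Z K \<omega> \<in> U \<longleftrightarrow> \<omega> \<in> rb.alive U z K"
        using exit_time_in_iff[OF _ openU cont, of K] K \<omega>
        by (simp add: Z_def rb.alive_def[OF ctx])
      then have iff: "Z K \<omega> \<in> annulus R \<longleftrightarrow> \<omega> \<in> rb.alive U z K" by (simp only: U_def)
      show ?thesis
      proof (cases "\<omega> \<in> rb.alive U z K")
        case True
        then have "exit_time U K (\<lambda>t. z + motion p t \<omega>) = K"
          using K by (intro exit_time_alive) (auto simp: rb.alive_def[OF ctx])
        then show ?thesis using True iff by (simp add: \<Theta> Z_def)
      next
        case False
        then show ?thesis using iff by (simp add: \<Theta>)
      qed
    qed
    have int1: "integrable M (\<lambda>\<omega>. F ((norm (Z K \<omega>))\<^sup>2))"
      by (rule integrable_const_bound[of _ B]) (use rf.F_bound in auto)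
    have int2: "integrable M (\<lambda>\<omega>. indicator (rb.alive U z K) \<omega> * rb.generator ((norm (z + motion p K \<omega>))\<^sup>2))"
    proof (rule integrable_const_bound[of _ C])
      have [measurable]: "rb.alive U z K \<in> events" "motion p K \<in> borel_measurable M"
        using K rb.alive_measurable[OF ctx, of K] by (auto intro: bm.measurable_motion)
      show "(\<lambda>\<omega>. indicator (rb.alive U z K) \<omega> * rb.generator ((norm (z + motion p K \<omega>))\<^sup>2)) \<in> borel_measurable M"
        by measurable
    qed (use C(3) K in auto)
    have int: "integrable M (\<lambda>\<omega>. \<Theta> (Z K \<omega>))"
      using Bochner_Integration.integrable_diff[OF int1 int2] by (subst Bochner_Integration.integrable_cong[OF refl eq])
    have E: "expectation (\<lambda>\<omega>. \<Theta> (Z K \<omega>)) = H K"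
    proof -
      have "expectation (\<lambda>\<omega>. \<Theta> (Z K \<omega>)) = expectation (\<lambda>\<omega>. F ((norm (Z K \<omega>))\<^sup>2)) - rb.rate U z K"
        using Bochner_Integration.integral_cong[where M = M and N = M, OF refl eq]
          Bochner_Integration.integral_diff[OF int1 int2]
        by (simp add: rb.rate_def[OF ctx])
      then show ?thesis
        using rb.dynkin_fixed_time(2)[OF ctx K] K unfolding H_def r_restrict by (simp add: Z_def r_def)
    qed
    have nonneg: "AE \<omega> in M. 0 \<le> \<Theta> (Z K \<omega>)" using Z_ann nonneg by (auto simp: \<Theta>_def)
    show "(\<integral>\<^sup>+\<omega>. ennreal (\<Theta> (Z K \<omega>)) \<partial>M) = ennreal (H K)"
      using nn_integral_eq_integral[OF int nonneg] E by simp
    show "0 \<le> H K" using integral_nonneg_AE[OF nonneg] E by simp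
  qed
  have "(\<integral>\<^sup>+\<omega>. ennreal (\<Theta> (exit_point R p z \<omega>)) \<partial>M) =
      (\<integral>\<^sup>+\<omega>. \<integral>\<^sup>+\<omega>'. ennreal (\<Theta> (Z (life p \<omega>) \<omega>')) \<partial>M \<partial>M)"
    unfolding exit_point_def U_def[symmetric] Z_def
  \<comment> \<open>Lifetime and motion are independent sources, so the lifetime can be frozen at a
    value \<open>K\<close>.\<close>
  proof (rule nn_integral_info[where C = "{Lifetime p}" and D = "{Motion p}" and
        f = "\<lambda>x. ennreal (\<Theta> (z + motion p (exit_time U (life p (fst x)) (\<lambda>t. z + motion p t (snd x))) (snd x)))",
        simplified fst_conv snd_conv])
    have l: "(\<lambda>x. life p (fst x)) \<in> borel_measurable (info {Lifetime p} \<Otimes>\<^sub>M info {Motion p})"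
      by (rule measurable_compose[OF measurable_fst life_info]) simp
    have [measurable]: "(\<lambda>x. z + motion p (exit_time U (life p (fst x)) (\<lambda>t. z + motion p t (snd x))) (snd x))
        \<in> borel_measurable (info {Lifetime p} \<Otimes>\<^sub>M info {Motion p})"
      unfolding U_def by (rule measurable_exit_point[OF _ l _ measurable_snd])
        (auto simp: space_pair_measure intro!: less_imp_le life_pos)
    show "(\<lambda>x. ennreal (\<Theta> (z + motion p (exit_time U (life p (fst x)) (\<lambda>t. z + motion p t (snd x))) (snd x))))
        \<in> borel_measurable (info {Lifetime p} \<Otimes>\<^sub>M info {Motion p})" by measurable
  qed simp
  also have "\<dots> = (\<integral>\<^sup>+\<omega>. ennreal (H (life p \<omega>)) \<partial>M)"
    by (intro nn_integral_cong fixed life_pos)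
  also have "\<dots> = ennreal (F ((norm z)\<^sup>2))"
  proof -
    have [measurable]: "life p \<in> borel_measurable M" using distributed_measurable[OF life_exponential] by simp
    note r_meas[measurable]
    have int1: "integrable M (\<lambda>\<omega>. \<integral>t. indicator {0..<life p \<omega>} t * r t \<partial>lborel)"
      by (rule exponential_time_integral_integrable[OF life_exponential r_meas r_bound])
    have int2: "integrable M (\<lambda>\<omega>. r (life p \<omega>))"
      by (rule integrable_const_bound[of _ C]) (use r_bound in auto)
    have int: "integrable M (\<lambda>\<omega>. H (life p \<omega>))"
      unfolding H_def using int1 int2 by simp
    have "expectation (\<lambda>\<omega>. H (life p \<omega>)) = F ((norm z)\<^sup>2)"
      unfolding H_def using int1 int2 exponential_time_integral[OF life_exponential r_meas r_bound, of p]
      by (simp add: prob_space)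
    moreover have "AE \<omega> in M. 0 \<le> H (life p \<omega>)" using fixed(2) life_pos by auto
    ultimately show ?thesis using nn_integral_eq_integral[OF int] by simp
  qed
  finally show ?thesis by (simp add: \<Theta>_def)
qed

end
end

section \<open>The generating function of the number of pioneers\<close>

text \<open>For an infinite set \<open>card\<close> is 0 and the power is 1, whereas the truncated
  powers are unbounded because \<open>c > 1\<close>; the case distinction on \<open>S\<close>
  records this. For finite \<open>P\<close> the supremum is attained.\<close>

lemma SUP_power_card:
  fixes P :: "('b list \<times> 'c) set"
  assumes c: "1 < c" and fin: "\<And>n. finite {v \<in> P. length (fst v) < n}"
  defines "S \<equiv> SUP n. ennreal (c ^ card {v \<in> P. length (fst v) < n})"
  shows "ennreal (c ^ card P) = (if S < \<infinity> then S else 1)"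
proof -
  define Q where "Q n = {v \<in> P. length (fst v) < n}" for n
  have S: "S = (SUP n. ennreal (c ^ card (Q n)))" by (simp add: S_def Q_def)
  have exhaust: "\<exists>n. A \<subseteq> Q n" if A: "finite A" "A \<subseteq> P" for A
  proof -
    have "finite ((\<lambda>v. length (fst v)) ` A)" using A by simp
    then obtain n where "\<forall>m\<in>(\<lambda>v. length (fst v)) ` A. m < n"
      using finite_nat_set_iff_bounded by blast
    then show ?thesis using A by (intro exI[of _ n]) (auto simp: Q_def)
  qed
  show ?thesis
  proof (cases "finite P")
    case True
    obtain n where n: "P \<subseteq> Q n" using exhaust[OF True] by blast
    have "S = ennreal (c ^ card P)"
    proof (rule antisym)
      show "S \<le> ennreal (c ^ card P)" unfolding S
        using c by (intro SUP_least ennreal_leI power_increasing card_mono[OF True]) (auto simp: Q_def)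
      have "card P \<le> card (Q n)" by (rule card_mono[OF _ n]) (simp add: Q_def fin)
      then have "ennreal (c ^ card P) \<le> ennreal (c ^ card (Q n))"
        using c by (intro ennreal_leI power_increasing) auto
      also have "\<dots> \<le> S" unfolding S by (rule SUP_upper) simp
      finally show "ennreal (c ^ card P) \<le> S" .
    qed
    then show ?thesis by simp
  next
    case False
    have "\<not> S < \<infinity>"
    proof
      assume "S < \<infinity>"
      then obtain x where x: "S = ennreal x" "0 \<le> x" by (cases S) auto
      obtain k where k: "x < c ^ k" using real_arch_pow[OF c] by blast
      obtain A where A: "finite A" "A \<subseteq> P" "card A = k"
        using infinite_arbitrarily_large[OF False] by blast
      obtain n where n: "A \<subseteq> Q n" using exhaust A by blast
      have "k \<le> card (Q n)" using card_mono[OF _ n] fin A by (simp add: Q_def)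
      then have "ennreal (c ^ k) \<le> ennreal (c ^ card (Q n))"
        using c by (intro ennreal_leI power_increasing) auto
      also have "\<dots> \<le> S" unfolding S by (rule SUP_upper) simp
      finally show False using x k by simp
    qed
    then show ?thesis using False by simp
  qed
qed

context critical_binary_bbm
begin

lemma measurable_moment:
  assumes R: "1 < R" and c: "0 < c"
  shows "moment R c n p \<in> borel_measurable borel"
proof -
  have "(\<lambda>\<omega>. \<omega>) \<in> measurable M (info (descent p))"
    by (rule measurable_info_events[of _ "descent p"]) simp
  then have "(\<lambda>x. (fst x, snd x)) \<in> measurable (borel \<Otimes>\<^sub>M M) (borel \<Otimes>\<^sub>M info (descent p))"
    by (intro measurable_Pair measurable_compose[OF measurable_snd] measurable_fst)
  from measurable_compose[OF this measurable_weight_pair[OF R c order_refl]]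
  have "(\<lambda>(z, \<omega>). weight R c n p z \<omega>) \<in> borel_measurable (borel \<Otimes>\<^sub>M M)"
    by (simp add: case_prod_beta)
  then show ?thesis unfolding moment_def[OF R c, abs_def]
    by (rule borel_measurable_nn_integral)
qed

text \<open>Assumption \<open>VH\<close> says that \<open>H\<close> is a strict supersolution of the equation linearised at \<open>V\<close>:
  this makes the truncation error contract by \<open>\<kappa>\<close>.\<close>

theorem moment_squeeze:
  assumes R: "1 < R" and c: "0 < c"
    and V: "radial_function V V1 V2 V3 aV 1 (R\<^sup>2) bV BV"
    and H: "radial_function H H1 H2 H3 aH 1 (R\<^sup>2) bH BH"
    and V_in: "V 1 = c" and V_out: "V (R\<^sup>2) = 1"
    and V_eq: "\<And>r. 1 < r \<Longrightarrow> r < R\<^sup>2 \<Longrightarrow> V r - (real DIM('v) * V1 r + 2 * r * V2 r) = 1 / 2 + (V r)\<^sup>2 / 2"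
    and V_ge: "\<And>r. 1 \<le> r \<Longrightarrow> r \<le> R\<^sup>2 \<Longrightarrow> 1 \<le> V r"
    and H_ge: "\<And>r. 1 \<le> r \<Longrightarrow> r \<le> R\<^sup>2 \<Longrightarrow> 0 \<le> H r"
    and \<kappa>: "0 < \<kappa>"
    and VH: "\<And>r. 1 < r \<Longrightarrow> r < R\<^sup>2 \<Longrightarrow> V r * H r \<le> \<kappa> * (H r - (real DIM('v) * H1 r + 2 * r * H2 r))"
    and V_le: "\<And>r. 1 \<le> r \<Longrightarrow> r \<le> R\<^sup>2 \<Longrightarrow> V r \<le> 1 + H r"
    and z: "1 \<le> norm z" "norm z \<le> R"
  shows "moment R c n p z \<le> ennreal (V ((norm z)\<^sup>2)) \<and>
    ennreal (V ((norm z)\<^sup>2)) \<le> moment R c n p z + ennreal (\<kappa> ^ n * H ((norm z)\<^sup>2))"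
  using z
proof (induction n arbitrary: p z)
  case 0
  have r: "1 \<le> (norm z)\<^sup>2" "(norm z)\<^sup>2 \<le> R\<^sup>2" using 0 by (auto intro: power_mono one_le_power)
  have "moment R c 0 p z = 1" by (simp add: moment_def[OF R c] weight_def[OF R c] emeasure_space_1)
  moreover have "(1::ennreal) \<le> ennreal (V ((norm z)\<^sup>2))" using ennreal_leI[OF V_ge[OF r]] by simp
  moreover have "ennreal (V ((norm z)\<^sup>2)) \<le> 1 + ennreal (H ((norm z)\<^sup>2))"
    using ennreal_leI[OF V_le[OF r]] H_ge[OF r] by (simp add: ennreal_plus)
  ultimately show ?case by simp
next
  case (Suc n)
  let ?\<Theta>V = "resolvent_data V V1 V2 R :: 'v \<Rightarrow> real"
  let ?\<Theta>H = "resolvent_data H H1 H2 R :: 'v \<Rightarrow> real"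
  \<comment> \<open>\<open>\<Phi>\<close> is the integrand of the recursion; it is compared
    pointwise with the resolvent data of \<open>V\<close>, whose expectation Dynkin's formula
    provides.\<close>
  define \<Phi> where "\<Phi> y = (if norm y \<le> 1 then ennreal c else if R \<le> norm y then 1
     else ennreal (1 / 2) + ennreal (1 / 2) * (moment R c n (0 # p) y * moment R c n (1 # p) y))" for y
  have moment: "moment R c (Suc n) p z = (\<integral>\<^sup>+\<omega>. \<Phi> (exit_point R p z \<omega>) \<partial>M)"
    using moment_Suc[OF R c, of n p z] by (simp add: \<Phi>_def Let_def)
  have r_range: "1 \<le> (norm y)\<^sup>2" "(norm y)\<^sup>2 \<le> R\<^sup>2" if "norm y \<in> {1..R}" for y :: 'v
    using that by (auto intro: power_mono one_le_power)
  have r_in: "1 < (norm y)\<^sup>2" "(norm y)\<^sup>2 < R\<^sup>2" if "y \<in> annulus R" for y :: 'v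
    using that by (auto simp: annulus_def intro: power_strict_mono one_less_power)
  have \<Theta>V_in: "?\<Theta>V y = 1 / 2 + (V ((norm y)\<^sup>2))\<^sup>2 / 2" if "y \<in> annulus R" for y
    using V_eq[OF r_in[OF that]] that by (simp add: resolvent_data_def)
  have \<Theta>V_nonneg: "0 \<le> ?\<Theta>V y" if "norm y \<in> {1..R}" for y
  proof (cases "y \<in> annulus R")
    case True
    then show ?thesis by (simp add: \<Theta>V_in)
  next
    case False
    then show ?thesis using V_ge[OF r_range[OF that]] by (simp add: resolvent_data_def)
  qed
  have \<Theta>H_in: "V ((norm y)\<^sup>2) * H ((norm y)\<^sup>2) \<le> \<kappa> * ?\<Theta>H y" if "y \<in> annulus R" for y
    using VH[OF r_in[OF that]] that by (simp add: resolvent_data_def)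
  have \<Theta>H_nonneg: "0 \<le> ?\<Theta>H y" if y: "norm y \<in> {1..R}" for y
  proof (cases "y \<in> annulus R")
    case True
    have "0 \<le> V ((norm y)\<^sup>2) * H ((norm y)\<^sup>2)"
      using V_ge[OF r_range[OF y]] H_ge[OF r_range[OF y]] by simp
    then have "0 \<le> \<kappa> * ?\<Theta>H y" using \<Theta>H_in[OF True] by linarith
    then show ?thesis using \<kappa> by (simp add: zero_le_mult_iff)
  next
    case False
    then show ?thesis using H_ge[OF r_range[OF y]] by (simp add: resolvent_data_def)
  qed
  have key: "\<Phi> y \<le> ennreal (?\<Theta>V y) \<and> ennreal (?\<Theta>V y) \<le> \<Phi> y + ennreal (\<kappa> ^ Suc n) * ennreal (?\<Theta>H y)"
    if y: "norm y \<in> {1..R}" for y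
  proof (cases "y \<in> annulus R")
    case False
    then consider "norm y = 1" | "norm y = R" using y by (auto simp: annulus_def)
    then have "\<Phi> y = ennreal (?\<Theta>V y)"
    proof cases
      case 1
      then show ?thesis using V_in by (simp add: \<Phi>_def resolvent_data_def annulus_def)
    next
      case 2
      then show ?thesis using V_out R by (simp add: \<Phi>_def resolvent_data_def annulus_def)
    qed
    then show ?thesis by simp
  next
    case True
    define v e where "v = V ((norm y)\<^sup>2)" and "e = \<kappa> ^ n * H ((norm y)\<^sup>2)"
    have v: "1 \<le> v" using V_ge r_range[OF y] by (simp add: v_def)
    have e: "0 \<le> e" using H_ge r_range[OF y] \<kappa> by (simp add: e_def)
    \<comment> \<open>The induction hypothesis covers every label, so both children obey the same
      bounds. The upper bound makes their moments finite and permits real arithmetic.\<close>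
    have "\<exists>m. moment R c n (i # p) y = ennreal m \<and> 0 \<le> m \<and> m \<le> v \<and> v \<le> m + e" for i
    proof -
      have IH: "moment R c n (i # p) y \<le> ennreal v" "ennreal v \<le> moment R c n (i # p) y + ennreal e"
        using Suc.IH[of y "i # p"] y by (auto simp: v_def e_def)
      then obtain m where m: "moment R c n (i # p) y = ennreal m" "0 \<le> m"
        by (cases "moment R c n (i # p) y") (auto simp: top_unique)
      then have "ennreal v \<le> ennreal (m + e)" using IH(2) e by (simp add: ennreal_plus)
      then have "v \<le> m + e" using m e by (subst (asm) ennreal_le_iff) auto
      moreover have "m \<le> v" using IH(1) m v by (simp add: ennreal_le_iff)
      ultimately show ?thesis using m by blast
    qed
    then obtain m0 m1 where m: "moment R c n (0 # p) y = ennreal m0" "0 \<le> m0" "m0 \<le> v" "v \<le> m0 + e"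
      "moment R c n (1 # p) y = ennreal m1" "0 \<le> m1" "m1 \<le> v" "v \<le> m1 + e"
      by metis
    have \<Phi>: "\<Phi> y = ennreal (1 / 2 + m0 * m1 / 2)"
      using True m by (simp add: \<Phi>_def annulus_def flip: ennreal_mult ennreal_plus del: ennreal_half)
    have upper: "m0 * m1 \<le> v\<^sup>2" unfolding power2_eq_square using m v by (intro mult_mono) auto
    \<comment> \<open>Both factors lie in \<open>[v - e, v]\<close>, so their product falls short of
      \<open>v\<^sup>2\<close> by at most \<open>2 * (v * e)\<close>.\<close>
    have lower: "v\<^sup>2 \<le> m0 * m1 + 2 * (v * e)"
    proof -
      have "v * v \<le> v * (m0 + e)" "m0 * v \<le> m0 * (m1 + e)" "m0 * e \<le> v * e"
        using m v e by (intro mult_left_mono mult_right_mono; simp)+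
      then show ?thesis by (simp add: power2_eq_square algebra_simps)
    qed
    \<comment> \<open>The factor 2 cancels against the branching probability one half, and the
      remaining \<open>v * e\<close> is what \<open>VH\<close> controls.\<close>
    have "v * e \<le> \<kappa> ^ Suc n * ?\<Theta>H y"
      using mult_left_mono[OF \<Theta>H_in[OF True], of "\<kappa> ^ n"] \<kappa> by (simp add: v_def e_def algebra_simps)
    with lower have "?\<Theta>V y \<le> 1 / 2 + m0 * m1 / 2 + \<kappa> ^ Suc n * ?\<Theta>H y"
      using \<Theta>V_in[OF True] by (simp add: v_def)
    then have "ennreal (?\<Theta>V y) \<le> ennreal (1 / 2 + m0 * m1 / 2 + \<kappa> ^ Suc n * ?\<Theta>H y)"
      by (rule ennreal_leI)
    also have "\<dots> = ennreal (1 / 2 + m0 * m1 / 2) + ennreal (\<kappa> ^ Suc n * ?\<Theta>H y)"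
      using m \<kappa> \<Theta>H_nonneg[OF y] by (intro ennreal_plus) auto
    also have "ennreal (\<kappa> ^ Suc n * ?\<Theta>H y) = ennreal (\<kappa> ^ Suc n) * ennreal (?\<Theta>H y)"
      using \<kappa> \<Theta>H_nonneg[OF y] by (intro ennreal_mult) auto
    finally have "ennreal (?\<Theta>V y) \<le> \<Phi> y + ennreal (\<kappa> ^ Suc n) * ennreal (?\<Theta>H y)"
      unfolding \<Phi> .
    moreover have "\<Phi> y \<le> ennreal (?\<Theta>V y)"
      unfolding \<Phi> using upper \<Theta>V_in[OF True] by (intro ennreal_leI) (simp add: v_def)
    ultimately show ?thesis by simp
  qed
  have exit: "norm (exit_point R p z \<omega>) \<in> {1..R}" if "\<omega> \<in> space M" for \<omega>
    by (rule exit_point_annulus[OF that R]) (use Suc.prems in auto)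
  interpret V: radial_function V V1 V2 V3 aV 1 "R\<^sup>2" bV BV by (rule V)
  interpret H: radial_function H H1 H2 H3 aH 1 "R\<^sup>2" bH BH by (rule H)
  have [measurable]: "exit_point R p z \<in> borel_measurable M"
    by (rule measurable_info_events[OF exit_point_measurable[of p UNIV]]) auto
  have \<Theta>H_meas[measurable]: "?\<Theta>H \<in> borel_measurable borel"
    by (rule resolvent_data_measurable) (rule H.F_measurable H.F1_measurable H.F2_measurable)+
  have [measurable]: "moment R c n q \<in> borel_measurable borel" for q by (rule measurable_moment[OF R c])
  have [measurable]: "\<Phi> \<in> borel_measurable borel" unfolding \<Phi>_def by measurable
  have dV: "(\<integral>\<^sup>+\<omega>. ennreal (?\<Theta>V (exit_point R p z \<omega>)) \<partial>M) = ennreal (V ((norm z)\<^sup>2))"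
    by (rule dynkin_exponential_time[OF R c V Suc.prems \<Theta>V_nonneg])
  have dH: "(\<integral>\<^sup>+\<omega>. ennreal (?\<Theta>H (exit_point R p z \<omega>)) \<partial>M) = ennreal (H ((norm z)\<^sup>2))"
    by (rule dynkin_exponential_time[OF R c H Suc.prems \<Theta>H_nonneg])
  have "moment R c (Suc n) p z \<le> ennreal (V ((norm z)\<^sup>2))"
    unfolding moment dV[symmetric] by (intro nn_integral_mono) (use key exit in auto)
  moreover have "ennreal (V ((norm z)\<^sup>2)) \<le> moment R c (Suc n) p z + ennreal (\<kappa> ^ Suc n * H ((norm z)\<^sup>2))"
  proof -
    have "ennreal (V ((norm z)\<^sup>2)) \<le> (\<integral>\<^sup>+\<omega>. \<Phi> (exit_point R p z \<omega>) +
        ennreal (\<kappa> ^ Suc n) * ennreal (?\<Theta>H (exit_point R p z \<omega>)) \<partial>M)"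
      unfolding dV[symmetric] by (intro nn_integral_mono) (use key exit in auto)
    also have "\<dots> = moment R c (Suc n) p z + ennreal (\<kappa> ^ Suc n) * ennreal (H ((norm z)\<^sup>2))"
      unfolding moment dH[symmetric] by (subst nn_integral_add) (simp_all add: nn_integral_cmult)
    also have "ennreal (\<kappa> ^ Suc n) * ennreal (H ((norm z)\<^sup>2)) = ennreal (\<kappa> ^ Suc n * H ((norm z)\<^sup>2))"
      using \<kappa> H_ge r_range[of z] Suc.prems by (intro ennreal_mult[symmetric]) auto
    finally show ?thesis .
  qed
  ultimately show ?case by simp
qed

text \<open>The weights increase with the number of generations, so monotone convergence identifies
  the integral of their supremum. For \<open>c > 1\<close> its finiteness also shows that infinitely
  many pioneers occur with probability 0 only.\<close>

theorem pioneer_moment: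
  assumes R: "1 < R" and c: "1 \<le> c" and z: "1 \<le> norm z" "norm z \<le> R"
    and lim: "(\<lambda>n. moment R c n [] z) \<longlonglongrightarrow> ennreal v" and v: "0 \<le> v"
  shows "integrable M (\<lambda>\<omega>. c ^ num_pioneers R z life offspring motion \<omega>) \<and>
    expectation (\<lambda>\<omega>. c ^ num_pioneers R z life offspring motion \<omega>) = v"
\<comment> \<open>For \<open>c = 1\<close> the weights cannot detect an infinite set of pioneers,
  but then both sides are 1.\<close>
proof (cases "c = 1")
  case True
  have "(\<lambda>n. moment R c n [] z) \<longlonglongrightarrow> ennreal 1"
    by (simp add: moment_def[OF R] weight_def[OF R] True emeasure_space_1)
  from LIMSEQ_unique[OF this lim] have "v = 1" using v by (metis ennreal_inj zero_le_one)
  then show ?thesis by (simp add: True prob_space)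
next
  case False
  with c have c: "1 < c" by simp
  then have c0: "0 < c" by simp
  define w where "w n \<omega> = weight R c n [] z \<omega>" for n \<omega>
  define S where "S \<omega> = (SUP n. w n \<omega>)" for \<omega>
  define N where "N = num_pioneers R z life offspring motion"
  have w_meas[measurable]: "w n \<in> borel_measurable M" for n
    unfolding w_def by (rule measurable_info_events[OF measurable_weight[OF R c0 order_refl]])
  have [measurable]: "S \<in> borel_measurable M" unfolding S_def by measurable
  have w_card: "w n \<omega> = ennreal (c ^ card (trunc_pioneers n R z (\<lambda>u. life u \<omega>) (\<lambda>u. offspring u \<omega>) (\<lambda>u t. motion u t \<omega>)))"
    if "\<omega> \<in> space M" for n \<omega>
    using card_trunc_pioneers[OF that R z, of n "[]"] by (simp add: w_def weight_def[OF R c0])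
  have fin: "finite (trunc_pioneers n R z (\<lambda>u. life u \<omega>) (\<lambda>u. offspring u \<omega>) (\<lambda>u t. motion u t \<omega>))"
    if "\<omega> \<in> space M" for n \<omega>
    by (rule finite_trunc_pioneers) (use that life_pos motion_zero motion_continuous R z in auto)
  have inc: "w n \<omega> \<le> w (Suc n) \<omega>" if "\<omega> \<in> space M" for n \<omega>
    unfolding w_card[OF that] using c fin[OF that]
    by (intro ennreal_leI power_increasing card_mono) (auto simp: trunc_pioneers_def)
  have N: "ennreal (c ^ N \<omega>) = (if S \<omega> < \<infinity> then S \<omega> else 1)" if "\<omega> \<in> space M" for \<omega>
    using SUP_power_card[OF c fin[OF that, unfolded trunc_pioneers_def]] w_card[OF that]
    by (simp add: N_def num_pioneers_def S_def trunc_pioneers_def)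
  have int_S: "integral\<^sup>N M S = ennreal v"
  proof -
    have "integral\<^sup>N M S = (SUP n. integral\<^sup>N M (w n))" unfolding S_def
      by (rule nn_integral_monotone_convergence_SUP_AE) (use inc in auto)
    also have "\<dots> = (SUP n. moment R c n [] z)" by (simp add: moment_def[OF R c0] w_def[abs_def])
    also have "\<dots> = ennreal v"
    proof (rule LIMSEQ_unique[OF LIMSEQ_SUP lim])
      show "incseq (\<lambda>n. moment R c n [] z)"
        using inc by (intro incseq_SucI) (auto simp: moment_def[OF R c0] w_def[abs_def] intro!: nn_integral_mono)
    qed
    finally show ?thesis .
  qed
  \<comment> \<open>Measurability comes from the supremum of the truncated weights, of which the
    power is a function.\<close>
  have N_meas: "(\<lambda>\<omega>. c ^ N \<omega>) \<in> borel_measurable M"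
  proof -
    have "(\<lambda>\<omega>. enn2real (if S \<omega> < \<infinity> then S \<omega> else 1)) \<in> borel_measurable M" by measurable
    moreover have "enn2real (if S \<omega> < \<infinity> then S \<omega> else 1) = c ^ N \<omega>" if "\<omega> \<in> space M" for \<omega>
      using N[OF that, symmetric] c by (simp del: ennreal_power)
    ultimately show ?thesis by (rule iffD1[OF measurable_cong, rotated])
  qed
  have "AE \<omega> in M. S \<omega> \<noteq> \<infinity>"
    by (rule nn_integral_PInf_AE) (use int_S in auto)
  then have "(\<integral>\<^sup>+\<omega>. ennreal (c ^ N \<omega>) \<partial>M) = integral\<^sup>N M S"
    using AE_space by (intro nn_integral_cong_AE) (auto elim!: eventually_mono simp: N less_top)
  then have nn: "(\<integral>\<^sup>+\<omega>. ennreal (c ^ N \<omega>) \<partial>M) = ennreal v" using int_S by simp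
  have nonneg: "AE \<omega> in M. 0 \<le> c ^ N \<omega>" using c by simp
  have "integrable M (\<lambda>\<omega>. c ^ N \<omega>)"
    by (rule integrableI_nn_integral_finite[OF N_meas nonneg nn])
  moreover have "expectation (\<lambda>\<omega>. c ^ N \<omega>) = v"
    using integral_eq_nn_integral[OF N_meas nonneg] nn v by simp
  ultimately show ?thesis by (simp add: N_def)
qed

end

section \<open>The two radial profiles\<close>

text \<open>Vanishing off an interval slightly larger than the relevant one supplies the global
  bound and measurability required by \<open>radial_function\<close>, with no change on the
  annulus.\<close>

definition cutoff :: "real \<Rightarrow> real \<Rightarrow> (real \<Rightarrow> real) \<Rightarrow> real \<Rightarrow> real" where
  "cutoff a b G r = indicator {a<..<b} r * G r"

lemma radial_function_cutoff:
  fixes F F1 F2 F3 :: "real \<Rightarrow> real"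
  assumes ab: "a' < a" "a \<le> b" "b < b'" "0 \<le> a"
    and F: "\<And>r. r \<in> {a'..b'} \<Longrightarrow> (F has_real_derivative F1 r) (at r)"
    and F1: "\<And>r. r \<in> {a'..b'} \<Longrightarrow> (F1 has_real_derivative F2 r) (at r)"
    and F2: "\<And>r. r \<in> {a'..b'} \<Longrightarrow> (F2 has_real_derivative F3 r) (at r)"
    and F3: "continuous_on {a'..b'} F3"
  shows "\<exists>B. radial_function (cutoff a' b' F) (cutoff a' b' F1) (cutoff a' b' F2) (cutoff a' b' F3) a' a b b' B"
proof -
  have cont: "continuous_on {a'..b'} F" "continuous_on {a'..b'} F1" "continuous_on {a'..b'} F2"
    by (intro continuous_at_imp_continuous_on ballI DERIV_isCont[OF F] DERIV_isCont[OF F1] DERIV_isCont[OF F2]; simp)+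
  have "bounded (F ` {a'..b'})" "bounded (F3 ` {a'..b'})"
    by (intro compact_imp_bounded compact_continuous_image cont F3; simp)+
  then obtain C C3 where C: "\<forall>r\<in>{a'..b'}. \<bar>F r\<bar> \<le> C" "\<forall>r\<in>{a'..b'}. \<bar>F3 r\<bar> \<le> C3"
    unfolding bounded_iff ball_simps real_norm_def by blast
  define B where "B = max 0 (max C C3)"
  have B: "\<bar>cutoff a' b' F r\<bar> \<le> B" "\<bar>cutoff a' b' F3 r\<bar> \<le> B" for r
    using C by (auto simp: B_def cutoff_def indicator_def) (fastforce simp: le_max_iff_disj)+
  have deriv: "(cutoff a' b' G has_real_derivative cutoff a' b' G' r) (at r)"
    if "r \<in> {a'<..<b'}" "(G has_real_derivative G' r) (at r)" for G G' r
  proof (rule has_field_derivative_transform_within_open[where f = G and S = "{a'<..<b'}"])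
    show "(G has_real_derivative cutoff a' b' G' r) (at r)" using that by (simp add: cutoff_def)
  qed (use that in \<open>auto simp: cutoff_def\<close>)
  have meas: "cutoff a' b' G \<in> borel_measurable borel" if "continuous_on {a'..b'} G" for G
  proof -
    have "continuous_on {a'<..<b'} G" by (rule continuous_on_subset[OF that]) auto
    from borel_measurable_continuous_on_indicator[OF _ this] show ?thesis
      by (simp add: cutoff_def[abs_def])
  qed
  have "radial_function (cutoff a' b' F) (cutoff a' b' F1) (cutoff a' b' F2) (cutoff a' b' F3) a' a b b' B"
  proof unfold_locales
    fix r assume r: "r \<in> {a'<..<b'}"
    then have r': "r \<in> {a'..b'}" by simp
    show "(cutoff a' b' F has_real_derivative cutoff a' b' F1 r) (at r)" by (rule deriv[where G = F and G' = F1, OF r F[OF r']])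
    show "(cutoff a' b' F1 has_real_derivative cutoff a' b' F2 r) (at r)" by (rule deriv[where G = F1 and G' = F2, OF r F1[OF r']])
    show "(cutoff a' b' F2 has_real_derivative cutoff a' b' F3 r) (at r)" by (rule deriv[where G = F2 and G' = F3, OF r F2[OF r']])
  qed (use ab B meas cont in auto)
  then show ?thesis by blast
qed

text \<open>The profile \<open>1 - g (L - ln r / 2) / r\<close> is the candidate generating function in the variable
  \<open>r = (norm y)\<^sup>2\<close>; with \<open>x = L - ln r / 2\<close> one has \<open>r = (exp (- x) * exp L)\<^sup>2\<close>.\<close>

lemma profile_radial_function:
  fixes g g1 g2 :: "real \<Rightarrow> real"
  assumes g: "\<And>x. x \<in> I \<Longrightarrow> (g has_real_derivative g1 x) (at x)"
    and g1: "\<And>x. x \<in> I \<Longrightarrow> (g1 has_real_derivative g2 x) (at x)"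
    and ode: "\<And>x. x \<in> I \<Longrightarrow> g2 x + 2 * g1 x = (g x)\<^sup>2"
    and I: "open I" "0 \<in> I" "{0..} \<subseteq> I" and L: "0 < L"
  defines "V r \<equiv> 1 - g (L - ln r / 2) / r"
    and "V1 r \<equiv> (g1 (L - ln r / 2) / 2 + g (L - ln r / 2)) / r\<^sup>2"
    and "V2 r \<equiv> - ((g (L - ln r / 2))\<^sup>2 / 4 + g1 (L - ln r / 2) + 2 * g (L - ln r / 2)) / r ^ 3"
  shows "\<exists>b' V3 B. (exp L)\<^sup>2 < b' \<and> radial_function (cutoff (1 / 2) b' V) (cutoff (1 / 2) b' V1)
    (cutoff (1 / 2) b' V2) V3 (1 / 2) 1 ((exp L)\<^sup>2) b' B"
proof -
  obtain e where e: "e > 0" "ball 0 e \<subseteq> I" using I(1,2) open_contains_ball by blast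
  \<comment> \<open>For \<open>r \<le> b'\<close> the argument \<open>L - ln r / 2\<close> is at
    least \<open>- e / 2\<close>: the solution is used slightly to the left of 0, which corresponds
    to radii slightly beyond \<open>exp L\<close>.\<close>
  define b' where "b' = exp (2 * L + e)"
  have b': "(exp L)\<^sup>2 < b'" using e by (simp add: b'_def power2_eq_square flip: exp_add)
  \<comment> \<open>The derivative of \<open>V2\<close> with the second derivative of
    \<open>g\<close> eliminated by the equation, so that continuity of \<open>g\<close> and
    \<open>g1\<close> is enough.\<close>
  define V3 where "V3 r = (g (L - ln r / 2) * g1 (L - ln r / 2) / 4 + 5 * (g (L - ln r / 2))\<^sup>2 / 4 +
     3 * g1 (L - ln r / 2) + 6 * g (L - ln r / 2)) / r ^ 4" for r
  have x_I: "L - ln r / 2 \<in> I" if r: "r \<in> {1 / 2..b'}" for r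
  proof -
    have "ln r \<le> ln b'" using r by (subst ln_le_cancel_iff) (auto intro: less_le_trans[of 0 "1/2"])
    then have "- (e / 2) \<le> L - ln r / 2" by (simp add: b'_def)
    moreover have "x \<in> I" if "- (e / 2) \<le> x" for x
    proof (cases "0 \<le> x")
      case False
      then have "x \<in> ball 0 e" using that e(1) by (simp add: dist_real_def)
      then show ?thesis using e(2) by blast
    qed (use I(3) in auto)
    ultimately show ?thesis by blast
  qed
  have pos: "0 < r" if "r \<in> {1 / 2..b'}" for r using that by simp
  have x: "((\<lambda>r. L - ln r / 2) has_real_derivative - 1 / (2 * r)) (at r)" if "r \<in> {1 / 2..b'}" for r
    using pos[OF that] by (auto intro!: derivative_eq_intros simp: field_simps)
  have dg: "((\<lambda>r. g (L - ln r / 2)) has_real_derivative g1 (L - ln r / 2) * (- 1 / (2 * r))) (at r)"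
    if "r \<in> {1 / 2..b'}" for r by (rule DERIV_chain2[OF g[OF x_I[OF that]] x[OF that]])
  have dg1: "((\<lambda>r. g1 (L - ln r / 2)) has_real_derivative g2 (L - ln r / 2) * (- 1 / (2 * r))) (at r)"
    if "r \<in> {1 / 2..b'}" for r by (rule DERIV_chain2[OF g1[OF x_I[OF that]] x[OF that]])
  have g2: "g2 (L - ln r / 2) = (g (L - ln r / 2))\<^sup>2 - 2 * g1 (L - ln r / 2)" if "r \<in> {1 / 2..b'}" for r
    using ode[OF x_I[OF that]] by simp
  have "\<exists>B. radial_function (cutoff (1 / 2) b' V) (cutoff (1 / 2) b' V1) (cutoff (1 / 2) b' V2) (cutoff (1 / 2) b' V3)
     (1 / 2) 1 ((exp L)\<^sup>2) b' B"
  proof (rule radial_function_cutoff)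
    show "1 \<le> (exp L)\<^sup>2" using L by (simp add: one_le_power)
    fix r assume r: "r \<in> {1 / 2..b'}"
    note D = dg[OF r] dg1[OF r] and r0 = pos[OF r]
    have ne: "r \<noteq> 0" "r\<^sup>2 \<noteq> 0" "r ^ 3 \<noteq> 0" using r0 by auto
    have "((\<lambda>r. 1 - g (L - ln r / 2) / r) has_real_derivative V1 r) (at r)"
      by (rule derivative_eq_intros D ne refl)+
        (use r0 in \<open>simp add: V1_def power2_eq_square field_simps\<close>)
    then show "(V has_real_derivative V1 r) (at r)" by (simp add: V_def[abs_def])
    have d2: "((\<lambda>r. r\<^sup>2) has_real_derivative 2 * r) (at r)"
      and d3: "((\<lambda>r. r ^ 3) has_real_derivative 3 * r\<^sup>2) (at r)"
      by (auto intro!: derivative_eq_intros)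
    define a a1 where "a = g (L - ln r / 2)" and "a1 = g1 (L - ln r / 2)"
    note D' = D[unfolded g2[OF r], folded a_def a1_def]
    have "((\<lambda>r. (g1 (L - ln r / 2) / 2 + g (L - ln r / 2)) / r\<^sup>2) has_real_derivative
        (((a\<^sup>2 - 2 * a1) * (- 1 / (2 * r)) / 2 + a1 * (- 1 / (2 * r))) * r\<^sup>2 - (a1 / 2 + a) * (2 * r)) /
        (r\<^sup>2 * r\<^sup>2)) (at r)"
      unfolding a_def a1_def
      by (intro DERIV_divide DERIV_add DERIV_cdivide D'[unfolded a_def a1_def] d2 ne)
    moreover have "(((a\<^sup>2 - 2 * a1) * (- 1 / (2 * r)) / 2 + a1 * (- 1 / (2 * r))) * r\<^sup>2 - (a1 / 2 + a) * (2 * r)) /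
        (r\<^sup>2 * r\<^sup>2) = V2 r"
      unfolding V2_def a_def[symmetric] a1_def[symmetric] using r0 by (simp add: eval_nat_numeral field_simps)
    ultimately show "(V1 has_real_derivative V2 r) (at r)" by (simp add: V1_def[abs_def])
    have dsq: "((\<lambda>r. (g (L - ln r / 2))\<^sup>2) has_real_derivative 2 * a * (a1 * (- 1 / (2 * r)))) (at r)"
      using DERIV_power[OF D'(1), of 2] by (simp add: a_def ac_simps)
    have "((\<lambda>r. - ((g (L - ln r / 2))\<^sup>2 / 4 + g1 (L - ln r / 2) + 2 * g (L - ln r / 2)) / r ^ 3) has_real_derivative
        (- (2 * a * (a1 * (- 1 / (2 * r))) / 4 + (a\<^sup>2 - 2 * a1) * (- 1 / (2 * r)) + 2 * (a1 * (- 1 / (2 * r)))) * r ^ 3 -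
          - (a\<^sup>2 / 4 + a1 + 2 * a) * (3 * r\<^sup>2)) / (r ^ 3 * r ^ 3)) (at r)"
      unfolding a_def a1_def
      by (intro DERIV_divide DERIV_minus DERIV_add DERIV_cdivide DERIV_cmult D'[unfolded a_def a1_def]
          dsq[unfolded a_def a1_def] d3 ne)
    moreover have "(- (2 * a * (a1 * (- 1 / (2 * r))) / 4 + (a\<^sup>2 - 2 * a1) * (- 1 / (2 * r)) + 2 * (a1 * (- 1 / (2 * r)))) * r ^ 3 -
          - (a\<^sup>2 / 4 + a1 + 2 * a) * (3 * r\<^sup>2)) / (r ^ 3 * r ^ 3) = V3 r"
      unfolding V3_def a_def[symmetric] a1_def[symmetric] using r0 by (simp add: eval_nat_numeral field_simps)
    ultimately show "(V2 has_real_derivative V3 r) (at r)" by (simp add: V2_def[abs_def])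
  next
    show "continuous_on {1 / 2..b'} V3"
      unfolding V3_def
      by (intro continuous_at_imp_continuous_on ballI continuous_intros DERIV_isCont[OF dg] DERIV_isCont[OF dg1])
        (auto dest: pos)
  qed (use b' in auto)
  then show ?thesis using b' by blast
qed

lemma inverse_norm_radial_function:
  fixes R :: real
  assumes "1 \<le> R"
  shows "\<exists>H3 B. radial_function (cutoff (1 / 2) (R\<^sup>2 + 1) (\<lambda>r. r powr (- 1 / 2)))
    (cutoff (1 / 2) (R\<^sup>2 + 1) (\<lambda>r. - 1 / 2 * r powr (- 3 / 2)))
    (cutoff (1 / 2) (R\<^sup>2 + 1) (\<lambda>r. 3 / 4 * r powr (- 5 / 2))) H3 (1 / 2) 1 (R\<^sup>2) (R\<^sup>2 + 1) B"
proof -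
  have "\<exists>B. radial_function (cutoff (1 / 2) (R\<^sup>2 + 1) (\<lambda>r. r powr (- 1 / 2)))
    (cutoff (1 / 2) (R\<^sup>2 + 1) (\<lambda>r. - 1 / 2 * r powr (- 3 / 2)))
    (cutoff (1 / 2) (R\<^sup>2 + 1) (\<lambda>r. 3 / 4 * r powr (- 5 / 2)))
    (cutoff (1 / 2) (R\<^sup>2 + 1) (\<lambda>r. - 15 / 8 * r powr (- 7 / 2))) (1 / 2) 1 (R\<^sup>2) (R\<^sup>2 + 1) B"
  proof (rule radial_function_cutoff)
    show "1 \<le> R\<^sup>2" using assms by (simp add: one_le_power)
    fix r assume "r \<in> {1 / 2..R\<^sup>2 + 1}"
    then have r: "0 < r" by simp
    show "((\<lambda>r. r powr (- 1 / 2)) has_real_derivative - 1 / 2 * r powr (- 3 / 2)) (at r)"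
      "((\<lambda>r. - 1 / 2 * r powr (- 3 / 2)) has_real_derivative 3 / 4 * r powr (- 5 / 2)) (at r)"
      "((\<lambda>r. 3 / 4 * r powr (- 5 / 2)) has_real_derivative - 15 / 8 * r powr (- 7 / 2)) (at r)"
      using r by (auto intro!: derivative_eq_intros simp: field_simps)
  next
    show "continuous_on {1 / 2..R\<^sup>2 + 1} (\<lambda>r. - 15 / 8 * r powr (- 7 / 2))"
      by (intro continuous_intros) auto
  qed auto
  then show ?thesis by blast
qed

lemma pioneer_representation:
  fixes M :: "'a measure" and motion :: "label \<Rightarrow> real \<Rightarrow> 'a \<Rightarrow> real ^ 4"
  assumes lam: "0 \<le> lam" "lam < 1" and bbm: "critical_binary_bbm M life offspring motion"
    and L: "0 < L" and x: "x \<in> {0..L}" and z: "norm z = exp (- x) * exp L"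
  shows "integrable M (\<lambda>\<omega>. (1 - ivp_max lam L) ^ num_pioneers (exp L) z life offspring motion \<omega>) \<and>
    ivp_max lam x = (exp (- x) * exp L)\<^sup>2 *
      (1 - (\<integral>\<omega>. (1 - ivp_max lam L) ^ num_pioneers (exp L) z life offspring motion \<omega> \<partial>M))"
proof -
  interpret bbm: critical_binary_bbm M life offspring motion by (rule bbm)
  define g where "g = ivp_max lam"
  define R where "R = exp L"
  define c where "c = 1 - g L"
  have I: "{0..} \<subseteq> ivp_domain lam" by (rule ivp_max_bounds(1)) (use lam in auto)
  have g_bounds: "- lam / 2 \<le> g y" "g y \<le> 0" if "0 \<le> y" for y
    unfolding g_def using ivp_max_bounds(2)[of lam y] lam that by auto
  obtain g1 g2 where g: "\<And>x. x \<in> ivp_domain lam \<Longrightarrow> (g has_real_derivative g1 x) (at x)"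
      "\<And>x. x \<in> ivp_domain lam \<Longrightarrow> (g1 has_real_derivative g2 x) (at x)"
      "\<And>x. x \<in> ivp_domain lam \<Longrightarrow> g2 x + 2 * g1 x = (g x)\<^sup>2" and g0: "g 0 = 0"
    and dom: "open (ivp_domain lam)" "0 \<in> ivp_domain lam"
    using ivp_solution_ivp_max[of lam] unfolding ivp_solution_def g_def by blast
  define y where "y r = L - ln r / 2" for r
  define V where "V r = 1 - g (y r) / r" for r
  define V1 where "V1 r = (g1 (y r) / 2 + g (y r)) / r\<^sup>2" for r
  define V2 where "V2 r = - ((g (y r))\<^sup>2 / 4 + g1 (y r) + 2 * g (y r)) / r ^ 3" for r
  obtain b V3 B where b: "R\<^sup>2 < b" and
    Vr: "radial_function (cutoff (1 / 2) b V) (cutoff (1 / 2) b V1) (cutoff (1 / 2) b V2) V3 (1 / 2) 1 (R\<^sup>2) b B"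
    using profile_radial_function[OF g dom I L] unfolding V_def V1_def V2_def y_def R_def by blast
  have R: "1 < R" using L by (simp add: R_def)
  define H where "H r = r powr (- 1 / 2)" for r :: real
  define H1 where "H1 r = - 1 / 2 * r powr (- 3 / 2)" for r :: real
  define H2 where "H2 r = 3 / 4 * r powr (- 5 / 2)" for r :: real
  obtain H3 BH where Hr: "radial_function (cutoff (1 / 2) (R\<^sup>2 + 1) H) (cutoff (1 / 2) (R\<^sup>2 + 1) H1)
      (cutoff (1 / 2) (R\<^sup>2 + 1) H2) H3 (1 / 2) 1 (R\<^sup>2) (R\<^sup>2 + 1) BH"
    using inverse_norm_radial_function[of R] R unfolding H_def H1_def H2_def by auto
  have cutV: "cutoff (1 / 2) b G r = G r" and cutH: "cutoff (1 / 2) (R\<^sup>2 + 1) G r = G r"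
    if "1 \<le> r" "r \<le> R\<^sup>2" for G r
    using that b by (simp_all add: cutoff_def)
  have lnR: "ln (R\<^sup>2) = 2 * L" by (simp add: R_def ln_realpow)
  have y: "0 \<le> y r" "y r \<le> L" if r: "1 \<le> r" "r \<le> R\<^sup>2" for r
  proof -
    have "ln r \<le> ln (R\<^sup>2)" using r by (subst ln_le_cancel_iff) auto
    then show "0 \<le> y r" by (simp add: y_def lnR)
    show "y r \<le> L" using r by (simp add: y_def)
  qed
  have V_ge: "1 \<le> V r" and V_le: "V r \<le> 1 + lam / 2 / r" if r: "1 \<le> r" "r \<le> R\<^sup>2" for r
  proof -
    have "g (y r) / r \<le> 0" using g_bounds(2)[OF y(1)[OF r]] r by (simp add: divide_le_0_iff)
    then show "1 \<le> V r" by (simp add: V_def)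
    have "- g (y r) / r \<le> lam / 2 / r" using g_bounds(1)[OF y(1)[OF r]] r by (intro divide_right_mono) auto
    then show "V r \<le> 1 + lam / 2 / r" by (simp add: V_def)
  qed
  have dim: "DIM(real ^ 4) = 4" by simp
  \<comment> \<open>The ratio required at \<open>r\<close> is
    \<open>(2 * r + lam) / (2 * r + 1)\<close>. It increases with \<open>r\<close> because
    \<open>lam < 1\<close>, so its value at \<open>r = R\<^sup>2\<close> serves on the whole
    annulus.\<close>
  define \<kappa> where "\<kappa> = (2 * R\<^sup>2 + lam) / (2 * R\<^sup>2 + 1)"
  have R2: "1 < R\<^sup>2" using R by (simp add: one_less_power)
  have \<kappa>: "0 < \<kappa>" "\<kappa> < 1" using R2 lam by (simp_all add: \<kappa>_def field_simps)
  have squeeze: "bbm.moment R c n [] z \<le> ennreal (V ((norm z)\<^sup>2)) \<and>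
      ennreal (V ((norm z)\<^sup>2)) \<le> bbm.moment R c n [] z + ennreal (\<kappa> ^ n * H ((norm z)\<^sup>2))"
    if zR: "1 \<le> norm z" "norm z \<le> R" for n
  proof -
    have r: "1 \<le> (norm z)\<^sup>2" "(norm z)\<^sup>2 \<le> R\<^sup>2" using zR by (auto intro: power_mono one_le_power)
    have "bbm.moment R c n [] z \<le> ennreal (cutoff (1 / 2) b V ((norm z)\<^sup>2)) \<and>
      ennreal (cutoff (1 / 2) b V ((norm z)\<^sup>2)) \<le>
        bbm.moment R c n [] z + ennreal (\<kappa> ^ n * cutoff (1 / 2) (R\<^sup>2 + 1) H ((norm z)\<^sup>2))"
    proof (rule bbm.moment_squeeze[OF R _ Vr Hr])
      show "0 < c" using g_bounds(2)[of L] L by (simp add: c_def)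
      show "cutoff (1 / 2) b V 1 = c" using R2 by (subst cutV) (auto simp: V_def y_def c_def)
      show "cutoff (1 / 2) b V (R\<^sup>2) = 1" using R2 by (subst cutV) (auto simp: V_def y_def lnR g0)
      show "1 \<le> cutoff (1 / 2) b V r" if "1 \<le> r" "r \<le> R\<^sup>2" for r using V_ge[OF that] cutV[OF that] by simp
      show "0 \<le> cutoff (1 / 2) (R\<^sup>2 + 1) H r" if "1 \<le> r" "r \<le> R\<^sup>2" for r using cutH[OF that] by (simp add: H_def)
      show "0 < \<kappa>" by (rule \<kappa>)
      show "cutoff (1 / 2) b V r \<le> 1 + cutoff (1 / 2) (R\<^sup>2 + 1) H r" if r: "1 \<le> r" "r \<le> R\<^sup>2" for r
      proof -
        \<comment> \<open>The initial datum 1 misses \<open>V\<close> by at most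
          \<open>lam / (2 * r)\<close>, and \<open>1 / r \<le> r powr (- 1 / 2)\<close> for
          \<open>r \<ge> 1\<close>.\<close>
        have "lam / 2 / r \<le> 1 * r powr (- 1)" using lam r by (simp add: powr_minus divide_simps)
        also have "\<dots> \<le> H r" unfolding H_def using powr_mono[of "- 1" "- 1 / 2" r] r by linarith
        finally show ?thesis using V_le[OF r] unfolding cutV[OF r] cutH[OF r] by linarith
      qed
      show "cutoff (1 / 2) b V r - (real DIM(real ^ 4) * cutoff (1 / 2) b V1 r + 2 * r * cutoff (1 / 2) b V2 r) =
          1 / 2 + (cutoff (1 / 2) b V r)\<^sup>2 / 2" if r: "1 < r" "r < R\<^sup>2" for r
      proof -
        have r': "1 \<le> r" "r \<le> R\<^sup>2" using r by auto
        define G G1 where "G = g (y r)" and "G1 = g1 (y r)"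
        \<comment> \<open>In \<open>V2\<close> the second derivative of \<open>g\<close> is already
          replaced through the equation, so an identity of rational functions remains.\<close>
        have "V r - (4 * V1 r + 2 * r * V2 r) = 1 / 2 + (V r)\<^sup>2 / 2"
          unfolding V_def V1_def V2_def G_def[symmetric] G1_def[symmetric]
          using r by (simp add: eval_nat_numeral field_simps)
        then show ?thesis unfolding cutV[OF r'] dim by simp
      qed
      show "cutoff (1 / 2) b V r * cutoff (1 / 2) (R\<^sup>2 + 1) H r \<le> \<kappa> * (cutoff (1 / 2) (R\<^sup>2 + 1) H r -
         (real DIM(real ^ 4) * cutoff (1 / 2) (R\<^sup>2 + 1) H1 r + 2 * r * cutoff (1 / 2) (R\<^sup>2 + 1) H2 r))"
        if r: "1 < r" "r < R\<^sup>2" for r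
      proof -
        have r': "1 \<le> r" "r \<le> R\<^sup>2" using r by auto
        have p: "r powr (- 3 / 2) = H r / r" "r powr (- 5 / 2) = H r / r\<^sup>2"
          using r powr_diff[of r "- 1 / 2" 1] powr_diff[of r "- 1 / 2" 2] by (simp_all add: H_def)
        \<comment> \<open>\<open>H\<close> is \<open>1 / norm y\<close>, and in dimension 4 half its
          Laplacian is \<open>- H r / (2 * r)\<close>.\<close>
        have gen: "H r - (4 * H1 r + 2 * r * H2 r) = H r * (1 + 1 / (2 * r))"
          unfolding H1_def H2_def p using r by (simp add: power2_eq_square field_simps)
        \<comment> \<open>Twice this product is the difference of the two sides after
          cross-multiplying the ratios at \<open>r\<close> and at \<open>R\<^sup>2\<close>.\<close>
        have "0 \<le> (1 - lam) * (R\<^sup>2 - r)" using lam r by simp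
        then have "(2 * r + lam) * (2 * R\<^sup>2 + 1) \<le> (2 * R\<^sup>2 + lam) * (2 * r + 1)" by (simp add: algebra_simps)
        then have "(2 * r + lam) / (2 * r) \<le> \<kappa> * ((2 * r + 1) / (2 * r))"
          using r R2 by (simp add: \<kappa>_def pos_le_divide_eq divide_right_mono) 
        then have "V r \<le> \<kappa> * (1 + 1 / (2 * r))"
          using V_le[OF r'] r by (simp add: add_divide_distrib)
        then have "V r * H r \<le> \<kappa> * (1 + 1 / (2 * r)) * H r"
          by (rule mult_right_mono) (simp add: H_def)
        then show ?thesis unfolding cutV[OF r'] cutH[OF r'] dim using gen by (simp add: ac_simps)
      qed
    qed (use zR in auto)
    then show ?thesis unfolding cutV[OF r] cutH[OF r] .
  qed
  have norm_z: "norm z = exp (L - x)" using z by (simp flip: exp_add)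
  have zR: "1 \<le> norm z" "norm z \<le> R" using x unfolding norm_z R_def by simp_all
  have r: "1 \<le> (norm z)\<^sup>2" "(norm z)\<^sup>2 \<le> R\<^sup>2" using zR by (auto intro: power_mono one_le_power)
  define v where "v = V ((norm z)\<^sup>2)"
  have v: "1 \<le> v" unfolding v_def by (rule V_ge[OF r])
  have "(\<lambda>n. bbm.moment R c n [] z) \<longlonglongrightarrow> ennreal v"
  proof (rule tendsto_sandwich)
    show "\<forall>\<^sub>F n in sequentially. bbm.moment R c n [] z \<le> ennreal v"
      using squeeze[OF zR] by (simp add: v_def)
    show "\<forall>\<^sub>F n in sequentially. ennreal (v - \<kappa> ^ n * H ((norm z)\<^sup>2)) \<le> bbm.moment R c n [] z"
    proof (intro always_eventually allI)
      fix n
      have e: "0 \<le> \<kappa> ^ n * H ((norm z)\<^sup>2)" using \<kappa> by (simp add: H_def)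
      have "ennreal (v - \<kappa> ^ n * H ((norm z)\<^sup>2)) = ennreal v - ennreal (\<kappa> ^ n * H ((norm z)\<^sup>2))"
        by (rule ennreal_minus[symmetric, OF e])
      also have "\<dots> \<le> bbm.moment R c n [] z"
        using squeeze[OF zR, of n] by (subst ennreal_minus_le_iff) (auto simp: v_def add.commute)
      finally show "ennreal (v - \<kappa> ^ n * H ((norm z)\<^sup>2)) \<le> bbm.moment R c n [] z" .
    qed
    have "(\<lambda>n. v - \<kappa> ^ n * H ((norm z)\<^sup>2)) \<longlonglongrightarrow> v - 0 * H ((norm z)\<^sup>2)"
      using \<kappa> by (intro tendsto_intros LIMSEQ_power_zero) simp
    then show "(\<lambda>n. ennreal (v - \<kappa> ^ n * H ((norm z)\<^sup>2))) \<longlonglongrightarrow> ennreal v"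
      by (intro tendsto_ennrealI) simp
  qed simp
  from bbm.pioneer_moment[OF R _ zR this]
  have main: "integrable M (\<lambda>\<omega>. c ^ num_pioneers R z life offspring motion \<omega>)"
    "(\<integral>\<omega>. c ^ num_pioneers R z life offspring motion \<omega> \<partial>M) = v"
    using g_bounds(2)[of L] L v by (auto simp: c_def)
  have "y ((norm z)\<^sup>2) = x" by (simp add: y_def norm_z ln_realpow diff_divide_distrib)
  then have "v = 1 - g x / (norm z)\<^sup>2" by (simp add: v_def V_def)
  then have "1 - v = g x / (norm z)\<^sup>2" by simp
  moreover have "(norm z)\<^sup>2 \<noteq> 0" using r by linarith
  ultimately have "g x = (norm z)\<^sup>2 * (1 - v)" by simp
  then show ?thesis using main z unfolding g_def[symmetric] R_def[symmetric] c_def[symmetric] by simp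
qed

theorem theorem3p1:
  fixes lam :: real
  assumes "0 \<le> lam"
  shows "(\<exists>!p. maximal_solution lam (fst p) (snd p)) \<and>
    (\<forall>I g. maximal_solution lam I g \<longrightarrow>
       (lam < 2 \<longrightarrow> {0..} \<subseteq> I \<and> (\<forall>x\<ge>0. g x \<le> 0)) \<and>
       (lam < 1 \<longrightarrow>
         (\<forall>(M :: 'a measure) life offspring (motion :: label \<Rightarrow> real \<Rightarrow> 'a \<Rightarrow> real ^ 4) L R s.
            critical_binary_bbm M life offspring motion \<and> R = exp L \<and> R > 1 \<and> s = g L \<longrightarrow>
            (\<forall>x\<in>{0..L}. \<forall>z :: real ^ 4. norm z = exp (- x) * R \<longrightarrow>
               integrable M (\<lambda>\<omega>. (1 - s) ^ num_pioneers R z life offspring motion \<omega>) \<and>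
               g x = (exp (- x) * R)\<^sup>2 *
                 (1 - (\<integral>\<omega>. (1 - s) ^ num_pioneers R z life offspring motion \<omega> \<partial>M))))))"
proof (intro conjI allI impI)
  show "\<exists>!p. maximal_solution lam (fst p) (snd p)"
    unfolding maximal_solution_iff by (rule ex1I[of _ "(ivp_domain lam, ivp_max lam)"]) (simp_all add: prod_eq_iff)
next
  fix I g assume max: "maximal_solution lam I g" and "lam < 2"
  then show "{0..} \<subseteq> I"
    using assms ivp_max_bounds(1)[of lam] unfolding maximal_solution_iff by simp
  fix x :: real assume "0 \<le> x"
  then show "g x \<le> 0"
    using max assms \<open>lam < 2\<close> ivp_max_bounds(2)[of lam x] unfolding maximal_solution_iff by simp
next
  fix I g and M :: "'a measure" and life offspring and motion :: "label \<Rightarrow> real \<Rightarrow> 'a \<Rightarrow> real ^ 4" and L R s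
  assume max: "maximal_solution lam I g" and lam: "lam < 1"
    and *: "critical_binary_bbm M life offspring motion \<and> R = exp L \<and> R > 1 \<and> s = g L"
  then have g: "g = ivp_max lam" by (simp add: maximal_solution_iff)
  have "1 < exp L" using * by metis
  then have L: "0 < L" by simp
  show "\<forall>x\<in>{0..L}. \<forall>z :: real ^ 4. norm z = exp (- x) * R \<longrightarrow>
       integrable M (\<lambda>\<omega>. (1 - s) ^ num_pioneers R z life offspring motion \<omega>) \<and>
       g x = (exp (- x) * R)\<^sup>2 * (1 - (\<integral>\<omega>. (1 - s) ^ num_pioneers R z life offspring motion \<omega> \<partial>M))"
  proof (intro ballI allI impI)
    fix x and z :: "real ^ 4"
    assume x: "x \<in> {0..L}" and z: "norm z = exp (- x) * R"
    have "critical_binary_bbm M life offspring motion" and R: "R = exp L" and s: "s = ivp_max lam L"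
      using * g by simp_all
    from pioneer_representation[OF assms lam this(1) L x z[unfolded R]]
    show "integrable M (\<lambda>\<omega>. (1 - s) ^ num_pioneers R z life offspring motion \<omega>) \<and>
       g x = (exp (- x) * R)\<^sup>2 * (1 - (\<integral>\<omega>. (1 - s) ^ num_pioneers R z life offspring motion \<omega> \<partial>M))"
      unfolding R s g .
  qed
qed

end
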